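(* Let $p$ be a prime, let $d\ge 1$, and let $\Omega\subseteq\mathbb{Q}_p^d$ be a compact open subset. Then $L^2(\Omega)$ admits a Riesz basis consisting of characters in $\widehat{\mathbb{Q}_p^d}$.
   Context: $\mathbb{Q}_p$ is the field of $p$-adic numbers, and $\mathbb{Q}_p^d$ is regarded as an additive locally compact abelian group. $\widehat{\mathbb{Q}_p^d}$ is the group of its characters, i.e. continuous group homomorphisms to $\mathbb{T}=\{z\in\mathbb{C}:|z|=1\}$. $L^2(\Omega)$ is taken with respect to Haar measure restricted to $\Omega$. A countable family $\{f_n\}$ in a separable Hilbert space $\mathcal{H}$ is a Riesz basis if $f_n=Te_n$ for all $n$, for some bounded invertible operator $T:\mathcal{H}\to\mathcal{H}$ and some orthonormal basis $\{e_n\}$ of $\mathcal{H}$; equivalently, $\{f_n\}$ is complete in $\mathcal{H}$ and there is $K>0$ with $\frac1K\sum_n|a_n|^2\le\|\sum_n a_nf_n\|^2\le K\sum_n|a_n|^2$ for all square-summable $\{a_n\}\subset\mathbb{C}$. Characters are viewed as elements of $L^2(\Omega)$ by restriction to $\Omega$. *)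

theory Defs
  imports "HOL-Analysis.Analysis" "Berlekamp_Zassenhaus.Finite_Field"
begin

section \<open>The $p$-adic absolute value on the rationals\<close>

definition padic_val :: "nat \<Rightarrow> rat \<Rightarrow> int" where
  "padic_val p x = int (multiplicity (int p) (fst (quotient_of x)))
                 - int (multiplicity (int p) (snd (quotient_of x)))"

definition padic_abs :: "nat \<Rightarrow> rat \<Rightarrow> real" where
  "padic_abs p x = (if x = 0 then 0 else real p powi (- padic_val p x))"

lemma padic_val_Fract:
  assumes p: "prime p" and "a \<noteq> 0" "b \<noteq> 0"
  shows "padic_val p (Rat.Fract a b) = int (multiplicity (int p) a) - int (multiplicity (int p) b)"
proof -
  obtain c d where cd: "quotient_of (Rat.Fract a b) = (c, d)" by force
  have d: "d > 0" using quotient_of_denom_pos[OF cd] .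
  have "Rat.Fract a b = Rat.Fract c d" using quotient_of_div[OF cd] by (simp add: Fract_of_int_quotient)
  hence eq: "a * d = c * b" using assms d by (simp add: eq_rat)
  have c: "c \<noteq> 0" using eq assms d by auto
  have pe: "prime_elem (int p)" using p by simp
  have "multiplicity (int p) (a * d) = multiplicity (int p) a + multiplicity (int p) d"
    using pe assms d by (intro prime_elem_multiplicity_mult_distrib) auto
  moreover have "multiplicity (int p) (c * b) = multiplicity (int p) c + multiplicity (int p) b"
    using pe assms c by (intro prime_elem_multiplicity_mult_distrib) auto
  ultimately show ?thesis using eq unfolding padic_val_def cd by simp
qed

lemma padic_abs_zero [simp]: "padic_abs p 0 = 0"
  by (simp add: padic_abs_def)

lemma padic_abs_nonneg [simp]: "padic_abs p x \<ge> 0"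
  by (simp add: padic_abs_def)

lemma padic_abs_eq_0_iff [simp]: "prime p \<Longrightarrow> padic_abs p x = 0 \<longleftrightarrow> x = 0"
  by (auto simp: padic_abs_def power_int_eq_0_iff dest: prime_gt_0_nat)

lemma padic_abs_mult:
  assumes p: "prime p"
  shows "padic_abs p (x * y) = padic_abs p x * padic_abs p y"
proof (cases "x = 0 \<or> y = 0")
  case False
  obtain a b where x: "x = Rat.Fract a b" "b > 0" by (cases x) auto
  obtain c d where y: "y = Rat.Fract c d" "d > 0" by (cases y) auto
  have nz: "a \<noteq> 0" "b \<noteq> 0" "c \<noteq> 0" "d \<noteq> 0" using False x y by (auto simp: rat_number_collapse)
  have pe: "prime_elem (int p)" using p by simp
  have "padic_val p (x * y) = padic_val p x + padic_val p y"
    using nz pe by (simp add: x y padic_val_Fract[OF p] prime_elem_multiplicity_mult_distrib)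
  moreover have "real p \<noteq> 0" using p by (auto dest: prime_gt_0_nat)
  ultimately show ?thesis using False by (simp add: padic_abs_def flip: power_int_add)
qed auto

lemma padic_abs_one [simp]: "prime p \<Longrightarrow> padic_abs p 1 = 1"
  using padic_abs_mult[of p 1 1] by simp

lemma padic_abs_minus [simp]:
  assumes p: "prime p"
  shows "padic_abs p (- x) = padic_abs p x"
proof -
  have "padic_abs p (-1) * padic_abs p (-1) = 1"
    using padic_abs_mult[OF p, of "-1" "-1"] p by simp
  hence "padic_abs p (-1) = 1"
    by (metis padic_abs_nonneg power2_eq_1_iff power2_eq_square
        dual_order.trans not_one_le_zero zero_le_one neg_0_le_iff_le)
  thus ?thesis using padic_abs_mult[OF p, of "-1" x] by simp
qed

lemma padic_abs_minus_commute:
  assumes "prime p"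
  shows "padic_abs p (x - y) = padic_abs p (y - x)"
  using padic_abs_minus[OF assms, of "x - y"] by simp

lemma padic_abs_inverse:
  assumes p: "prime p"
  shows "padic_abs p (inverse x) = inverse (padic_abs p x)"
proof (cases "x = 0")
  case False
  hence "padic_abs p (inverse x) * padic_abs p x = 1"
    using padic_abs_mult[OF p, of "inverse x" x] p by simp
  thus ?thesis by (metis inverse_unique mult.commute)
qed auto

lemma padic_abs_add_le_max:
  assumes p: "prime p"
  shows "padic_abs p (x + y) \<le> max (padic_abs p x) (padic_abs p y)"
proof (cases "x = 0 \<or> y = 0 \<or> x + y = 0")
  case True
  thus ?thesis by (auto simp: le_max_iff_disj)
next
  case False
  obtain a b where x: "x = Rat.Fract a b" "b > 0" by (cases x) auto
  obtain c d where y: "y = Rat.Fract c d" "d > 0" by (cases y) auto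
  define m n k where "m = a * d" and "n = c * b" and "k = b * d"
  have k: "k \<noteq> 0" using x y by (simp add: k_def)
  have xk: "x = Rat.Fract m k" and yk: "y = Rat.Fract n k" and xy: "x + y = Rat.Fract (m + n) k"
    using x y by (simp_all add: m_def n_def k_def eq_rat algebra_simps)
  have nz: "m \<noteq> 0" "n \<noteq> 0" "m + n \<noteq> 0" using False xk yk xy by (auto simp: rat_number_collapse)
  define j where "j = min (multiplicity (int p) m) (multiplicity (int p) n)"
  have "int p ^ j dvd m" "int p ^ j dvd n" by (auto simp: j_def intro: multiplicity_dvd')
  hence "int p ^ j dvd m + n" by simp
  hence "j \<le> multiplicity (int p) (m + n)"
    using nz p by (intro multiplicity_geI) (auto dest: prime_gt_1_nat)
  hence "padic_val p (x + y) \<ge> min (padic_val p x) (padic_val p y)"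
    unfolding xk yk xy[unfolded xk yk] using nz k by (simp add: padic_val_Fract[OF p] j_def min_def split: if_splits)
  hence "- padic_val p (x + y) \<le> - padic_val p x \<or> - padic_val p (x + y) \<le> - padic_val p y"
    by linarith
  moreover have "real p \<ge> 1" using p by (auto dest: prime_gt_1_nat)
  ultimately have "real p powi (- padic_val p (x + y)) \<le> real p powi (- padic_val p x)
      \<or> real p powi (- padic_val p (x + y)) \<le> real p powi (- padic_val p y)"
    using power_int_increasing by blast
  thus ?thesis using False by (auto simp: padic_abs_def le_max_iff_disj)
qed

lemma padic_abs_triangle:
  assumes p: "prime p"
  shows "padic_abs p (x + y) \<le> padic_abs p x + padic_abs p y"
  using padic_abs_add_le_max[OF p, of x y] padic_abs_nonneg[of p x] padic_abs_nonneg[of p y]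
  by linarith

lemma padic_abs_diff_triangle:
  assumes p: "prime p"
  shows "\<bar>padic_abs p x - padic_abs p y\<bar> \<le> padic_abs p (x - y)"
  using padic_abs_triangle[OF p, of "x - y" y] padic_abs_triangle[OF p, of "y - x" x]
    padic_abs_minus_commute[OF p, of x y]
  by simp

section \<open>The field $\mathbb{Q}_p$ as the completion of $\mathbb{Q}$\<close>

definition padic_Cauchy :: "nat \<Rightarrow> (nat \<Rightarrow> rat) \<Rightarrow> bool" where
  "padic_Cauchy p X \<longleftrightarrow> (\<forall>e>0. \<exists>M. \<forall>m\<ge>M. \<forall>n\<ge>M. padic_abs p (X m - X n) < e)"

definition padic_null :: "nat \<Rightarrow> (nat \<Rightarrow> rat) \<Rightarrow> bool" where
  "padic_null p X \<longleftrightarrow> (\<lambda>n. padic_abs p (X n)) \<longlonglongrightarrow> 0"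

lemma padic_Cauchy_const [simp]: "padic_Cauchy p (\<lambda>n. c)"
  by (simp add: padic_Cauchy_def)

lemma padic_null_zero [simp]: "padic_null p (\<lambda>n. 0)"
  by (simp add: padic_null_def)

lemma padic_null_const: "prime p \<Longrightarrow> padic_null p (\<lambda>n. c) \<longleftrightarrow> c = 0"
  by (simp add: padic_null_def LIMSEQ_const_iff)

lemma padic_Cauchy_abs_tendsto:
  assumes p: "prime p" and X: "padic_Cauchy p X"
  shows "(\<lambda>n. padic_abs p (X n)) \<longlonglongrightarrow> lim (\<lambda>n. padic_abs p (X n))"
proof -
  have "Cauchy (\<lambda>n. padic_abs p (X n))"
    unfolding Cauchy_def dist_real_def
    using X[unfolded padic_Cauchy_def] padic_abs_diff_triangle[OF p]
    by (meson order_le_less_trans)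
  thus ?thesis using Cauchy_convergent convergent_LIMSEQ_iff by blast
qed

lemma padic_Cauchy_bounded:
  assumes p: "prime p" and X: "padic_Cauchy p X"
  obtains B where "B > 0" "\<And>n. padic_abs p (X n) \<le> B"
proof -
  have "Bseq (\<lambda>n. padic_abs p (X n))"
    using padic_Cauchy_abs_tendsto[OF p X] by (meson convergent_def convergent_imp_Bseq)
  thus ?thesis using that by (auto elim!: BseqE)
qed

lemma padic_Cauchy_add:
  assumes p: "prime p" and X: "padic_Cauchy p X" and Y: "padic_Cauchy p Y"
  shows "padic_Cauchy p (\<lambda>n. X n + Y n)"
  unfolding padic_Cauchy_def
proof (intro allI impI)
  fix e :: real assume "e > 0"
  obtain i where i: "\<forall>m\<ge>i. \<forall>n\<ge>i. padic_abs p (X m - X n) < e"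
    using X \<open>e > 0\<close> unfolding padic_Cauchy_def by blast
  obtain j where j: "\<forall>m\<ge>j. \<forall>n\<ge>j. padic_abs p (Y m - Y n) < e"
    using Y \<open>e > 0\<close> unfolding padic_Cauchy_def by blast
  have "padic_abs p ((X m + Y m) - (X n + Y n)) < e" if "m \<ge> max i j" "n \<ge> max i j" for m n
  proof -
    have "(X m + Y m) - (X n + Y n) = (X m - X n) + (Y m - Y n)" by simp
    moreover have "padic_abs p (X m - X n) < e" "padic_abs p (Y m - Y n) < e"
      using i j that by auto
    ultimately show ?thesis
      using padic_abs_add_le_max[OF p, of "X m - X n" "Y m - Y n"] by (auto simp only: max_less_iff_conj intro: order_le_less_trans)
  qed
  thus "\<exists>M. \<forall>m\<ge>M. \<forall>n\<ge>M. padic_abs p ((X m + Y m) - (X n + Y n)) < e" by blast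
qed

lemma padic_Cauchy_mult:
  assumes p: "prime p" and X: "padic_Cauchy p X" and Y: "padic_Cauchy p Y"
  shows "padic_Cauchy p (\<lambda>n. X n * Y n)"
  unfolding padic_Cauchy_def
proof (intro allI impI)
  fix e :: real assume e: "e > 0"
  obtain A where A: "A > 0" "\<And>n. padic_abs p (X n) \<le> A" by (rule padic_Cauchy_bounded[OF p X]) blast
  obtain B where B: "B > 0" "\<And>n. padic_abs p (Y n) \<le> B" by (rule padic_Cauchy_bounded[OF p Y]) blast
  have "e / B > 0" "e / A > 0" using e A B by auto
  then obtain i j where i: "\<forall>m\<ge>i. \<forall>n\<ge>i. padic_abs p (X m - X n) < e / B"
    and j: "\<forall>m\<ge>j. \<forall>n\<ge>j. padic_abs p (Y m - Y n) < e / A"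
    using X Y unfolding padic_Cauchy_def by meson
  have "padic_abs p (X m * Y m - X n * Y n) < e" if "m \<ge> max i j" "n \<ge> max i j" for m n
  proof -
    have eq: "X m * Y m - X n * Y n = X m * (Y m - Y n) + (X m - X n) * Y n"
      by (simp add: algebra_simps)
    have "padic_abs p (X m * (Y m - Y n)) \<le> A * padic_abs p (Y m - Y n)"
      using A by (simp add: padic_abs_mult[OF p] mult_right_mono)
    also have "\<dots> < A * (e / A)" using j that A by (intro mult_strict_left_mono) auto
    finally have 1: "padic_abs p (X m * (Y m - Y n)) < e" using A by simp
    have "padic_abs p ((X m - X n) * Y n) \<le> padic_abs p (X m - X n) * B"
      using B by (simp add: padic_abs_mult[OF p] mult_left_mono)
    also have "\<dots> < (e / B) * B" using i that B by (intro mult_strict_right_mono) auto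
    finally have 2: "padic_abs p ((X m - X n) * Y n) < e" using B by simp
    show ?thesis
      unfolding eq using 1 2 padic_abs_add_le_max[OF p, of "X m * (Y m - Y n)" "(X m - X n) * Y n"]
      by simp
  qed
  thus "\<exists>M. \<forall>m\<ge>M. \<forall>n\<ge>M. padic_abs p (X m * Y m - X n * Y n) < e" by blast
qed

lemma padic_Cauchy_minus:
  assumes p: "prime p" and X: "padic_Cauchy p X"
  shows "padic_Cauchy p (\<lambda>n. - X n)"
  using padic_Cauchy_mult[OF p padic_Cauchy_const[of p "-1"] X] by simp

lemma padic_Cauchy_diff:
  assumes p: "prime p" and X: "padic_Cauchy p X" and Y: "padic_Cauchy p Y"
  shows "padic_Cauchy p (\<lambda>n. X n - Y n)"
  using padic_Cauchy_add[OF p X padic_Cauchy_minus[OF p Y]] by simp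

lemma padic_null_add:
  assumes p: "prime p" and X: "padic_null p X" and Y: "padic_null p Y"
  shows "padic_null p (\<lambda>n. X n + Y n)"
  unfolding padic_null_def
proof (rule tendsto_sandwich[OF _ _ tendsto_const])
  show "(\<lambda>n. padic_abs p (X n) + padic_abs p (Y n)) \<longlonglongrightarrow> 0"
    using tendsto_add[OF X[unfolded padic_null_def] Y[unfolded padic_null_def]] by simp
qed (auto simp: padic_abs_triangle[OF p])

lemma padic_null_mult:
  assumes p: "prime p" and X: "padic_Cauchy p X" and Y: "padic_null p Y"
  shows "padic_null p (\<lambda>n. X n * Y n)"
  using tendsto_mult[OF padic_Cauchy_abs_tendsto[OF p X] Y[unfolded padic_null_def]]
  by (simp add: padic_null_def padic_abs_mult[OF p])

lemma padic_null_minus: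
  assumes p: "prime p" and X: "padic_null p X"
  shows "padic_null p (\<lambda>n. - X n)"
  using X p by (simp add: padic_null_def)

lemma padic_null_diff:
  assumes p: "prime p" and X: "padic_null p X" and Y: "padic_null p Y"
  shows "padic_null p (\<lambda>n. X n - Y n)"
  using padic_null_add[OF p X padic_null_minus[OF p Y]] by simp

lemma padic_not_null:
  assumes p: "prime p" and X: "padic_Cauchy p X" and nz: "\<not> padic_null p X"
  obtains b M where "b > 0" "\<And>n. n \<ge> M \<Longrightarrow> b < padic_abs p (X n)"
proof -
  define l where "l = lim (\<lambda>n. padic_abs p (X n))"
  have lim: "(\<lambda>n. padic_abs p (X n)) \<longlonglongrightarrow> l"
    unfolding l_def using p X by (rule padic_Cauchy_abs_tendsto)
  have "l \<ge> 0" using lim by (rule LIMSEQ_le_const) auto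
  moreover have "l \<noteq> 0" using nz lim unfolding padic_null_def by auto
  ultimately have l: "l > 0" by simp
  have "\<forall>\<^sub>F n in sequentially. l / 2 < padic_abs p (X n)"
    using order_tendstoD(1)[OF lim, of "l/2"] l by simp
  thus ?thesis using that[of "l/2"] l unfolding eventually_sequentially by auto
qed

lemma padic_Cauchy_inverse:
  assumes p: "prime p" and X: "padic_Cauchy p X" and nz: "\<not> padic_null p X"
  shows "padic_Cauchy p (\<lambda>n. inverse (X n))"
  unfolding padic_Cauchy_def
proof (intro allI impI)
  fix e :: real assume e: "e > 0"
  obtain b M where b: "b > 0" and M: "\<And>n. n \<ge> M \<Longrightarrow> b < padic_abs p (X n)"
    using padic_not_null[OF p X nz] by metis
  have "e * (b * b) > 0" using e b by simp
  then obtain i where i: "\<forall>m\<ge>i. \<forall>n\<ge>i. padic_abs p (X m - X n) < e * (b * b)"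
    using X unfolding padic_Cauchy_def by meson
  have "padic_abs p (inverse (X m) - inverse (X n)) < e" if mn: "m \<ge> max i M" "n \<ge> max i M" for m n
  proof -
    have bm: "b < padic_abs p (X m)" and bn: "b < padic_abs p (X n)" using M mn by auto
    hence nz: "X m \<noteq> 0" "X n \<noteq> 0" using b by auto
    have "inverse (X m) - inverse (X n) = inverse (X m) * (X n - X m) * inverse (X n)"
      using nz by (simp add: field_simps)
    hence "padic_abs p (inverse (X m) - inverse (X n))
        = padic_abs p (X n - X m) / (padic_abs p (X m) * padic_abs p (X n))"
      by (simp add: padic_abs_mult[OF p] padic_abs_inverse[OF p] divide_inverse ac_simps)
    also have "\<dots> \<le> padic_abs p (X n - X m) / (b * b)"
      using b bm bn by (intro divide_left_mono mult_mono) auto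
    also have "\<dots> < e" using i mn b by (simp add: divide_less_eq)
    finally show ?thesis .
  qed
  thus "\<exists>M. \<forall>m\<ge>M. \<forall>n\<ge>M. padic_abs p (inverse (X m) - inverse (X n)) < e" by blast
qed

lemma padic_null_inverse_mult:
  assumes p: "prime p" and X: "padic_Cauchy p X" and nz: "\<not> padic_null p X"
  shows "padic_null p (\<lambda>n. inverse (X n) * X n - 1)"
proof -
  obtain b M where b: "b > 0" and M: "\<And>n. n \<ge> M \<Longrightarrow> b < padic_abs p (X n)"
    using padic_not_null[OF p X nz] by metis
  have "inverse (X n) * X n - 1 = 0" if "n \<ge> M" for n
    using M[OF that] b by (cases "X n = 0") auto
  hence "\<forall>\<^sub>F n in sequentially. padic_abs p (inverse (X n) * X n - 1) = 0"
    unfolding eventually_sequentially by (metis padic_abs_zero)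
  thus ?thesis unfolding padic_null_def by (rule tendsto_eventually)
qed

lemma padic_null_diff_inverse:
  assumes p: "prime p" and X: "padic_Cauchy p X" "\<not> padic_null p X"
    and Y: "padic_Cauchy p Y" "\<not> padic_null p Y" and XY: "padic_null p (\<lambda>n. X n - Y n)"
  shows "padic_null p (\<lambda>n. inverse (X n) - inverse (Y n))"
proof -
  let ?X' = "\<lambda>n. inverse (X n)" and ?Y' = "\<lambda>n. inverse (Y n)"
  note cX = padic_Cauchy_inverse[OF p X] and cY = padic_Cauchy_inverse[OF p Y]
  have 1: "padic_null p (\<lambda>n. (?X' n * ?Y' n) * (X n - Y n))"
    by (intro padic_null_mult padic_Cauchy_mult p cX cY XY)
  have 2: "padic_null p (\<lambda>n. ?X' n * (?Y' n * Y n - 1))"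
    by (intro padic_null_mult padic_null_inverse_mult p cX Y)
  have 3: "padic_null p (\<lambda>n. ?Y' n * (?X' n * X n - 1))"
    by (intro padic_null_mult padic_null_inverse_mult p cY X)
  have eq: "inverse (X n) - inverse (Y n) = (?Y' n * (?X' n * X n - 1) - ?X' n * (?Y' n * Y n - 1))
      - (?X' n * ?Y' n) * (X n - Y n) " for n by (simp add: algebra_simps)
  show ?thesis unfolding eq by (intro padic_null_diff p 1 2 3)
qed

text \<open>
  The prime is carried by the type: for \<^typ>\<open>'p::prime_card\<close>, the prime is \<^term>\<open>CARD('p)\<close>. Every
  prime is the cardinality of some type, so a theorem about a free \<^typ>\<open>'p\<close> covers all primes.
\<close>

typedef (overloaded) 'p padic_seq = "{X. padic_Cauchy CARD('p::prime_card) X}"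
  by (rule exI[of _ "\<lambda>_. 0"]) simp

setup_lifting type_definition_padic_seq

instantiation padic_seq :: (prime_card) comm_ring_1
begin

lift_definition zero_padic_seq :: "'a padic_seq" is "\<lambda>n. 0" by simp
lift_definition one_padic_seq :: "'a padic_seq" is "\<lambda>n. 1" by simp
lift_definition plus_padic_seq :: "'a padic_seq \<Rightarrow> 'a padic_seq \<Rightarrow> 'a padic_seq" is "\<lambda>X Y n. X n + Y n"
  by (rule padic_Cauchy_add[OF prime_card])
lift_definition minus_padic_seq :: "'a padic_seq \<Rightarrow> 'a padic_seq \<Rightarrow> 'a padic_seq" is "\<lambda>X Y n. X n - Y n"
  by (rule padic_Cauchy_diff[OF prime_card])
lift_definition uminus_padic_seq :: "'a padic_seq \<Rightarrow> 'a padic_seq" is "\<lambda>X n. - X n"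
  by (rule padic_Cauchy_minus[OF prime_card])
lift_definition times_padic_seq :: "'a padic_seq \<Rightarrow> 'a padic_seq \<Rightarrow> 'a padic_seq" is "\<lambda>X Y n. X n * Y n"
  by (rule padic_Cauchy_mult[OF prime_card])

instance
  by standard (transfer; simp add: algebra_simps fun_eq_iff)+

end

lift_definition padic_seq_null :: "'p::prime_card padic_seq \<Rightarrow> bool" is "padic_null CARD('p)" .

lift_definition padic_seq_inverse :: "'p::prime_card padic_seq \<Rightarrow> 'p padic_seq"
  is "\<lambda>X. if padic_null CARD('p) X then (\<lambda>n. 0) else (\<lambda>n. inverse (X n))"
  by (auto intro: padic_Cauchy_inverse[OF prime_card])

lift_definition padic_seq_abs :: "'p::prime_card padic_seq \<Rightarrow> real"
  is "\<lambda>X. lim (\<lambda>n. padic_abs CARD('p) (X n))" .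

lemma padic_seq_null_0 [simp]: "padic_seq_null 0"
  by transfer simp

lemma padic_seq_null_1 [simp]: "\<not> padic_seq_null 1"
  by transfer (simp add: padic_null_const[OF prime_card])

lemma padic_seq_null_add: "padic_seq_null X \<Longrightarrow> padic_seq_null Y \<Longrightarrow> padic_seq_null (X + Y)"
  by transfer (rule padic_null_add[OF prime_card])

lemma padic_seq_null_minus: "padic_seq_null X \<Longrightarrow> padic_seq_null (- X)"
  by transfer (rule padic_null_minus[OF prime_card])

lemma padic_seq_null_diff: "padic_seq_null X \<Longrightarrow> padic_seq_null Y \<Longrightarrow> padic_seq_null (X - Y)"
  by transfer (rule padic_null_diff[OF prime_card])

lemma padic_seq_null_mult: "padic_seq_null Y \<Longrightarrow> padic_seq_null (X * Y)"
  by transfer (rule padic_null_mult[OF prime_card])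

lemma padic_seq_null_inverse_mult: "\<not> padic_seq_null X \<Longrightarrow> padic_seq_null (padic_seq_inverse X * X - 1)"
  by transfer (simp add: padic_null_inverse_mult[OF prime_card])

lemma padic_seq_null_cong: "padic_seq_null (X - Y) \<Longrightarrow> padic_seq_null X \<longleftrightarrow> padic_seq_null Y"
  using padic_seq_null_add[of "X - Y" Y] padic_seq_null_diff[of X "X - Y"] by auto

lemma padic_seq_null_diff_inverse:
  assumes "padic_seq_null (X - Y)"
  shows "padic_seq_null (padic_seq_inverse X - padic_seq_inverse Y)"
proof (cases "padic_seq_null X")
  case True
  hence "padic_seq_null Y" using padic_seq_null_cong[OF assms] by simp
  with True show ?thesis by transfer simp
next
  case False
  hence "\<not> padic_seq_null Y" using padic_seq_null_cong[OF assms] by simp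
  with False assms show ?thesis by transfer (simp add: padic_null_diff_inverse[OF prime_card])
qed

lemma padic_seq_abs_tendsto:
  fixes X :: "'p::prime_card padic_seq"
  shows "(\<lambda>n. padic_abs CARD('p) (Rep_padic_seq X n)) \<longlonglongrightarrow> padic_seq_abs X"
  using padic_Cauchy_abs_tendsto[OF prime_card] Rep_padic_seq[of X]
  by (simp add: padic_seq_abs.rep_eq)

lemma padic_seq_abs_eq_0_iff: "padic_seq_abs X = 0 \<longleftrightarrow> padic_seq_null X"
  unfolding padic_seq_null.rep_eq padic_null_def
  by (metis LIMSEQ_unique padic_seq_abs_tendsto)

lemma padic_seq_abs_cong:
  fixes X Y :: "'p::prime_card padic_seq"
  assumes "padic_seq_null (X - Y)"
  shows "padic_seq_abs X = padic_seq_abs Y"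
proof -
  let ?N = "padic_abs CARD('p)"
  have 0: "(\<lambda>n. ?N (Rep_padic_seq X n - Rep_padic_seq Y n)) \<longlonglongrightarrow> 0"
    using assms by (simp add: padic_seq_null.rep_eq padic_null_def minus_padic_seq.rep_eq)
  have "(\<lambda>n. ?N (Rep_padic_seq X n) - ?N (Rep_padic_seq Y n)) \<longlonglongrightarrow> 0"
    by (rule Lim_null_comparison[OF _ 0]) (simp add: padic_abs_diff_triangle[OF prime_card])
  moreover have "(\<lambda>n. ?N (Rep_padic_seq X n) - ?N (Rep_padic_seq Y n))
      \<longlonglongrightarrow> padic_seq_abs X - padic_seq_abs Y"
    by (intro tendsto_diff padic_seq_abs_tendsto)
  ultimately have "padic_seq_abs X - padic_seq_abs Y = 0" by (metis LIMSEQ_unique)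
  thus ?thesis by simp
qed

lemma padic_seq_abs_add_le: "padic_seq_abs (X + Y) \<le> max (padic_seq_abs X) (padic_seq_abs Y)"
  for X Y :: "'p::prime_card padic_seq"
proof (rule LIMSEQ_le[OF padic_seq_abs_tendsto])
  let ?N = "padic_abs CARD('p)"
  show "(\<lambda>n. max (?N (Rep_padic_seq X n)) (?N (Rep_padic_seq Y n)))
      \<longlonglongrightarrow> max (padic_seq_abs X) (padic_seq_abs Y)"
    by (intro tendsto_max padic_seq_abs_tendsto)
  show "\<exists>M. \<forall>n\<ge>M. ?N (Rep_padic_seq (X + Y) n) \<le> max (?N (Rep_padic_seq X n)) (?N (Rep_padic_seq Y n))"
    by (simp add: plus_padic_seq.rep_eq padic_abs_add_le_max[OF prime_card])
qed

lemma padic_seq_abs_minus [simp]: "padic_seq_abs (- X) = padic_seq_abs X"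
  by transfer (simp add: padic_abs_minus[OF prime_card])

lemma padic_seq_abs_mult: "padic_seq_abs (X * Y) = padic_seq_abs X * padic_seq_abs Y"
  using LIMSEQ_unique[OF padic_seq_abs_tendsto[of "X * Y"]]
    tendsto_mult[OF padic_seq_abs_tendsto[of X] padic_seq_abs_tendsto[of Y]]
  by (simp add: times_padic_seq.rep_eq padic_abs_mult[OF prime_card])

lemma padic_seq_abs_nonneg: "padic_seq_abs X \<ge> 0"
  by (rule LIMSEQ_le_const[OF padic_seq_abs_tendsto]) auto

definition padic_rel :: "'p::prime_card padic_seq \<Rightarrow> 'p padic_seq \<Rightarrow> bool" where
  "padic_rel X Y \<longleftrightarrow> padic_seq_null (X - Y)"

quotient_type (overloaded) 'p padic = "'p::prime_card padic_seq" / padic_rel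
proof (rule equivpI)
  show "reflp (padic_rel :: 'p padic_seq \<Rightarrow> _)" by (rule reflpI) (simp add: padic_rel_def)
  show "symp (padic_rel :: 'p padic_seq \<Rightarrow> _)"
    by (rule sympI) (metis padic_rel_def padic_seq_null_minus minus_diff_eq)
  show "transp (padic_rel :: 'p padic_seq \<Rightarrow> _)"
  proof (rule transpI)
    fix X Y Z :: "'p padic_seq" assume "padic_rel X Y" "padic_rel Y Z"
    thus "padic_rel X Z"
      using padic_seq_null_add[of "X - Y" "Y - Z"] by (simp add: padic_rel_def)
  qed
qed

lemma padic_rel_add:
  "padic_rel X X' \<Longrightarrow> padic_rel Y Y' \<Longrightarrow> padic_rel (X + Y) (X' + Y')"
  using padic_seq_null_add[of "X - X'" "Y - Y'"] by (simp add: padic_rel_def algebra_simps)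

lemma padic_rel_minus: "padic_rel X X' \<Longrightarrow> padic_rel (- X) (- X')"
  using padic_seq_null_minus[of "X - X'"] by (simp add: padic_rel_def)

lemma padic_rel_diff:
  "padic_rel X X' \<Longrightarrow> padic_rel Y Y' \<Longrightarrow> padic_rel (X - Y) (X' - Y')"
  using padic_rel_add[of X X' "- Y" "- Y'"] padic_rel_minus[of Y Y'] by simp

lemma padic_rel_mult:
  assumes "padic_rel X X'" and "padic_rel Y Y'"
  shows "padic_rel (X * Y) (X' * Y')"
proof -
  have "X * Y - X' * Y' = Y * (X - X') + X' * (Y - Y')" by (simp add: algebra_simps)
  thus ?thesis
    using assms padic_seq_null_add[OF padic_seq_null_mult[of "X - X'" Y] padic_seq_null_mult[of "Y - Y'" X']]
    by (simp only: padic_rel_def)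
qed

instantiation padic :: (prime_card) field
begin

lift_definition zero_padic :: "'a padic" is 0 .
lift_definition one_padic :: "'a padic" is 1 .

lift_definition plus_padic :: "'a padic \<Rightarrow> 'a padic \<Rightarrow> 'a padic" is "(+)"
  by (rule padic_rel_add)

lift_definition minus_padic :: "'a padic \<Rightarrow> 'a padic \<Rightarrow> 'a padic" is "(-)"
  by (rule padic_rel_diff)

lift_definition uminus_padic :: "'a padic \<Rightarrow> 'a padic" is uminus
  by (rule padic_rel_minus)

lift_definition times_padic :: "'a padic \<Rightarrow> 'a padic \<Rightarrow> 'a padic" is "(*)"
  by (rule padic_rel_mult)

lift_definition inverse_padic :: "'a padic \<Rightarrow> 'a padic" is padic_seq_inverse
  unfolding padic_rel_def by (rule padic_seq_null_diff_inverse)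

definition divide_padic :: "'a padic \<Rightarrow> 'a padic \<Rightarrow> 'a padic" where
  "divide_padic x y = x * inverse y"

instance
proof
  fix a b c :: "'a padic"
  show "a + b + c = a + (b + c)" by transfer (simp add: padic_rel_def add.assoc)
  show "a + b = b + a" by transfer (simp add: padic_rel_def add.commute)
  show "0 + a = a" by transfer (simp add: padic_rel_def)
  show "- a + a = 0" by transfer (simp add: padic_rel_def)
  show "a - b = a + - b" by transfer (simp add: padic_rel_def)
  show "a * b * c = a * (b * c)" by transfer (simp add: padic_rel_def mult.assoc)
  show "a * b = b * a" by transfer (simp add: padic_rel_def mult.commute)
  show "1 * a = a" by transfer (simp add: padic_rel_def)
  show "(a + b) * c = a * c + b * c" by transfer (simp add: padic_rel_def distrib_right)
  show "(0::'a padic) \<noteq> 1"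
    by transfer (use padic_seq_null_minus[of "- 1"] in \<open>auto simp: padic_rel_def\<close>)
  show "a \<noteq> 0 \<Longrightarrow> inverse a * a = 1"
    by transfer (simp add: padic_rel_def padic_seq_null_inverse_mult)
  show "a div b = a * inverse b" by (rule divide_padic_def)
  show "inverse (0::'a padic) = 0"
    by transfer (unfold padic_rel_def, transfer, simp)
qed

end

lift_definition padic_norm :: "'p::prime_card padic \<Rightarrow> real" is padic_seq_abs
  unfolding padic_rel_def by (rule padic_seq_abs_cong)

lemma padic_norm_nonneg [simp]: "padic_norm x \<ge> 0"
  by transfer (rule padic_seq_abs_nonneg)

lemma padic_norm_eq_0_iff [simp]: "padic_norm x = 0 \<longleftrightarrow> x = 0"
  by transfer (simp add: padic_seq_abs_eq_0_iff padic_rel_def)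

lemma padic_norm_minus [simp]: "padic_norm (- x) = padic_norm x"
  by transfer simp

lemma padic_norm_mult: "padic_norm (x * y) = padic_norm x * padic_norm y"
  by transfer (rule padic_seq_abs_mult)

lemma padic_norm_add_le_max: "padic_norm (x + y) \<le> max (padic_norm x) (padic_norm y)"
  by transfer (rule padic_seq_abs_add_le)

lemma padic_norm_of_nat: "padic_norm (of_nat n :: 'p::prime_card padic) = padic_abs CARD('p) (of_nat n)"
proof -
  have "Rep_padic_seq (of_nat n :: 'p padic_seq) = (\<lambda>_. of_nat n)"
    by (induction n) (simp_all add: zero_padic_seq.rep_eq one_padic_seq.rep_eq plus_padic_seq.rep_eq)
  hence "padic_seq_abs (of_nat n :: 'p padic_seq) = padic_abs CARD('p) (of_nat n)"
    using padic_seq_abs_tendsto[of "of_nat n :: 'p padic_seq"] by (simp add: LIMSEQ_const_iff)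
  moreover have "of_nat n = abs_padic (of_nat n :: 'p padic_seq)"
    by (induction n) (simp_all add: zero_padic_def one_padic_def plus_padic.abs_eq)
  ultimately show ?thesis by (simp add: padic_norm.abs_eq)
qed

instantiation padic :: (prime_card) metric_space
begin

definition dist_padic :: "'a padic \<Rightarrow> 'a padic \<Rightarrow> real" where
  "dist_padic x y = padic_norm (x - y)"

definition uniformity_padic :: "('a padic \<times> 'a padic) filter" where
  "uniformity_padic = (INF e\<in>{0<..}. principal {(x, y). dist x y < e})"

definition open_padic :: "'a padic set \<Rightarrow> bool" where
  "open_padic U \<longleftrightarrow> (\<forall>x\<in>U. eventually (\<lambda>(x', y). x' = x \<longrightarrow> y \<in> U) uniformity)"

instance
proof
  fix x y z :: "'a padic"
  show "dist x y = 0 \<longleftrightarrow> x = y" by (simp add: dist_padic_def)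
  have "padic_norm (x - y) \<le> max (padic_norm (x - z)) (padic_norm (z - y))"
    using padic_norm_add_le_max[of "x - z" "z - y"] by simp
  also have "padic_norm (z - y) = padic_norm (y - z)" using padic_norm_minus[of "z - y"] by simp
  also have "max (padic_norm (x - z)) (padic_norm (y - z)) \<le> padic_norm (x - z) + padic_norm (y - z)"
    by simp
  finally show "dist x y \<le> dist x z + dist y z" by (simp add: dist_padic_def)
qed (simp_all add: uniformity_padic_def open_padic_def)

end

instance padic :: (prime_card) topological_ab_group_add
proof
  fix a b :: "'a padic"
  have *: "dist (x + y) (a + b) \<le> dist x a + dist y b" for x y
  proof -
    have "padic_norm ((x - a) + (y - b)) \<le> padic_norm (x - a) + padic_norm (y - b)"
      using padic_norm_add_le_max[of "x - a" "y - b"] padic_norm_nonneg[of "x - a"]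
        padic_norm_nonneg[of "y - b"] by linarith
    thus ?thesis by (simp add: dist_padic_def algebra_simps)
  qed
  have 0: "((\<lambda>z. dist (fst z) a + dist (snd z) b) \<longlongrightarrow> 0) (nhds a \<times>\<^sub>F nhds b)"
  proof -
    have "((\<lambda>z. dist (fst z) a + dist (snd z) b) \<longlongrightarrow> dist a a + dist b b) (nhds a \<times>\<^sub>F nhds b)"
      by (intro tendsto_intros filterlim_fst filterlim_snd)
    thus ?thesis by simp
  qed
  show "((\<lambda>x. fst x + snd x) \<longlongrightarrow> a + b) (nhds a \<times>\<^sub>F nhds b)"
    by (subst tendsto_dist_iff, rule tendsto_sandwich[OF _ _ tendsto_const 0]) (auto simp: *)
  have "dist (- x) (- a) = dist x a" for x
    using padic_norm_minus[of "x - a"] by (simp add: dist_padic_def)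
  hence "((\<lambda>x. dist (- x) (- a)) \<longlongrightarrow> dist a a) (nhds a)"
    by (simp only:) (intro tendsto_intros filterlim_ident)
  thus "(uminus \<longlongrightarrow> - a) (nhds a)" by (subst tendsto_dist_iff) simp
qed

instance vec :: (topological_monoid_add, finite) topological_monoid_add
proof
  fix a b :: "'a ^ 'b"
  show "((\<lambda>x. fst x + snd x) \<longlongrightarrow> a + b) (nhds a \<times>\<^sub>F nhds b)"
    by (rule vec_tendstoI)
      (auto intro!: tendsto_add tendsto_vec_nth filterlim_fst filterlim_snd)
qed

instance vec :: (topological_comm_monoid_add, finite) topological_comm_monoid_add ..

instance vec :: (topological_group_add, finite) topological_group_add
proof
  fix a :: "'a ^ 'b"
  show "(uminus \<longlongrightarrow> - a) (nhds a)"
    by (rule vec_tendstoI) (auto intro!: tendsto_minus tendsto_vec_nth filterlim_ident)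
qed

instance vec :: (topological_ab_group_add, finite) topological_ab_group_add ..

section \<open>Characters and Haar measure\<close>

definition is_character :: "('a::topological_ab_group_add \<Rightarrow> complex) \<Rightarrow> bool" where
  "is_character \<psi> \<longleftrightarrow>
     continuous_on UNIV \<psi> \<and> (\<forall>x. cmod (\<psi> x) = 1) \<and> (\<forall>x y. \<psi> (x + y) = \<psi> x * \<psi> y)"

text \<open>
  The last three clauses say that \<open>\<mu>\<close> is a Radon measure. Haar measure is unique only up to a positive
  factor, and no normalisation is fixed here.
\<close>

definition is_haar_measure :: "'a::topological_ab_group_add measure \<Rightarrow> bool" where
  "is_haar_measure \<mu> \<longleftrightarrow>
     sets \<mu> = sets borel \<and>
     emeasure \<mu> UNIV \<noteq> 0 \<and>
     (\<forall>a. \<forall>A\<in>sets borel. emeasure \<mu> ((+) a ` A) = emeasure \<mu> A) \<and>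
     (\<forall>K. compact K \<longrightarrow> emeasure \<mu> K < \<infinity>) \<and>
     (\<forall>A\<in>sets borel. emeasure \<mu> A = (INF U\<in>{U. open U \<and> A \<subseteq> U}. emeasure \<mu> U)) \<and>
     (\<forall>U. open U \<longrightarrow> emeasure \<mu> U = (SUP K\<in>{K. compact K \<and> K \<subseteq> U}. emeasure \<mu> K))"

section \<open>$L^2$ spaces and Riesz bases\<close>

text \<open>
  Elements of $L^2(M)$ are handled through representatives, equality in $L^2(M)$ being equality
  almost everywhere.
\<close>

definition L2 :: "'a measure \<Rightarrow> ('a \<Rightarrow> complex) set" where
  "L2 M = {f \<in> borel_measurable M. integrable M (\<lambda>x. (cmod (f x))\<^sup>2)}"

definition L2_inner :: "'a measure \<Rightarrow> ('a \<Rightarrow> complex) \<Rightarrow> ('a \<Rightarrow> complex) \<Rightarrow> complex" where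
  "L2_inner M f g = (LINT x|M. f x * cnj (g x))"

definition L2_norm :: "'a measure \<Rightarrow> ('a \<Rightarrow> complex) \<Rightarrow> real" where
  "L2_norm M f = sqrt (LINT x|M. (cmod (f x))\<^sup>2)"

definition L2_orthonormal_basis :: "'a measure \<Rightarrow> 'i set \<Rightarrow> ('i \<Rightarrow> 'a \<Rightarrow> complex) \<Rightarrow> bool" where
  "L2_orthonormal_basis M I e \<longleftrightarrow>
     (\<forall>n\<in>I. e n \<in> L2 M) \<and>
     (\<forall>m\<in>I. \<forall>n\<in>I. L2_inner M (e m) (e n) = (if m = n then 1 else 0)) \<and>
     (\<forall>f\<in>L2 M. \<forall>\<epsilon>>0. \<exists>J c. finite J \<and> J \<subseteq> I \<and> L2_norm M (\<lambda>x. f x - (\<Sum>n\<in>J. c n * e n x)) < \<epsilon>)"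

text \<open>
  A map on representatives that is linear up to null sets and bounded sends a.e.-equal functions to
  a.e.-equal functions, so it induces a bounded operator on $L^2(M)$; every bounded operator arises
  in this way.
\<close>

definition L2_bounded_operator :: "'a measure \<Rightarrow> (('a \<Rightarrow> complex) \<Rightarrow> 'a \<Rightarrow> complex) \<Rightarrow> bool" where
  "L2_bounded_operator M T \<longleftrightarrow>
     (\<forall>f\<in>L2 M. T f \<in> L2 M) \<and>
     (\<forall>f\<in>L2 M. \<forall>g\<in>L2 M. \<forall>a b. AE x in M. T (\<lambda>y. a * f y + b * g y) x = a * T f x + b * T g x) \<and>
     (\<exists>C. \<forall>f\<in>L2 M. L2_norm M (T f) \<le> C * L2_norm M f)"

definition L2_bounded_invertible :: "'a measure \<Rightarrow> (('a \<Rightarrow> complex) \<Rightarrow> 'a \<Rightarrow> complex) \<Rightarrow> bool" where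
  "L2_bounded_invertible M T \<longleftrightarrow> L2_bounded_operator M T \<and>
     (\<exists>S. L2_bounded_operator M S \<and>
       (\<forall>f\<in>L2 M. (AE x in M. S (T f) x = f x) \<and> (AE x in M. T (S f) x = f x)))"

definition L2_riesz_basis :: "'a measure \<Rightarrow> 'i set \<Rightarrow> ('i \<Rightarrow> 'a \<Rightarrow> complex) \<Rightarrow> bool" where
  "L2_riesz_basis M I f \<longleftrightarrow> countable I \<and> (\<forall>n\<in>I. f n \<in> L2 M) \<and>
     (\<exists>T e. L2_bounded_invertible M T \<and> L2_orthonormal_basis M I e \<and>
       (\<forall>n\<in>I. AE x in M. f n x = T (e n) x))"

end

theory Submission
  imports Defs
begin

text \<open>
  Let \<open>G\<close> be the group \<open>\<rat>\<^sub>p\<^sup>d\<close>. The set \<open>\<Omega>\<close> is a disjoint union of finitely many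
  cosets \<open>a + S\<close>, \<open>a \<in> A\<close>, of one small compact open subgroup \<open>S\<close>, namely a ball. Choose a set \<open>\<Lambda>\<close> of
  characters of \<open>G\<close> whose restrictions to \<open>S\<close> are pairwise distinct and exhaust the restrictions of
  characters to \<open>S\<close>. Up to a common scalar the functions \<open>\<phi> \<cdot> 1\<^bsub>a + S\<^esub>\<close>, with \<open>\<phi> \<in> \<Lambda>\<close> and \<open>a \<in> A\<close>, form an
  orthonormal basis of \<open>L\<^sup>2(\<Omega>)\<close>: orthogonality is the vanishing of the integral of a nontrivial character
  over \<open>S\<close>, and completeness follows from the density of locally constant functions together with
  the fact that characters separate points.

  These functions are supported on single cosets and are not characters. The remedy is linear
  algebra on the finite set \<open>A\<close>. The characters that are trivial on \<open>S\<close> are constant on each coset, and they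
  separate the points of \<open>A\<close>; hence one can pick \<open>|A|\<close> of them, \<open>\<theta>\<^sub>j\<close> for \<open>j \<in> A\<close>, such that the matrix
  \<open>(\<theta>\<^sub>j(a))\<close> is invertible (\<open>biorthogonal_family\<close>). For each \<open>\<phi> \<in> \<Lambda>\<close> this one matrix expresses the
  characters \<open>\<phi> \<theta>\<^sub>j\<close> through the functions \<open>\<phi> \<cdot> 1\<^bsub>a + S\<^esub>\<close>. Since it does not depend on \<open>\<phi>\<close>, the norms of
  \<open>\<Sum> c\<^bsub>\<phi>,j\<^esub> \<phi> \<theta>\<^sub>j\<close> and of the corresponding orthonormal sum are comparable with constants independent of the
  coefficients (\<open>sum_f_le_sum_e\<close>, \<open>sum_e_le_sum_f\<close>), and the characters \<open>\<phi> \<theta>\<^sub>j\<close> are a Riesz basis.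

  Three ingredients are developed separately. The passage from comparable norms of finite sums to a
  bounded invertible operator (\<open>L2_riesz_basisI\<close>) goes through the closure of a densely defined linear
  relation and the completeness of \<open>L\<^sup>2\<close>. The group-theoretic part is carried out for any abelian
  topological group with a neighbourhood basis of open subgroups \<open>H n\<close> and a countable monoid \<open>X\<close> of
  characters that separates points modulo each \<open>H n\<close> (locale \<open>separated_group\<close>). Finally, such
  characters of \<open>\<rat>\<^sub>p\<^sup>d\<close> are built from a single character of \<open>\<rat>\<^sub>p\<close> whose kernel is exactly the ring of
  \<open>p\<close>-adic integers (\<open>padic_char_eq_1_iff\<close>).
\<close>

section \<open>The space \<open>L\<^sup>2\<close>\<close>

definition L2_sq :: "'a measure \<Rightarrow> ('a \<Rightarrow> complex) \<Rightarrow> real" where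
  "L2_sq M f = (LINT x|M. (cmod (f x))\<^sup>2)"

lemma L2_norm_eq_sqrt: "L2_norm M f = sqrt (L2_sq M f)"
  by (simp add: L2_norm_def L2_sq_def)

lemma L2_sq_nonneg [simp]: "0 \<le> L2_sq M f"
  by (simp add: L2_sq_def)

lemma L2_measurable [measurable_dest]: "f \<in> L2 M \<Longrightarrow> f \<in> borel_measurable M"
  by (simp add: L2_def)

lemma L2_integrable: "f \<in> L2 M \<Longrightarrow> integrable M (\<lambda>x. (cmod (f x))\<^sup>2)"
  by (simp add: L2_def)

text \<open>
  Together with its integrated form \<open>L2_sq_lincomb_le\<close>, this crude inequality with factor 2 stands in
  for Minkowski's inequality: every estimate below is insensitive to constants.
\<close>

lemma cmod_lincomb_sq_le:
  "(cmod (a * u + b * v))\<^sup>2 \<le> 2 * (cmod a)\<^sup>2 * (cmod u)\<^sup>2 + 2 * (cmod b)\<^sup>2 * (cmod v)\<^sup>2"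
proof -
  have "(cmod (a * u + b * v))\<^sup>2 \<le> (cmod a * cmod u + cmod b * cmod v)\<^sup>2"
    by (intro power_mono order_trans[OF norm_triangle_ineq]) (auto simp: norm_mult)
  also have "\<dots> \<le> 2 * (cmod a * cmod u)\<^sup>2 + 2 * (cmod b * cmod v)\<^sup>2"
    using zero_le_power2[of "cmod a * cmod u - cmod b * cmod v"]
    by (simp only: power2_diff power2_sum)
  finally show ?thesis by (simp add: power_mult_distrib)
qed

lemma L2_lincomb:
  assumes f: "f \<in> L2 M" and g: "g \<in> L2 M"
  shows "(\<lambda>x. a * f x + b * g x) \<in> L2 M"
proof -
  have "integrable M (\<lambda>x. (cmod (a * f x + b * g x))\<^sup>2)"
  proof (rule Bochner_Integration.integrable_bound)
    show "integrable M (\<lambda>x. 2 * (cmod a)\<^sup>2 * (cmod (f x))\<^sup>2 + 2 * (cmod b)\<^sup>2 * (cmod (g x))\<^sup>2)"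
      using f g by (intro Bochner_Integration.integrable_add integrable_mult_right) (auto simp: L2_integrable)
    show "(\<lambda>x. (cmod (a * f x + b * g x))\<^sup>2) \<in> borel_measurable M"
      using f g by measurable
  qed (use cmod_lincomb_sq_le in \<open>auto intro!: AE_I2 order_trans[OF _ abs_ge_self]\<close>)
  thus ?thesis using f g by (auto simp: L2_def)
qed

lemma L2_sq_lincomb_le:
  assumes f: "f \<in> L2 M" and g: "g \<in> L2 M"
  shows "L2_sq M (\<lambda>x. a * f x + b * g x) \<le> 2 * (cmod a)\<^sup>2 * L2_sq M f + 2 * (cmod b)\<^sup>2 * L2_sq M g"
proof -
  have "L2_sq M (\<lambda>x. a * f x + b * g x)
      \<le> (LINT x|M. 2 * (cmod a)\<^sup>2 * (cmod (f x))\<^sup>2 + 2 * (cmod b)\<^sup>2 * (cmod (g x))\<^sup>2)"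
    unfolding L2_sq_def
    using f g L2_lincomb[OF f g]
    by (intro integral_mono cmod_lincomb_sq_le Bochner_Integration.integrable_add
        integrable_mult_right) (auto simp: L2_integrable)
  also have "\<dots> = 2 * (cmod a)\<^sup>2 * L2_sq M f + 2 * (cmod b)\<^sup>2 * L2_sq M g"
    unfolding L2_sq_def using f g
    by (subst Bochner_Integration.integral_add) (auto intro!: integrable_mult_right simp: L2_integrable)
  finally show ?thesis .
qed

lemma L2_zero [simp]: "(\<lambda>x. 0) \<in> L2 M"
  by (simp add: L2_def)

lemma L2_add: "f \<in> L2 M \<Longrightarrow> g \<in> L2 M \<Longrightarrow> (\<lambda>x. f x + g x) \<in> L2 M"
  using L2_lincomb[of f M g 1 1] by simp

lemma L2_diff: "f \<in> L2 M \<Longrightarrow> g \<in> L2 M \<Longrightarrow> (\<lambda>x. f x - g x) \<in> L2 M"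
  using L2_lincomb[of f M g 1 "-1"] by simp

lemma L2_mult: "f \<in> L2 M \<Longrightarrow> (\<lambda>x. c * f x) \<in> L2 M"
  using L2_lincomb[of f M f c 0] by simp

lemma L2_sum: "(\<And>i. i \<in> J \<Longrightarrow> f i \<in> L2 M) \<Longrightarrow> (\<lambda>x. \<Sum>i\<in>J. c i * f i x) \<in> L2 M"
  proof (induction J rule: infinite_finite_induct)
  case (insert i J)
  thus ?case using L2_lincomb[of "f i" M "\<lambda>x. \<Sum>i\<in>J. c i * f i x" "c i" 1] by simp
qed auto

lemma L2_sq_add_le:
  "f \<in> L2 M \<Longrightarrow> g \<in> L2 M \<Longrightarrow> L2_sq M (\<lambda>x. f x + g x) \<le> 2 * L2_sq M f + 2 * L2_sq M g"
  using L2_sq_lincomb_le[of f M g 1 1] by simp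

lemma L2_sq_commute: "L2_sq M (\<lambda>x. f x - g x) = L2_sq M (\<lambda>x. g x - f x)"
  by (simp add: L2_sq_def norm_minus_commute)

lemma L2_sq_diff_triangle:
  assumes "f \<in> L2 M" "g \<in> L2 M" "h \<in> L2 M"
  shows "L2_sq M (\<lambda>x. f x - h x) \<le> 2 * L2_sq M (\<lambda>x. f x - g x) + 2 * L2_sq M (\<lambda>x. g x - h x)"
  using L2_sq_add_le[OF L2_diff[OF assms(1,2)] L2_diff[OF assms(2,3)]] by simp

text \<open>
  Used to show that closures of linear relations and of spans are again linear; what matters is that \<open>\<delta>\<close>
  depends on the coefficients only.
\<close>

lemma L2_lincomb_near:
  assumes "\<epsilon> > 0"
  obtains \<delta> :: real where "\<delta> > 0"
    "\<And>w w' r r'. w \<in> L2 M \<Longrightarrow> w' \<in> L2 M \<Longrightarrow> r \<in> L2 M \<Longrightarrow> r' \<in> L2 M \<Longrightarrow>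
      L2_sq M (\<lambda>x. w x - r x) < \<delta> \<Longrightarrow> L2_sq M (\<lambda>x. w' x - r' x) < \<delta> \<Longrightarrow>
      L2_sq M (\<lambda>x. (a * w x + b * w' x) - (a * r x + b * r' x)) < \<epsilon>"
proof -
  define K where "K = 2 * (cmod a)\<^sup>2 + 2 * (cmod b)\<^sup>2 + 1"
  have K: "K > 0" by (auto simp: K_def intro: add_nonneg_pos)
  define \<delta> where "\<delta> = \<epsilon> / K"
  have \<delta>: "\<delta> > 0" "K * \<delta> = \<epsilon>" using \<open>\<epsilon> > 0\<close> K by (auto simp: \<delta>_def)
  show ?thesis
  proof (rule that[OF \<delta>(1)])
    fix w w' r r' assume rw: "w \<in> L2 M" "w' \<in> L2 M" "r \<in> L2 M" "r' \<in> L2 M"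
      "L2_sq M (\<lambda>x. w x - r x) < \<delta>" "L2_sq M (\<lambda>x. w' x - r' x) < \<delta>"
    have "L2_sq M (\<lambda>x. a * (w x - r x) + b * (w' x - r' x))
        \<le> 2 * (cmod a)\<^sup>2 * L2_sq M (\<lambda>x. w x - r x) + 2 * (cmod b)\<^sup>2 * L2_sq M (\<lambda>x. w' x - r' x)"
      using rw by (intro L2_sq_lincomb_le L2_diff)
    also have "\<dots> \<le> 2 * (cmod a)\<^sup>2 * \<delta> + 2 * (cmod b)\<^sup>2 * \<delta>"
      using rw by (intro add_mono mult_left_mono) auto
    also have "\<dots> < K * \<delta>" using \<delta>(1) by (simp add: K_def algebra_simps)
    finally show "L2_sq M (\<lambda>x. (a * w x + b * w' x) - (a * r x + b * r' x)) < \<epsilon>"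
      by (simp add: \<delta>(2) algebra_simps)
  qed
qed

lemma nn_integral_L2_sq:
  "f \<in> L2 M \<Longrightarrow> (\<integral>\<^sup>+x. ennreal ((cmod (f x))\<^sup>2) \<partial>M) = ennreal (L2_sq M f)"
  unfolding L2_sq_def by (intro nn_integral_eq_integral L2_integrable) auto

lemma L2_sq_eq_0_AE:
  assumes "f \<in> L2 M" "L2_sq M f = 0"
  shows "AE x in M. f x = 0"
  using assms integral_nonneg_eq_0_iff_AE[OF L2_integrable[OF assms(1)]]
  by (simp add: L2_sq_def)

text \<open>
  Weighting the squared increments by \<open>2 ^ k\<close> leaves a convergent series of integrals. Hence almost everywhere
  the increments are bounded by \<open>(1 / sqrt 2) ^ k\<close> for large \<open>k\<close> and the sequence converges pointwise; Fatou's lemma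
  carries the bounds over to the limit.
\<close>

lemma L2_complete:
  assumes u: "\<And>k. u k \<in> L2 M" and c: "c \<ge> 0"
    and cauchy: "\<And>k l. k \<le> l \<Longrightarrow> L2_sq M (\<lambda>x. u l x - u k x) \<le> c * (1/4) ^ k"
  obtains v where "v \<in> L2 M" "\<And>k. L2_sq M (\<lambda>x. v x - u k x) \<le> c * (1/4) ^ k"
proof -
  note [measurable] = u[THEN L2_measurable]
  define D where "D = (\<lambda>k x. u (Suc k) x - u k x)"
  have D: "D k \<in> L2 M" for k unfolding D_def by (intro L2_diff u)
  note [measurable] = D[THEN L2_measurable]
  have "(\<integral>\<^sup>+x. (\<Sum>k. ennreal (2 ^ k * (cmod (D k x))\<^sup>2)) \<partial>M)
      = (\<Sum>k. \<integral>\<^sup>+x. ennreal (2 ^ k * (cmod (D k x))\<^sup>2) \<partial>M)"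
    by (rule nn_integral_suminf) measurable
  also have "\<dots> = (\<Sum>k. ennreal (2 ^ k * L2_sq M (D k)))"
  proof (rule suminf_cong)
    fix k
    have "(\<integral>\<^sup>+x. ennreal (2 ^ k * (cmod (D k x))\<^sup>2) \<partial>M)
        = (\<integral>\<^sup>+x. ennreal (2 ^ k) * ennreal ((cmod (D k x))\<^sup>2) \<partial>M)"
      by (simp add: ennreal_mult)
    also have "\<dots> = ennreal (2 ^ k) * (\<integral>\<^sup>+x. ennreal ((cmod (D k x))\<^sup>2) \<partial>M)"
      by (rule nn_integral_cmult) measurable
    finally show "(\<integral>\<^sup>+x. ennreal (2 ^ k * (cmod (D k x))\<^sup>2) \<partial>M) = ennreal (2 ^ k * L2_sq M (D k))"
      by (simp add: nn_integral_L2_sq[OF D] ennreal_mult)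
  qed
  also have "\<dots> \<le> (\<Sum>k. ennreal (c * (1/2) ^ k))"
  proof (intro suminf_le ennreal_leI)
    fix k :: nat
    have "L2_sq M (D k) \<le> c * (1/4) ^ k" using cauchy[of k "Suc k"] by (simp add: D_def)
    hence "2 ^ k * L2_sq M (D k) \<le> 2 ^ k * (c * (1/4) ^ k)" by simp
    also have "\<dots> = c * (1/2) ^ k"
      by (simp add: power_divide flip: power_mult_distrib)
         (simp add: field_simps flip: power_mult_distrib)
    finally show "2 ^ k * L2_sq M (D k) \<le> c * (1/2) ^ k" .
  qed auto
  also have "\<dots> = ennreal (\<Sum>k. c * (1/2) ^ k)"
    using c by (intro suminf_ennreal_eq summable_sums summable_mult summable_geometric) auto
  also have "\<dots> < \<infinity>" by simp
  finally have "AE x in M. (\<Sum>k. ennreal (2 ^ k * (cmod (D k x))\<^sup>2)) \<noteq> \<infinity>"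
    by (intro nn_integral_noteq_infinite) auto
  moreover have "convergent (\<lambda>k. u k x)" if "(\<Sum>k. ennreal (2 ^ k * (cmod (D k x))\<^sup>2)) \<noteq> \<infinity>" for x
  proof -
    have "summable (\<lambda>k. 2 ^ k * (cmod (D k x))\<^sup>2)"
      using that by (intro summable_suminf_not_top) auto
    hence "(\<lambda>k. 2 ^ k * (cmod (D k x))\<^sup>2) \<longlonglongrightarrow> 0" by (rule summable_LIMSEQ_zero)
    hence "eventually (\<lambda>k. 2 ^ k * (cmod (D k x))\<^sup>2 < 1) sequentially"
      by (rule order_tendstoD) simp
    hence ev: "eventually (\<lambda>k. norm (D k x) \<le> (sqrt (1/2)) ^ k) sequentially"
    proof eventually_elim
      case (elim k)
      hence "(cmod (D k x))\<^sup>2 \<le> (1/2) ^ k" by (simp add: field_simps power_divide)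
      also have "\<dots> = ((sqrt (1/2)) ^ k)\<^sup>2"
        by (simp add: power2_eq_square flip: power_mult_distrib)
      finally show ?case by (rule power2_le_imp_le) simp
    qed
    have "summable (\<lambda>k. D k x)"
      by (rule summable_comparison_test_ev[OF ev summable_geometric]) (simp add: real_sqrt_divide)
    hence "convergent (\<lambda>n. \<Sum>k<n. D k x)" by (simp add: summable_iff_convergent)
    hence "convergent (\<lambda>n. u n x - u 0 x)" by (simp add: D_def sum_lessThan_telescope[of "\<lambda>n. u n x"])
    from convergent_add[OF this convergent_const[of "u 0 x"]] show ?thesis by simp
  qed
  ultimately have conv: "AE x in M. convergent (\<lambda>k. u k x)" by (auto elim!: eventually_mono)
  \<comment> \<open>On the null set where the sequence diverges, \<open>lim\<close> still gives a measurable function.\<close>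
  define v where "v = (\<lambda>x. lim (\<lambda>k. u k x))"
  have [measurable]: "v \<in> borel_measurable M" unfolding v_def by (rule borel_measurable_lim_metric) measurable
  have lim: "AE x in M. (\<lambda>k. u k x) \<longlonglongrightarrow> v x"
    using conv by eventually_elim (simp add: v_def convergent_LIMSEQ_iff)
  have bound: "(\<integral>\<^sup>+x. ennreal ((cmod (v x - u k x))\<^sup>2) \<partial>M) \<le> ennreal (c * (1/4) ^ k)" for k
  proof -
    have "(\<integral>\<^sup>+x. ennreal ((cmod (v x - u k x))\<^sup>2) \<partial>M)
        = (\<integral>\<^sup>+x. liminf (\<lambda>l. ennreal ((cmod (u l x - u k x))\<^sup>2)) \<partial>M)"
    proof (rule nn_integral_cong_AE, use lim in eventually_elim)
      case (elim x)
      have "(\<lambda>l. ennreal ((cmod (u l x - u k x))\<^sup>2)) \<longlonglongrightarrow> ennreal ((cmod (v x - u k x))\<^sup>2)"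
        by (intro tendsto_intros elim)
      thus ?case by (intro lim_imp_Liminf[symmetric]) auto
    qed
    also have "\<dots> \<le> liminf (\<lambda>l. \<integral>\<^sup>+x. ennreal ((cmod (u l x - u k x))\<^sup>2) \<partial>M)"
      by (rule nn_integral_liminf) measurable
    also have "\<dots> \<le> liminf (\<lambda>l. ennreal (c * (1/4) ^ k))"
      by (intro Liminf_mono eventually_sequentiallyI[of k])
         (simp add: nn_integral_L2_sq[OF L2_diff[OF u u]] ennreal_leI cauchy)
    finally show ?thesis by (simp add: Liminf_const)
  qed
  have diff: "(\<lambda>x. v x - u k x) \<in> L2 M" for k
  proof -
    have "integrable M (\<lambda>x. (cmod (v x - u k x))\<^sup>2)"
    proof (rule integrableI_bounded)
      show "(\<integral>\<^sup>+x. ennreal (norm ((cmod (v x - u k x))\<^sup>2)) \<partial>M) < \<infinity>"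
        using bound[of k] by (auto simp: order_le_less_trans)
    qed measurable
    thus ?thesis by (simp add: L2_def)
  qed
  show ?thesis
  proof (rule that)
    show "v \<in> L2 M" using L2_add[OF diff u, of 0 0] by simp
    show "L2_sq M (\<lambda>x. v x - u k x) \<le> c * (1/4) ^ k" for k
      using bound[of k] c by (simp add: nn_integral_L2_sq[OF diff] ennreal_le_iff)
  qed
qed

lemma L2_bounded:
  assumes "finite_measure M" "f \<in> borel_measurable M" "\<And>x. x \<in> space M \<Longrightarrow> cmod (f x) \<le> B"
  shows "f \<in> L2 M"
proof -
  have "integrable M (\<lambda>x. (cmod (f x))\<^sup>2)"
    using assms by (intro finite_measure.integrable_const_bound[where B = "B\<^sup>2"]) (auto intro!: AE_I2 power_mono)
  thus ?thesis using assms(2) by (simp add: L2_def)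
qed

lemma L2_sq_cong: "(\<And>x. x \<in> space M \<Longrightarrow> f x = g x) \<Longrightarrow> L2_sq M f = L2_sq M g"
  unfolding L2_sq_def by (simp cong: Bochner_Integration.integral_cong)

lemma L2_mult_cnj_integrable:
  assumes "f \<in> L2 M" "g \<in> L2 M"
  shows "integrable M (\<lambda>x. f x * cnj (g x))"
proof (rule Bochner_Integration.integrable_bound)
  show "integrable M (\<lambda>x. (cmod (f x))\<^sup>2 + (cmod (g x))\<^sup>2)"
    using assms by (intro Bochner_Integration.integrable_add L2_integrable)
  have "(\<lambda>x. cnj (g x)) \<in> borel_measurable M"
    by (rule borel_measurable_continuous_on[OF _ L2_measurable[OF assms(2)]]) (intro continuous_intros)
  thus "(\<lambda>x. f x * cnj (g x)) \<in> borel_measurable M"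
    using L2_measurable[OF assms(1)] by (rule borel_measurable_times[rotated])
  have "cmod a * cmod b \<le> (cmod a)\<^sup>2 + (cmod b)\<^sup>2" for a b
    using sum_squares_bound[of "cmod a" "cmod b"] mult_nonneg_nonneg[OF norm_ge_zero[of a] norm_ge_zero[of b]]
    by linarith
  thus "AE x in M. norm (f x * cnj (g x)) \<le> norm ((cmod (f x))\<^sup>2 + (cmod (g x))\<^sup>2)"
    by (auto simp: norm_mult intro!: AE_I2)
qed

lemma L2_sq_eq_inner:
  assumes "f \<in> L2 M"
  shows "complex_of_real (L2_sq M f) = L2_inner M f f"
proof -
  have "L2_inner M f f = (LINT x|M. complex_of_real ((cmod (f x))\<^sup>2))"
    unfolding L2_inner_def by (simp only: complex_norm_square)
  thus ?thesis unfolding L2_sq_def by (simp only: integral_complex_of_real)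
qed

lemma L2_pythagoras:
  assumes J: "finite J" and e: "\<And>n. n \<in> J \<Longrightarrow> e n \<in> L2 M"
    and orth: "\<And>m n. m \<in> J \<Longrightarrow> n \<in> J \<Longrightarrow> L2_inner M (e m) (e n) = (if m = n then 1 else 0)"
  shows "L2_sq M (\<lambda>x. \<Sum>n\<in>J. c n * e n x) = (\<Sum>n\<in>J. (cmod (c n))\<^sup>2)"
proof -
  have "complex_of_real (L2_sq M (\<lambda>x. \<Sum>n\<in>J. c n * e n x))
      = (LINT x|M. (\<Sum>m\<in>J. \<Sum>n\<in>J. (c m * cnj (c n)) * (e m x * cnj (e n x))))"
    by (subst L2_sq_eq_inner[OF L2_sum[OF e]]) (simp_all add: L2_inner_def sum_product mult_ac)
  also have "\<dots> = (\<Sum>m\<in>J. \<Sum>n\<in>J. (c m * cnj (c n)) * L2_inner M (e m) (e n))"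
  proof -
    have int: "integrable M (\<lambda>x. (c m * cnj (c n)) * (e m x * cnj (e n x)))" if "m \<in> J" "n \<in> J" for m n
      using that e by (intro integrable_mult_right L2_mult_cnj_integrable)
    show ?thesis
      unfolding L2_inner_def using int
      by (simp add: Bochner_Integration.integral_sum Bochner_Integration.integrable_sum
          del: Bochner_Integration.integral_mult_right_zero)
        (simp add: mult.assoc)
  qed
  also have "\<dots> = (\<Sum>m\<in>J. \<Sum>n\<in>J. if m = n then c m * cnj (c n) else 0)"
    using orth by (intro sum.cong) auto
  also have "\<dots> = (\<Sum>m\<in>J. c m * cnj (c m))" using J by simp
  also have "\<dots> = complex_of_real (\<Sum>n\<in>J. (cmod (c n))\<^sup>2)"
    by (simp add: complex_mult_cnj cmod_power2)
  finally show ?thesis by (simp only: of_real_eq_iff)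
qed

text \<open>
  Approximate \<open>u\<close> pointwise by simple functions dominated by \<open>2 * cmod u\<close>, and use dominated convergence.
  Finiteness of \<open>M\<close> puts the indicators into \<open>L\<^sup>2\<close>.
\<close>

lemma L2_closed_subspace_eq:
  assumes fin: "finite_measure M"
    and ind: "\<And>A. A \<in> sets M \<Longrightarrow> (\<lambda>x. indicator A x) \<in> D"
    and lincomb: "\<And>f g a b. f \<in> D \<Longrightarrow> g \<in> D \<Longrightarrow> (\<lambda>x. a * f x + b * g x) \<in> D"
    and closed: "\<And>u. u \<in> L2 M \<Longrightarrow> (\<And>\<epsilon>::real. \<epsilon> > 0 \<Longrightarrow> \<exists>v\<in>D. L2_sq M (\<lambda>x. u x - v x) < \<epsilon>) \<Longrightarrow> u \<in> D"
    and u: "u \<in> L2 M"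
  shows "u \<in> D"
proof (rule closed[OF u])
  fix \<epsilon> :: real assume "\<epsilon> > 0"
  note [measurable] = L2_measurable[OF u]
  obtain F where F: "\<And>i. simple_function M (F i)"
    and lim: "\<And>x. x \<in> space M \<Longrightarrow> (\<lambda>i. F i x) \<longlonglongrightarrow> u x"
    and bound: "\<And>i x. x \<in> space M \<Longrightarrow> dist (F i x) 0 \<le> 2 * dist (u x) 0"
    using borel_measurable_implies_sequence_metric[OF L2_measurable[OF u], of 0] by blast
  note [measurable] = borel_measurable_simple_function[OF F]
  have "(\<lambda>i. L2_sq M (\<lambda>x. u x - F i x)) \<longlonglongrightarrow> (LINT x|M. 0)"
    unfolding L2_sq_def
  proof (rule integral_dominated_convergence)
    show "integrable M (\<lambda>x. 9 * (cmod (u x))\<^sup>2)" using L2_integrable[OF u] by simp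
    show "AE x in M. (\<lambda>i. (cmod (u x - F i x))\<^sup>2) \<longlonglongrightarrow> 0"
    proof (rule AE_I2)
      fix x assume "x \<in> space M"
      have "(\<lambda>i. (cmod (u x - F i x))\<^sup>2) \<longlonglongrightarrow> (cmod (u x - u x))\<^sup>2"
        by (intro tendsto_intros lim \<open>x \<in> space M\<close>)
      thus "(\<lambda>i. (cmod (u x - F i x))\<^sup>2) \<longlonglongrightarrow> 0" by simp
    qed
    show "AE x in M. norm ((cmod (u x - F i x))\<^sup>2) \<le> 9 * (cmod (u x))\<^sup>2" for i
    proof (rule AE_I2)
      fix x assume "x \<in> space M"
      hence "cmod (u x - F i x) \<le> 3 * cmod (u x)"
        using bound[of x i] norm_triangle_ineq4[of "u x" "F i x"] by simp
      hence "(cmod (u x - F i x))\<^sup>2 \<le> (3 * cmod (u x))\<^sup>2" by (intro power_mono) auto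
      thus "norm ((cmod (u x - F i x))\<^sup>2) \<le> 9 * (cmod (u x))\<^sup>2" by (simp add: power_mult_distrib)
    qed
  qed measurable
  hence "eventually (\<lambda>i. L2_sq M (\<lambda>x. u x - F i x) < \<epsilon>) sequentially"
    using \<open>\<epsilon> > 0\<close> by (intro order_tendstoD(2)[where y = 0]) simp_all
  then obtain i where i: "L2_sq M (\<lambda>x. u x - F i x) < \<epsilon>"
    using eventually_happens'[OF sequentially_bot] by blast
  define A where "A = (\<lambda>y. F i -` {y} \<inter> space M)"
  define s where "s = (\<lambda>x. \<Sum>y\<in>F i ` space M. y * indicator (A y) x)"
  have fin_im: "finite (F i ` space M)" using F simple_functionD(1) by blast
  have zero: "(\<lambda>x. 0) \<in> D" using lincomb[OF ind[OF sets.top] ind[OF sets.top], of 0 0] by simp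
  have "(\<lambda>x. \<Sum>y\<in>Z. y * indicator (A y) x) \<in> D" if "finite Z" for Z
    using that
  proof induction
    case (insert y Z)
    have "A y \<in> sets M" unfolding A_def using simple_functionD(2)[OF F] by blast
    from lincomb[OF ind[OF this] insert.IH, of y 1] show ?case
      by (simp only: sum.insert[OF insert.hyps] mult_1)
  qed (simp add: zero)
  hence "s \<in> D" unfolding s_def using fin_im by blast
  moreover have "s x = F i x" if "x \<in> space M" for x
  proof -
    have "s x = (\<Sum>y\<in>F i ` space M. if y = F i x then y else 0)"
      unfolding s_def A_def using that by (intro sum.cong) (auto simp: indicator_def)
    thus ?thesis using that fin_im by simp
  qed
  hence "L2_sq M (\<lambda>x. u x - s x) = L2_sq M (\<lambda>x. u x - F i x)" by (intro L2_sq_cong) simp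
  ultimately show "\<exists>v\<in>D. L2_sq M (\<lambda>x. u x - v x) < \<epsilon>"
    using i by (intro bexI[of _ s]) simp_all
qed

section \<open>From comparable norms to Riesz bases\<close>

text \<open>
  The closure of a linear relation \<open>P\<close> in \<open>L\<^sup>2 \<times> L\<^sup>2\<close>. Working with relations instead of operators makes
  the situation symmetric: the inverse operator is obtained from the converse relation.
\<close>

definition L2_graph_closure ::
    "'a measure \<Rightarrow> (('a \<Rightarrow> complex) \<times> ('a \<Rightarrow> complex)) set \<Rightarrow> ('a \<Rightarrow> complex) \<Rightarrow> ('a \<Rightarrow> complex) \<Rightarrow> bool" where
  "L2_graph_closure M P u v \<longleftrightarrow> u \<in> L2 M \<and> v \<in> L2 M \<and>
     (\<forall>\<epsilon>>0. \<exists>(s, t)\<in>P. L2_sq M (\<lambda>x. u x - s x) < \<epsilon> \<and> L2_sq M (\<lambda>x. v x - t x) < \<epsilon>)"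

text \<open>
  A densely defined bounded linear relation. Its closure is the graph, up to null sets, of an everywhere defined bounded
  operator: boundedness gives uniqueness of the values, density and completeness give existence.
\<close>

locale bounded_L2_relation =
  fixes M :: "'a measure" and P :: "(('a \<Rightarrow> complex) \<times> ('a \<Rightarrow> complex)) set" and C :: real
  assumes in_L2: "(s, t) \<in> P \<Longrightarrow> s \<in> L2 M \<and> t \<in> L2 M"
    and lincomb: "(s, t) \<in> P \<Longrightarrow> (s', t') \<in> P \<Longrightarrow>
      ((\<lambda>x. a * s x + b * s' x), (\<lambda>x. a * t x + b * t' x)) \<in> P"
    and C_nonneg: "C \<ge> 0"
    and bounded: "(s, t) \<in> P \<Longrightarrow> L2_sq M t \<le> C * L2_sq M s"
    and dense: "u \<in> L2 M \<Longrightarrow> \<epsilon> > 0 \<Longrightarrow> \<exists>(s, t)\<in>P. L2_sq M (\<lambda>x. u x - s x) < \<epsilon>"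
begin

abbreviation graph :: "('a \<Rightarrow> complex) \<Rightarrow> ('a \<Rightarrow> complex) \<Rightarrow> bool" where
  "graph \<equiv> L2_graph_closure M P"

lemma graph_L2: "graph u v \<Longrightarrow> u \<in> L2 M \<and> v \<in> L2 M"
  by (simp add: L2_graph_closure_def)

lemma graph_bounded:
  assumes "graph u v"
  shows "L2_sq M v \<le> 4 * C * L2_sq M u"
proof (rule field_le_epsilon)
  fix e :: real assume e: "e > 0"
  \<comment> \<open>Chosen so that the error accumulated below is exactly \<open>e\<close>.\<close>
  define \<epsilon> where "\<epsilon> = e / (2 + 4 * C)"
  have \<epsilon>: "\<epsilon> > 0" "2 * \<epsilon> + 4 * C * \<epsilon> = e"
  proof -
    have "2 + 4 * C > 0" using C_nonneg by simp
    hence "\<epsilon> > 0" "(2 + 4 * C) * \<epsilon> = e"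
      using e by (simp_all add: \<epsilon>_def)
    thus "\<epsilon> > 0" "2 * \<epsilon> + 4 * C * \<epsilon> = e" by (simp_all add: distrib_right)
  qed
  from assms \<epsilon>(1) obtain s t where st: "(s, t) \<in> P" "L2_sq M (\<lambda>x. u x - s x) < \<epsilon>" "L2_sq M (\<lambda>x. v x - t x) < \<epsilon>"
    unfolding L2_graph_closure_def by blast
  have L2: "u \<in> L2 M" "v \<in> L2 M" "s \<in> L2 M" "t \<in> L2 M"
    using graph_L2[OF assms] in_L2[OF st(1)] by auto
  have "L2_sq M s \<le> 2 * L2_sq M (\<lambda>x. u x - s x) + 2 * L2_sq M u"
    using L2_sq_add_le[OF L2_diff[OF L2(3,1)] L2(1)] by (simp add: L2_sq_commute[of M s u])
  also have "\<dots> \<le> 2 * \<epsilon> + 2 * L2_sq M u" using st by simp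
  finally have "C * L2_sq M s \<le> C * (2 * \<epsilon> + 2 * L2_sq M u)"
    using C_nonneg by (rule mult_left_mono)
  hence t: "L2_sq M t \<le> C * (2 * \<epsilon> + 2 * L2_sq M u)" using bounded[OF st(1)] by linarith
  have "L2_sq M v \<le> 2 * L2_sq M (\<lambda>x. v x - t x) + 2 * L2_sq M t"
    using L2_sq_add_le[OF L2_diff[OF L2(2,4)] L2(4)] by simp
  also have "\<dots> \<le> 2 * \<epsilon> + 2 * (C * (2 * \<epsilon> + 2 * L2_sq M u))" using st t by simp
  also have "\<dots> = 4 * C * L2_sq M u + e" by (simp add: \<epsilon>(2)[symmetric] algebra_simps)
  finally show "L2_sq M v \<le> 4 * C * L2_sq M u + e" .
qed

lemma graph_lincomb:
  assumes uv: "graph u v" and uv': "graph u' v'"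
  shows "graph (\<lambda>x. a * u x + b * u' x) (\<lambda>x. a * v x + b * v' x)"
  unfolding L2_graph_closure_def
proof (intro conjI allI impI)
  have L2: "u \<in> L2 M" "v \<in> L2 M" "u' \<in> L2 M" "v' \<in> L2 M"
    using graph_L2[OF uv] graph_L2[OF uv'] by auto
  show "(\<lambda>x. a * u x + b * u' x) \<in> L2 M" "(\<lambda>x. a * v x + b * v' x) \<in> L2 M"
    using L2 by (auto intro: L2_lincomb)
  fix \<epsilon> :: real assume "\<epsilon> > 0"
  obtain \<delta> :: real where \<delta>: "\<delta> > 0"
    and near: "\<And>w w' r r'. w \<in> L2 M \<Longrightarrow> w' \<in> L2 M \<Longrightarrow> r \<in> L2 M \<Longrightarrow> r' \<in> L2 M \<Longrightarrow>
      L2_sq M (\<lambda>x. w x - r x) < \<delta> \<Longrightarrow> L2_sq M (\<lambda>x. w' x - r' x) < \<delta> \<Longrightarrow>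
      L2_sq M (\<lambda>x. (a * w x + b * w' x) - (a * r x + b * r' x)) < \<epsilon>"
    using \<open>\<epsilon> > 0\<close> by (rule L2_lincomb_near[of \<epsilon> M a b]) blast
  obtain s t where st: "(s, t) \<in> P" "L2_sq M (\<lambda>x. u x - s x) < \<delta>" "L2_sq M (\<lambda>x. v x - t x) < \<delta>"
    using uv \<delta> unfolding L2_graph_closure_def by blast
  obtain s' t' where st': "(s', t') \<in> P" "L2_sq M (\<lambda>x. u' x - s' x) < \<delta>" "L2_sq M (\<lambda>x. v' x - t' x) < \<delta>"
    using uv' \<delta> unfolding L2_graph_closure_def by blast
  have rs: "s \<in> L2 M" "t \<in> L2 M" "s' \<in> L2 M" "t' \<in> L2 M"
    using in_L2[OF st(1)] in_L2[OF st'(1)] by auto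
  show "\<exists>(s, t)\<in>P. L2_sq M (\<lambda>x. a * u x + b * u' x - s x) < \<epsilon> \<and>
      L2_sq M (\<lambda>x. a * v x + b * v' x - t x) < \<epsilon>"
    using near[OF L2(1,3) rs(1,3) st(2) st'(2)] near[OF L2(2,4) rs(2,4) st(3) st'(3)]
    by (intro bexI[OF _ lincomb[OF st(1) st'(1), of a b]]) simp
qed

lemma graph_unique:
  assumes "graph u v" "graph u' v'" "AE x in M. u x = u' x"
  shows "AE x in M. v x = v' x"
proof -
  have g: "graph (\<lambda>x. u x - u' x) (\<lambda>x. v x - v' x)"
    using graph_lincomb[OF assms(1,2), of 1 "-1"] by simp
  have "L2_sq M (\<lambda>x. u x - u' x) = 0"
    unfolding L2_sq_def using assms(3) by (intro integral_eq_zero_AE) auto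
  hence "L2_sq M (\<lambda>x. v x - v' x) = 0"
    using graph_bounded[OF g] L2_sq_nonneg[of M "\<lambda>x. v x - v' x"] by simp
  with L2_sq_eq_0_AE graph_L2[OF g] have "AE x in M. v x - v' x = 0" by blast
  thus ?thesis by (rule eventually_mono) simp
qed

text \<open>
  Approximants \<open>s k\<close> of \<open>u\<close> with geometrically decreasing error form a Cauchy sequence, and
  boundedness makes their partners \<open>t k\<close> Cauchy as well.
\<close>

lemma graph_total:
  assumes u: "u \<in> L2 M"
  shows "\<exists>v. graph u v"
proof -
  \<comment> \<open>The factor covers the errors of both sequences: \<open>1\<close> for \<open>s\<close> and \<open>4 * C\<close> for \<open>t\<close>.\<close>
  define K where "K = 4 * C + 1"
  have K: "K > 0" using C_nonneg by (simp add: K_def)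
  have "\<exists>s t. (s, t) \<in> P \<and> L2_sq M (\<lambda>x. u x - s x) < (1/4) ^ k" for k :: nat
    using dense[OF u, of "(1/4) ^ k"] by auto
  then obtain s t where st: "\<And>k::nat. (s k, t k) \<in> P" "\<And>k. L2_sq M (\<lambda>x. u x - s k x) < (1/4) ^ k"
    by metis
  have L2: "s k \<in> L2 M" "t k \<in> L2 M" for k using in_L2[OF st(1)] by auto
  have cauchy: "L2_sq M (\<lambda>x. t l x - t k x) \<le> 4 * C * (1/4) ^ k" if "k \<le> l" for k l
  proof -
    have "L2_sq M (\<lambda>x. s l x - s k x) \<le> 2 * L2_sq M (\<lambda>x. s l x - u x) + 2 * L2_sq M (\<lambda>x. u x - s k x)"
      by (intro L2_sq_diff_triangle L2 u)
    also have "\<dots> \<le> 2 * (1/4) ^ l + 2 * (1/4) ^ k"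
      using st(2)[of k] st(2)[of l] by (simp add: L2_sq_commute[of M "s l" u])
    also have "\<dots> \<le> 4 * (1/4) ^ k"
      using power_decreasing[OF that, of "1/4::real"] by simp
    finally have "C * L2_sq M (\<lambda>x. s l x - s k x) \<le> C * (4 * (1/4) ^ k)"
      using C_nonneg by (rule mult_left_mono)
    moreover have "L2_sq M (\<lambda>x. t l x - t k x) \<le> C * L2_sq M (\<lambda>x. s l x - s k x)"
      using bounded[OF lincomb[OF st(1)[of l] st(1)[of k], of 1 "-1"]] by simp
    ultimately show ?thesis by (simp add: mult_ac)
  qed
  obtain v where v: "v \<in> L2 M" "\<And>k. L2_sq M (\<lambda>x. v x - t k x) \<le> 4 * C * (1/4) ^ k"
    using L2_complete[of t M "4 * C", OF L2(2) _ cauchy] C_nonneg by auto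
  have "graph u v"
    unfolding L2_graph_closure_def
  proof (intro conjI u v(1) allI impI)
    fix \<epsilon> :: real assume \<epsilon>: "\<epsilon> > 0"
    obtain k where "(1/4::real) ^ k < \<epsilon> / K" using real_arch_pow_inv[of "\<epsilon> / K" "1/4"] \<epsilon> K by auto
    hence k: "K * (1/4) ^ k < \<epsilon>" using K by (simp add: field_simps)
    have "L2_sq M (\<lambda>x. u x - s k x) < \<epsilon>" "L2_sq M (\<lambda>x. v x - t k x) < \<epsilon>"
    proof -
      have *: "(1/4::real) ^ k \<le> K * (1/4) ^ k" "4 * C * (1/4::real) ^ k \<le> K * (1/4) ^ k"
        using C_nonneg by (simp_all add: K_def algebra_simps)
      show "L2_sq M (\<lambda>x. u x - s k x) < \<epsilon>" using st(2)[of k] k * by linarith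
      show "L2_sq M (\<lambda>x. v x - t k x) < \<epsilon>" using v(2)[of k] k * by linarith
    qed
    thus "\<exists>(s, t)\<in>P. L2_sq M (\<lambda>x. u x - s x) < \<epsilon> \<and> L2_sq M (\<lambda>x. v x - t x) < \<epsilon>"
      using st(1) by blast
  qed
  thus ?thesis by (intro exI[of _ v])
qed

definition extension :: "('a \<Rightarrow> complex) \<Rightarrow> 'a \<Rightarrow> complex" where
  "extension u = (SOME v. graph u v)"

lemma graph_extension: "u \<in> L2 M \<Longrightarrow> graph u (extension u)"
  unfolding extension_def using graph_total by (rule someI_ex)

lemma extension_eq: "graph u v \<Longrightarrow> AE x in M. extension u x = v x"
  using graph_unique[OF graph_extension] graph_L2 by blast

lemma graph_of_mem: "(s, t) \<in> P \<Longrightarrow> graph s t"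
  unfolding L2_graph_closure_def using in_L2
  by (auto simp: L2_sq_def intro!: bexI[of _ "(s, t)"])

lemma extension_bounded_operator: "L2_bounded_operator M extension"
  unfolding L2_bounded_operator_def
proof (intro conjI ballI allI)
  show "extension f \<in> L2 M" if "f \<in> L2 M" for f
    using graph_extension[OF that] graph_L2 by blast
  show "AE x in M. extension (\<lambda>y. a * f y + b * g y) x = a * extension f x + b * extension g x"
    if "f \<in> L2 M" "g \<in> L2 M" for f g a b
    using that by (intro extension_eq graph_lincomb graph_extension)
  show "\<exists>K. \<forall>f\<in>L2 M. L2_norm M (extension f) \<le> K * L2_norm M f"
  proof (intro exI ballI)
    fix f assume f: "f \<in> L2 M"
    show "L2_norm M (extension f) \<le> sqrt (4 * C) * L2_norm M f"
      unfolding L2_norm_eq_sqrt real_sqrt_mult[symmetric]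
      by (intro real_sqrt_le_mono graph_bounded graph_extension f)
  qed
qed

end

lemma L2_graph_closure_converse: "L2_graph_closure M (P\<inverse>) v u \<longleftrightarrow> L2_graph_closure M P u v"
  unfolding L2_graph_closure_def by blast

text \<open>
  If \<open>P\<close> and its converse are both bounded with dense domain, then their closures are converse to each
  other, so the two extensions are mutually inverse.
\<close>

lemma bounded_invertible_extension:
  assumes P: "bounded_L2_relation M P C" and P': "bounded_L2_relation M (P\<inverse>) C'"
  shows "\<exists>T. L2_bounded_invertible M T \<and> (\<forall>(s, t)\<in>P. AE x in M. T s x = t x)"
proof -
  interpret P: bounded_L2_relation M P C by fact
  interpret P': bounded_L2_relation M "P\<inverse>" C' by fact
  have 1: "AE x in M. P'.extension (P.extension f) x = f x" if "f \<in> L2 M" for f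
    by (rule P'.extension_eq[OF L2_graph_closure_converse[THEN iffD2, OF P.graph_extension[OF that]]])
  have 2: "AE x in M. P.extension (P'.extension f) x = f x" if "f \<in> L2 M" for f
    by (rule P.extension_eq[OF L2_graph_closure_converse[THEN iffD1, OF P'.graph_extension[OF that]]])
  have inv: "L2_bounded_invertible M P.extension"
    unfolding L2_bounded_invertible_def
    using P.extension_bounded_operator P'.extension_bounded_operator 1 2
    by (intro conjI exI[of _ P'.extension] ballI)
  have "\<forall>(s, t)\<in>P. AE x in M. P.extension s x = t x"
    using P.extension_eq[OF P.graph_of_mem] by auto
  with inv show ?thesis by (intro exI[of _ P.extension] conjI)
qed

text \<open>
  The coefficients \<open>d\<close> do not depend on \<open>w\<close>. This allows the same coefficients to be used simultaneously
  for two families and at all points.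
\<close>

lemma sum_lincomb_union:
  fixes c c' :: "'i \<Rightarrow> complex"
  assumes "finite J" "finite J'"
  obtains d where "\<And>w. a * (\<Sum>n\<in>J. c n * w n) + b * (\<Sum>n\<in>J'. c' n * w n) = (\<Sum>n\<in>J \<union> J'. d n * w n)"
proof
  fix w :: "'i \<Rightarrow> complex"
  have "(\<Sum>n\<in>J. c n * w n) = (\<Sum>n\<in>J \<union> J'. (if n \<in> J then c n else 0) * w n)"
    using assms by (intro sum.mono_neutral_cong_left) auto
  moreover have "(\<Sum>n\<in>J'. c' n * w n) = (\<Sum>n\<in>J \<union> J'. (if n \<in> J' then c' n else 0) * w n)"
    using assms by (intro sum.mono_neutral_cong_left) auto
  ultimately show "a * (\<Sum>n\<in>J. c n * w n) + b * (\<Sum>n\<in>J'. c' n * w n)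
      = (\<Sum>n\<in>J \<union> J'. (a * (if n \<in> J then c n else 0) + b * (if n \<in> J' then c' n else 0)) * w n)"
    by (simp add: sum_distrib_left sum.distrib algebra_simps)
qed

definition L2_total :: "'a measure \<Rightarrow> 'i set \<Rightarrow> ('i \<Rightarrow> 'a \<Rightarrow> complex) \<Rightarrow> bool" where
  "L2_total M I f \<longleftrightarrow> (\<forall>u\<in>L2 M. \<forall>\<epsilon>>0. \<exists>J c. finite J \<and> J \<subseteq> I \<and>
     L2_sq M (\<lambda>x. u x - (\<Sum>n\<in>J. c n * f n x)) < \<epsilon>)"

text \<open>The graph of the linear map that sends \<open>e n\<close> to \<open>f n\<close> for all \<open>n \<in> I\<close>.\<close>

definition comb_pairs ::
    "'i set \<Rightarrow> ('i \<Rightarrow> 'a \<Rightarrow> complex) \<Rightarrow> ('i \<Rightarrow> 'a \<Rightarrow> complex) \<Rightarrow> (('a \<Rightarrow> complex) \<times> ('a \<Rightarrow> complex)) set" where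
  "comb_pairs I e f = {((\<lambda>x. \<Sum>n\<in>J. c n * e n x), (\<lambda>x. \<Sum>n\<in>J. c n * f n x)) | J c. finite J \<and> J \<subseteq> I}"

lemma comb_pairs_converse: "(comb_pairs I e f)\<inverse> = comb_pairs I f e"
  unfolding comb_pairs_def by blast

lemma bounded_L2_relation_comb_pairs:
  assumes e: "\<And>n. n \<in> I \<Longrightarrow> e n \<in> L2 M" and f: "\<And>n. n \<in> I \<Longrightarrow> f n \<in> L2 M"
    and total: "L2_total M I e" and C: "C \<ge> 0"
    and bounded: "\<And>J c. finite J \<Longrightarrow> J \<subseteq> I \<Longrightarrow>
      L2_sq M (\<lambda>x. \<Sum>n\<in>J. c n * f n x) \<le> C * L2_sq M (\<lambda>x. \<Sum>n\<in>J. c n * e n x)"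
  shows "bounded_L2_relation M (comb_pairs I e f) C"
proof
  fix s t s' t' a b
  assume "(s, t) \<in> comb_pairs I e f" and "(s', t') \<in> comb_pairs I e f"
  then obtain J c J' c' where J: "finite J" "J \<subseteq> I" "finite J'" "J' \<subseteq> I"
    and st: "s = (\<lambda>x. \<Sum>n\<in>J. c n * e n x)" "t = (\<lambda>x. \<Sum>n\<in>J. c n * f n x)"
      "s' = (\<lambda>x. \<Sum>n\<in>J'. c' n * e n x)" "t' = (\<lambda>x. \<Sum>n\<in>J'. c' n * f n x)"
    unfolding comb_pairs_def by blast
  obtain d where "\<And>w. a * (\<Sum>n\<in>J. c n * w n) + b * (\<Sum>n\<in>J'. c' n * w n) = (\<Sum>n\<in>J \<union> J'. d n * w n)"
    using sum_lincomb_union[OF J(1,3), of a c b c'] by blast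
  thus "((\<lambda>x. a * s x + b * s' x), (\<lambda>x. a * t x + b * t' x)) \<in> comb_pairs I e f"
    unfolding st comb_pairs_def using J
    by (intro CollectI exI[of _ "J \<union> J'"] exI[of _ d]) auto
next
  fix u and \<epsilon> :: real assume u: "u \<in> L2 M" "\<epsilon> > 0"
  obtain J c where J: "finite J" "J \<subseteq> I" and near: "L2_sq M (\<lambda>x. u x - (\<Sum>n\<in>J. c n * e n x)) < \<epsilon>"
    using total[unfolded L2_total_def, rule_format, OF u] by (elim exE conjE)
  have "((\<lambda>x. \<Sum>n\<in>J. c n * e n x), (\<lambda>x. \<Sum>n\<in>J. c n * f n x)) \<in> comb_pairs I e f"
    using J unfolding comb_pairs_def by blast
  with near show "\<exists>(s, t)\<in>comb_pairs I e f. L2_sq M (\<lambda>x. u x - s x) < \<epsilon>"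
    by (intro bexI[of _ "((\<lambda>x. \<Sum>n\<in>J. c n * e n x), (\<lambda>x. \<Sum>n\<in>J. c n * f n x))"]) auto
next
  fix s t assume "(s, t) \<in> comb_pairs I e f"
  then obtain J c where J: "finite J" "J \<subseteq> I"
    and st: "s = (\<lambda>x. \<Sum>n\<in>J. c n * e n x)" "t = (\<lambda>x. \<Sum>n\<in>J. c n * f n x)"
    unfolding comb_pairs_def by blast
  show "s \<in> L2 M \<and> t \<in> L2 M"
    unfolding st using J e f by (intro conjI L2_sum) auto
  show "L2_sq M t \<le> C * L2_sq M s"
    unfolding st using J by (rule bounded)
qed fact

lemma L2_orthonormal_basisI:
  assumes "\<And>n. n \<in> I \<Longrightarrow> e n \<in> L2 M"
    and "\<And>m n. m \<in> I \<Longrightarrow> n \<in> I \<Longrightarrow> L2_inner M (e m) (e n) = (if m = n then 1 else 0)"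
    and "L2_total M I e"
  shows "L2_orthonormal_basis M I e"
  unfolding L2_orthonormal_basis_def
proof (intro conjI ballI allI impI)
  fix f and \<epsilon> :: real assume "f \<in> L2 M" "\<epsilon> > 0"
  then obtain J c where J: "finite J" "J \<subseteq> I" and "L2_sq M (\<lambda>x. f x - (\<Sum>n\<in>J. c n * e n x)) < \<epsilon>\<^sup>2"
    using assms(3)[unfolded L2_total_def, rule_format, of f "\<epsilon>\<^sup>2"] by auto
  hence "L2_norm M (\<lambda>x. f x - (\<Sum>n\<in>J. c n * e n x)) < sqrt (\<epsilon>\<^sup>2)"
    unfolding L2_norm_eq_sqrt by (intro real_sqrt_less_mono)
  thus "\<exists>J c. finite J \<and> J \<subseteq> I \<and> L2_norm M (\<lambda>x. f x - (\<Sum>n\<in>J. c n * e n x)) < \<epsilon>"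
    using J \<open>\<epsilon> > 0\<close> by auto
qed (use assms in auto)

text \<open>
  The criterion by which the characters are recognised as a Riesz basis. Everything is stated in
  terms of finite sums; the map \<open>e n \<mapsto> f n\<close> and its inverse extend by \<open>bounded_invertible_extension\<close>.
\<close>

lemma L2_riesz_basisI:
  assumes I: "countable I"
    and e: "\<And>n. n \<in> I \<Longrightarrow> e n \<in> L2 M" and f: "\<And>n. n \<in> I \<Longrightarrow> f n \<in> L2 M"
    and orth: "\<And>m n. m \<in> I \<Longrightarrow> n \<in> I \<Longrightarrow> L2_inner M (e m) (e n) = (if m = n then 1 else 0)"
    and total: "L2_total M I e" "L2_total M I f"
    and C: "C \<ge> 0" and fe: "\<And>J c. finite J \<Longrightarrow> J \<subseteq> I \<Longrightarrow>
      L2_sq M (\<lambda>x. \<Sum>n\<in>J. c n * f n x) \<le> C * L2_sq M (\<lambda>x. \<Sum>n\<in>J. c n * e n x)"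
    and C': "C' \<ge> 0" and ef: "\<And>J c. finite J \<Longrightarrow> J \<subseteq> I \<Longrightarrow>
      L2_sq M (\<lambda>x. \<Sum>n\<in>J. c n * e n x) \<le> C' * L2_sq M (\<lambda>x. \<Sum>n\<in>J. c n * f n x)"
  shows "L2_riesz_basis M I f"
proof -
  have "bounded_L2_relation M (comb_pairs I e f) C"
    using e f total(1) C fe by (rule bounded_L2_relation_comb_pairs)
  moreover have "bounded_L2_relation M ((comb_pairs I e f)\<inverse>) C'"
    unfolding comb_pairs_converse
    using f e total(2) C' ef by (rule bounded_L2_relation_comb_pairs)
  ultimately obtain T where T: "L2_bounded_invertible M T"
      "\<And>s t. (s, t) \<in> comb_pairs I e f \<Longrightarrow> AE x in M. T s x = t x"
    using bounded_invertible_extension by blast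
  have "AE x in M. f n x = T (e n) x" if "n \<in> I" for n
  proof -
    have "((\<lambda>x. \<Sum>n\<in>{n}. 1 * e n x), (\<lambda>x. \<Sum>n\<in>{n}. 1 * f n x)) \<in> comb_pairs I e f"
      using that unfolding comb_pairs_def
      by (intro CollectI exI[of _ "{n}"] exI[of _ "\<lambda>_. 1"]) simp
    from T(2)[OF this] show ?thesis by (auto elim!: eventually_mono)
  qed
  thus ?thesis
    unfolding L2_riesz_basis_def
    using I f T(1) L2_orthonormal_basisI[OF e orth total(1)] by blast
qed

lemma L2_riesz_basis_reindex:
  assumes g: "bij_betw g I X" and riesz: "L2_riesz_basis M X f"
  shows "L2_riesz_basis M I (f \<circ> g)"
proof -
  obtain T e where Te: "L2_bounded_invertible M T" "L2_orthonormal_basis M X e"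
      "\<And>n. n \<in> X \<Longrightarrow> AE x in M. f n x = T (e n) x"
    and X: "countable X" "\<And>n. n \<in> X \<Longrightarrow> f n \<in> L2 M"
    using riesz unfolding L2_riesz_basis_def by blast
  have gX: "g n \<in> X" if "n \<in> I" for n using g that by (auto simp: bij_betw_def)
  have inj: "g m = g n \<longleftrightarrow> m = n" if "m \<in> I" "n \<in> I" for m n
    using g that by (auto simp: bij_betw_def inj_on_def)
  have "L2_orthonormal_basis M I (e \<circ> g)"
    unfolding L2_orthonormal_basis_def
  proof (intro conjI ballI allI impI)
    fix u and \<epsilon> :: real assume "u \<in> L2 M" "\<epsilon> > 0"
    then obtain J c where J: "finite J" "J \<subseteq> X"
      and near: "L2_norm M (\<lambda>x. u x - (\<Sum>n\<in>J. c n * e n x)) < \<epsilon>"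
      using Te(2)[unfolded L2_orthonormal_basis_def, THEN conjunct2, THEN conjunct2, rule_format, of u \<epsilon>] by auto
    define J' where "J' = {n\<in>I. g n \<in> J}"
    have "g ` J' = J" using g J by (auto simp: J'_def bij_betw_def)
    moreover have "inj_on g J'" using g by (auto simp: J'_def bij_betw_def inj_on_def)
    ultimately have bij: "bij_betw g J' J" by (simp add: bij_betw_def)
    have "(\<Sum>n\<in>J'. c (g n) * (e \<circ> g) n x) = (\<Sum>n\<in>J. c n * e n x)" for x
      using sum.reindex_bij_betw[OF bij, of "\<lambda>n. c n * e n x"] by simp
    moreover have "finite J'" using bij_betw_finite[OF bij] J by simp
    ultimately show "\<exists>J c. finite J \<and> J \<subseteq> I \<and> L2_norm M (\<lambda>x. u x - (\<Sum>n\<in>J. c n * (e \<circ> g) n x)) < \<epsilon>"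
      using near by (intro exI[of _ J'] exI[of _ "c \<circ> g"]) (auto simp: J'_def)
  qed (use Te(2) gX inj in \<open>auto simp: L2_orthonormal_basis_def\<close>)
  moreover have "countable I"
    using bij_betw_imp_surj_on[OF bij_betw_inv_into[OF g]] X(1) by (metis countable_image)
  ultimately show ?thesis
    unfolding L2_riesz_basis_def using X(2) gX Te(1,3)
    by (intro conjI exI[of _ T] exI[of _ "e \<circ> g"]) auto
qed

section \<open>Finite systems of functions separating points\<close>

definition combs :: "('a \<Rightarrow> complex) set \<Rightarrow> ('a \<Rightarrow> complex) set" where
  "combs X = {(\<lambda>x. \<Sum>\<phi>\<in>J. c \<phi> * \<phi> x) | J c. finite J \<and> J \<subseteq> X}"

lemma combsE:
  assumes "f \<in> combs X"
  obtains J c where "finite J" "J \<subseteq> X" "f = (\<lambda>x. \<Sum>\<phi>\<in>J. c \<phi> * \<phi> x)"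
  using assms unfolding combs_def by blast

lemma combs_mem: "\<phi> \<in> X \<Longrightarrow> \<phi> \<in> combs X"
  unfolding combs_def by (intro CollectI exI[of _ "{\<phi>}"] exI[of _ "\<lambda>_. 1"]) auto

lemma combs_zero: "(\<lambda>x. 0) \<in> combs X"
  unfolding combs_def by (intro CollectI exI[of _ "{}"]) auto

lemma combs_lincomb:
  assumes "f \<in> combs X" "g \<in> combs X"
  shows "(\<lambda>x. a * f x + b * g x) \<in> combs X"
proof -
  obtain J c where J: "finite J" "J \<subseteq> X" and f: "f = (\<lambda>x. \<Sum>\<phi>\<in>J. c \<phi> * \<phi> x)"
    using assms(1) by (rule combsE)
  obtain J' c' where J': "finite J'" "J' \<subseteq> X" and g: "g = (\<lambda>x. \<Sum>\<phi>\<in>J'. c' \<phi> * \<phi> x)"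
    using assms(2) by (rule combsE)
  obtain d where "\<And>w. a * (\<Sum>\<phi>\<in>J. c \<phi> * w \<phi>) + b * (\<Sum>\<phi>\<in>J'. c' \<phi> * w \<phi>) = (\<Sum>\<phi>\<in>J \<union> J'. d \<phi> * w \<phi>)"
    using sum_lincomb_union[OF J(1) J'(1), of a c b c'] by blast
  thus ?thesis
    unfolding combs_def f g using J J'
    by (intro CollectI exI[of _ "J \<union> J'"] exI[of _ d]) auto
qed

lemma combs_sum:
  "(\<And>i. i \<in> J \<Longrightarrow> f i \<in> combs X) \<Longrightarrow> (\<lambda>x. \<Sum>i\<in>J. c i * f i x) \<in> combs X"
proof (induction J rule: infinite_finite_induct)
  case (insert i J)
  thus ?case using combs_lincomb[of "f i" X "\<lambda>x. \<Sum>i\<in>J. c i * f i x" "c i" 1] by simp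
qed (auto intro: combs_zero)

lemma combs_mult:
  assumes mult: "\<And>\<phi> \<phi>'. \<phi> \<in> X \<Longrightarrow> \<phi>' \<in> X \<Longrightarrow> (\<lambda>x. \<phi> x * \<phi>' x) \<in> X"
    and f: "f \<in> combs X" and g: "g \<in> combs X"
  shows "(\<lambda>x. f x * g x) \<in> combs X"
proof -
  obtain J c where J: "J \<subseteq> X" "f = (\<lambda>x. \<Sum>\<phi>\<in>J. c \<phi> * \<phi> x)" using f by (rule combsE)
  obtain J' c' where J': "J' \<subseteq> X" "g = (\<lambda>x. \<Sum>\<phi>\<in>J'. c' \<phi> * \<phi> x)" using g by (rule combsE)
  have "(\<lambda>x. \<Sum>\<phi>\<in>J. c \<phi> * (\<Sum>\<phi>'\<in>J'. c' \<phi>' * (\<phi> x * \<phi>' x))) \<in> combs X"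
    using J(1) J'(1) mult by (intro combs_sum combs_mem) auto
  thus ?thesis by (simp add: J J' sum_distrib_left sum_distrib_right mult_ac)
qed

text \<open>
  The matrices \<open>(\<phi> j a)\<close> and \<open>(Y a j)\<close>, whose rows and columns are both indexed by the finite set \<open>A\<close>, are
  inverse to each other.
\<close>

definition biorthogonal :: "'a set \<Rightarrow> ('a \<Rightarrow> 'a \<Rightarrow> complex) \<Rightarrow> ('a \<Rightarrow> 'a \<Rightarrow> complex) \<Rightarrow> bool" where
  "biorthogonal A \<phi> Y \<longleftrightarrow>
    (\<forall>a\<in>A. \<forall>b\<in>A. (\<Sum>j\<in>A. Y a j * \<phi> j b) = (if a = b then 1 else 0)) \<and>
    (\<forall>i\<in>A. \<forall>j\<in>A. (\<Sum>a\<in>A. \<phi> i a * Y a j) = (if i = j then 1 else 0))"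

locale function_monoid =
  fixes X :: "('a \<Rightarrow> complex) set"
  assumes one: "(\<lambda>x. 1) \<in> X"
    and mult: "\<phi> \<in> X \<Longrightarrow> \<phi>' \<in> X \<Longrightarrow> (\<lambda>x. \<phi> x * \<phi>' x) \<in> X"
begin

text \<open>The interpolating function is a product of factors \<open>(\<phi> x - \<phi> b) / (\<phi> a - \<phi> b)\<close>.\<close>

lemma interpolation:
  assumes "finite B" and sep: "\<And>b. b \<in> B \<Longrightarrow> \<exists>\<phi>\<in>X. \<phi> a \<noteq> \<phi> b"
  shows "\<exists>f\<in>combs X. f a = 1 \<and> (\<forall>b\<in>B. f b = 0)"
  using assms
proof (induction B rule: finite_induct)
  case empty
  show ?case using combs_mem[OF one] by (intro bexI[of _ "\<lambda>x. 1"]) auto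
next
  case (insert b B)
  then obtain f where f: "f \<in> combs X" "f a = 1" "\<And>b. b \<in> B \<Longrightarrow> f b = 0" by blast
  obtain \<phi> where \<phi>: "\<phi> \<in> X" "\<phi> a \<noteq> \<phi> b" using insert.prems by blast
  define g where "g = (\<lambda>x. inverse (\<phi> a - \<phi> b) * \<phi> x + (- \<phi> b * inverse (\<phi> a - \<phi> b)) * 1)"
  have g: "g \<in> combs X"
    unfolding g_def by (rule combs_lincomb[OF combs_mem[OF \<phi>(1)] combs_mem[OF one]])
  have "g x = inverse (\<phi> a - \<phi> b) * (\<phi> x - \<phi> b)" for x by (simp add: g_def algebra_simps)
  hence gab: "g a = 1" "g b = 0" using \<phi>(2) by simp_all
  show ?case
  proof (intro bexI conjI)
    show "(\<lambda>x. f x * g x) \<in> combs X" by (rule combs_mult[OF mult f(1) g])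
  qed (use f gab in auto)
qed

text \<open>
  The induction on \<open>A\<close> is simplest with linear independence in place of one of the two matrix
  identities.
\<close>

definition dual_families :: "'a set \<Rightarrow> ('a \<Rightarrow> 'a \<Rightarrow> complex) \<Rightarrow> ('a \<Rightarrow> 'a \<Rightarrow> complex) \<Rightarrow> bool" where
  "dual_families A \<phi> Y \<longleftrightarrow> (\<forall>j\<in>A. \<phi> j \<in> X) \<and>
    (\<forall>c. (\<forall>a\<in>A. (\<Sum>j\<in>A. c j * \<phi> j a) = 0) \<longrightarrow> (\<forall>j\<in>A. c j = 0)) \<and>
    (\<forall>a\<in>A. \<forall>b\<in>A. (\<Sum>j\<in>A. Y a j * \<phi> j b) = (if a = b then 1 else 0))"

lemma dual_familiesD:
  assumes "dual_families A \<phi> Y"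
  shows "\<And>j. j \<in> A \<Longrightarrow> \<phi> j \<in> X"
    and "\<And>c j. (\<And>a. a \<in> A \<Longrightarrow> (\<Sum>j\<in>A. c j * \<phi> j a) = 0) \<Longrightarrow> j \<in> A \<Longrightarrow> c j = 0"
    and "\<And>a b. a \<in> A \<Longrightarrow> b \<in> A \<Longrightarrow> (\<Sum>j\<in>A. Y a j * \<phi> j b) = (if a = b then 1 else 0)"
proof -
  show "\<phi> j \<in> X" if "j \<in> A" for j using assms that by (simp add: dual_families_def)
  show "c j = 0" if "\<And>a. a \<in> A \<Longrightarrow> (\<Sum>j\<in>A. c j * \<phi> j a) = 0" "j \<in> A" for c j
    using assms[unfolded dual_families_def, THEN conjunct2, THEN conjunct1, rule_format, of c j] that by simp
  show "(\<Sum>j\<in>A. Y a j * \<phi> j b) = (if a = b then 1 else 0)" if "a \<in> A" "b \<in> A" for a b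
    using assms that by (simp add: dual_families_def)
qed

text \<open>
  Suppose the family is constructed on \<open>A\<close>, and let \<open>b\<close> be a new point. For a function \<open>g\<close>, the interpolant of its
  values on \<open>A\<close> by the \<open>\<phi> j\<close> takes the value \<open>\<Sum>a\<in>A. g a * u a\<close> at \<open>b\<close>. Not every \<open>\<psi> \<in> X\<close> can agree with its
  interpolant at \<open>b\<close>, because then no combination of elements of \<open>X\<close> could separate \<open>b\<close> from \<open>A\<close>. A \<open>\<psi>\<close> that
  disagrees is the new member of the family.
\<close>

lemma dual_families_exist:
  assumes "finite A" and sep: "\<And>a b. a \<in> A \<Longrightarrow> b \<in> A \<Longrightarrow> a \<noteq> b \<Longrightarrow> \<exists>\<phi>\<in>X. \<phi> a \<noteq> \<phi> b"
  shows "\<exists>\<phi> Y. dual_families A \<phi> Y"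
  using assms
proof (induction A rule: finite_induct)
  case (insert b A)
  then obtain \<phi> Y where fam: "dual_families A \<phi> Y" by (metis insertCI)
  note \<phi> = dual_familiesD(1)[OF fam] and indep = dual_familiesD(2)[OF fam] and dual = dual_familiesD(3)[OF fam]
  define u where "u = (\<lambda>a. \<Sum>j\<in>A. Y a j * \<phi> j b)"
  have "\<exists>\<psi>\<in>X. \<psi> b \<noteq> (\<Sum>a\<in>A. \<psi> a * u a)"
  proof (rule ccontr)
    assume "\<not> (\<exists>\<psi>\<in>X. \<psi> b \<noteq> (\<Sum>a\<in>A. \<psi> a * u a))"
    hence *: "\<psi> b = (\<Sum>a\<in>A. \<psi> a * u a)" if "\<psi> \<in> X" for \<psi> using that by blast
    obtain f where f: "f \<in> combs X" "f b = 1" "\<And>a. a \<in> A \<Longrightarrow> f a = 0"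
      using interpolation[of A b] insert by (metis insertCI)
    obtain J c where J: "J \<subseteq> X" "f = (\<lambda>x. \<Sum>\<phi>\<in>J. c \<phi> * \<phi> x)" using f(1) by (rule combsE)
    have "f b = (\<Sum>\<psi>\<in>J. c \<psi> * (\<Sum>a\<in>A. \<psi> a * u a))"
      unfolding J(2) using J(1) * by (intro sum.cong) auto
    also have "\<dots> = (\<Sum>\<psi>\<in>J. \<Sum>a\<in>A. c \<psi> * \<psi> a * u a)"
      by (simp add: sum_distrib_left mult.assoc)
    also have "\<dots> = (\<Sum>a\<in>A. \<Sum>\<psi>\<in>J. c \<psi> * \<psi> a * u a)" by (rule sum.swap)
    also have "\<dots> = (\<Sum>a\<in>A. f a * u a)" by (simp add: J(2) sum_distrib_right)
    also have "\<dots> = 0" using f(3) by simp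
    finally show False using f(2) by simp
  qed
  then obtain \<psi> where \<psi>: "\<psi> \<in> X" "\<psi> b \<noteq> (\<Sum>a\<in>A. \<psi> a * u a)" by blast
  \<comment> \<open>The coefficients of the interpolant of \<open>\<psi>\<close> on \<open>A\<close>.\<close>
  define w where "w = (\<lambda>j. \<Sum>a\<in>A. \<psi> a * Y a j)"
  have w: "(\<Sum>j\<in>A. w j * \<phi> j x) = (\<Sum>a\<in>A. \<psi> a * (\<Sum>j\<in>A. Y a j * \<phi> j x))" for x
    unfolding w_def sum_distrib_left sum_distrib_right by (subst sum.swap) (simp add: mult_ac)
  have w_A: "(\<Sum>j\<in>A. w j * \<phi> j a) = \<psi> a" if "a \<in> A" for a
  proof -
    have "(\<Sum>a'\<in>A. \<psi> a' * (\<Sum>j\<in>A. Y a' j * \<phi> j a)) = (\<Sum>a'\<in>A. if a' = a then \<psi> a' else 0)"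
      using dual that by (intro sum.cong) auto
    thus ?thesis using that insert.hyps by (simp add: w)
  qed
  define \<gamma> where "\<gamma> = \<psi> b - (\<Sum>j\<in>A. w j * \<phi> j b)"
  have \<gamma>: "\<gamma> \<noteq> 0" using \<psi>(2) by (simp add: \<gamma>_def w u_def)
  define \<phi>' where "\<phi>' = \<phi>(b := \<psi>)"
  have sum_\<phi>': "(\<Sum>j\<in>insert b A. c j * \<phi>' j x) = c b * \<psi> x + (\<Sum>j\<in>A. c j * \<phi> j x)" for c x
  proof -
    have "(\<Sum>j\<in>A. c j * \<phi>' j x) = (\<Sum>j\<in>A. c j * \<phi> j x)"
      using insert.hyps by (intro sum.cong) (auto simp: \<phi>'_def)
    thus ?thesis using insert.hyps by (simp add: \<phi>'_def)
  qed
  have indep': "c j = 0"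
    if c: "\<And>a. a \<in> insert b A \<Longrightarrow> (\<Sum>j\<in>insert b A. c j * \<phi>' j a) = 0" and j: "j \<in> insert b A" for c j
  proof -
    have cA: "c j + c b * w j = 0" if "j \<in> A" for j
    proof (rule indep[OF _ that])
      fix a assume a: "a \<in> A"
      have "(\<Sum>j\<in>A. (c j + c b * w j) * \<phi> j a) = (\<Sum>j\<in>A. c j * \<phi> j a) + c b * (\<Sum>j\<in>A. w j * \<phi> j a)"
        by (simp add: distrib_right sum.distrib sum_distrib_left mult.assoc)
      thus "(\<Sum>j\<in>A. (c j + c b * w j) * \<phi> j a) = 0"
        using c[of a] a by (simp add: sum_\<phi>' w_A add.commute del: sum.insert)
    qed
    have "(\<Sum>j\<in>A. c j * \<phi> j b) = (\<Sum>j\<in>A. - c b * (w j * \<phi> j b))"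
    proof (rule sum.cong)
      fix j assume "j \<in> A"
      hence "c j = - (c b * w j)" using cA by (simp add: eq_neg_iff_add_eq_0)
      thus "c j * \<phi> j b = - c b * (w j * \<phi> j b)" by simp
    qed simp
    hence "c b * \<gamma> = 0"
      using c[of b] unfolding sum_\<phi>' \<gamma>_def by (simp add: sum_distrib_left[symmetric] algebra_simps sum_negf)
    hence "c b = 0" using \<gamma> by simp
    thus ?thesis using cA j by auto
  qed
  \<comment> \<open>The combination \<open>(\<psi> - interpolant) / \<gamma>\<close>, which is 1 at \<open>b\<close> and 0 on \<open>A\<close>.\<close>
  define y where "y = (\<lambda>j. if j = b then inverse \<gamma> else - w j * inverse \<gamma>)"
  have y: "(\<Sum>j\<in>insert b A. y j * \<phi>' j x) = inverse \<gamma> * (\<psi> x - (\<Sum>j\<in>A. w j * \<phi> j x))" for x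
  proof -
    have "(\<Sum>j\<in>A. y j * \<phi> j x) = (\<Sum>j\<in>A. - inverse \<gamma> * (w j * \<phi> j x))"
      using insert.hyps by (intro sum.cong) (auto simp: y_def)
    thus ?thesis
      unfolding sum_\<phi>' by (simp add: y_def sum_distrib_left[symmetric] sum_negf algebra_simps)
  qed
  have y_b: "(\<Sum>j\<in>insert b A. y j * \<phi>' j b) = 1" unfolding y using \<gamma> by (simp add: \<gamma>_def)
  have y_A: "(\<Sum>j\<in>insert b A. y j * \<phi>' j a) = 0" if "a \<in> A" for a unfolding y using w_A that by simp
  \<comment> \<open>The old dual functions take the value \<open>u a\<close> at \<open>b\<close>; this is corrected by a multiple of the row of \<open>b\<close>.\<close>
  define Y' where "Y' = (\<lambda>a j. if a = b then y j else (if j = b then 0 else Y a j) - u a * y j)"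
  have Y': "(\<Sum>j\<in>insert b A. Y' a j * \<phi>' j x)
      = (\<Sum>j\<in>A. Y a j * \<phi> j x) - u a * (\<Sum>j\<in>insert b A. y j * \<phi>' j x)" if "a \<in> A" for a x
  proof -
    have ab: "a \<noteq> b" using that insert.hyps by auto
    have "(\<Sum>j\<in>insert b A. Y' a j * \<phi>' j x)
      = (\<Sum>j\<in>insert b A. (if j = b then 0 else Y a j) * \<phi>' j x) - (\<Sum>j\<in>insert b A. u a * (y j * \<phi>' j x))"
      using ab by (simp only: Y'_def if_False sum_subtractf[symmetric] left_diff_distrib mult.assoc)
    also have "(\<Sum>j\<in>insert b A. (if j = b then 0 else Y a j) * \<phi>' j x) = (\<Sum>j\<in>A. Y a j * \<phi> j x)"
      unfolding sum_\<phi>' using insert.hyps by (auto intro!: sum.cong)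
    finally show ?thesis by (simp only: sum_distrib_left)
  qed
  have dual': "(\<Sum>j\<in>insert b A. Y' a j * \<phi>' j x) = (if a = x then 1 else 0)"
    if "a \<in> insert b A" "x \<in> insert b A" for a x
  proof (cases "a = b")
    case True
    thus ?thesis using that y_b y_A insert.hyps by (auto simp: Y'_def simp del: sum.insert)
  next
    case False
    hence a: "a \<in> A" using that by simp
    show ?thesis
      unfolding Y'[OF a] using that a False y_b y_A dual[OF a] u_def insert.hyps by (auto simp del: sum.insert)
  qed
  have \<phi>': "\<phi>' j \<in> X" if "j \<in> insert b A" for j
    using that \<phi> \<psi>(1) by (auto simp: \<phi>'_def)
  have "dual_families (insert b A) \<phi>' Y'"
    unfolding dual_families_def
  proof (intro conjI ballI allI impI)
    show "c j = 0" if "\<forall>a\<in>insert b A. (\<Sum>j\<in>insert b A. c j * \<phi>' j a) = 0" "j \<in> insert b A" for c j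
      by (rule indep'[OF bspec[OF that(1)] that(2)])
  qed (rule \<phi>' dual'; assumption)+
  thus ?case by (intro exI)
next
  case empty
  have "dual_families {} \<phi> Y" for \<phi> Y by (simp add: dual_families_def)
  thus ?case by (intro exI)
qed

text \<open>
  A one-sided inverse of the square matrix is two-sided: by independence, the expansion of \<open>\<phi> i\<close> in the
  family obtained by interpolating its values on \<open>A\<close> is the trivial one.
\<close>

lemma biorthogonal_family:
  assumes A: "finite A" and sep: "\<And>a b. a \<in> A \<Longrightarrow> b \<in> A \<Longrightarrow> a \<noteq> b \<Longrightarrow> \<exists>\<phi>\<in>X. \<phi> a \<noteq> \<phi> b"
  shows "\<exists>\<phi> Y. (\<forall>j\<in>A. \<phi> j \<in> X) \<and> biorthogonal A \<phi> Y"
proof -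
  obtain \<phi> Y where fam: "dual_families A \<phi> Y" using dual_families_exist[OF assms] by blast
  note \<phi> = dual_familiesD(1)[OF fam] and indep = dual_familiesD(2)[OF fam] and dual = dual_familiesD(3)[OF fam]
  have "(\<Sum>a\<in>A. \<phi> i a * Y a j) = (if i = j then 1 else 0)" if i: "i \<in> A" and j: "j \<in> A" for i j
  proof -
    define c where "c = (\<lambda>j. (\<Sum>a\<in>A. \<phi> i a * Y a j) - (if i = j then 1 else 0))"
    have "(\<Sum>j\<in>A. c j * \<phi> j b) = 0" if b: "b \<in> A" for b
    proof -
      have "(\<Sum>j\<in>A. (\<Sum>a\<in>A. \<phi> i a * Y a j) * \<phi> j b) = (\<Sum>a\<in>A. \<phi> i a * (\<Sum>j\<in>A. Y a j * \<phi> j b))"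
        unfolding sum_distrib_left sum_distrib_right by (subst sum.swap) (simp add: mult_ac)
      also have "\<dots> = (\<Sum>a\<in>A. if a = b then \<phi> i a else 0)"
        using dual b by (intro sum.cong) auto
      also have "\<dots> = \<phi> i b" using A b by simp
      moreover have "(\<Sum>j\<in>A. (if i = j then 1 else 0) * \<phi> j b) = (\<Sum>j\<in>A. if i = j then \<phi> j b else 0)"
        by (intro sum.cong) auto
      ultimately show ?thesis using A i by (simp add: c_def left_diff_distrib sum_subtractf)
    qed
    from indep[OF this j] show ?thesis by (simp add: c_def)
  qed
  hence "biorthogonal A \<phi> Y" using dual by (simp add: biorthogonal_def)
  with \<phi> show ?thesis by blast
qed

end

text \<open>
  \<open>L2_total\<close> speaks of sums over indices, \<open>combs\<close> of sums over functions. The next two lemmas translate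
  between them.
\<close>

lemma L2_total_combs:
  assumes e: "\<And>n. n \<in> I \<Longrightarrow> e n \<in> L2 M"
    and dense: "\<And>u \<epsilon>. u \<in> L2 M \<Longrightarrow> \<epsilon> > 0 \<Longrightarrow> \<exists>s\<in>combs (e ` I). L2_sq M (\<lambda>x. u x - s x) < \<epsilon>"
  shows "L2_total M I e"
  unfolding L2_total_def
proof (intro ballI allI impI)
  fix u and \<epsilon> :: real assume "u \<in> L2 M" "\<epsilon> > 0"
  then obtain s where s: "s \<in> combs (e ` I)" "L2_sq M (\<lambda>x. u x - s x) < \<epsilon>" using dense by blast
  obtain J c where J: "finite J" "J \<subseteq> e ` I" "s = (\<lambda>x. \<Sum>\<phi>\<in>J. c \<phi> * \<phi> x)"
    using s(1) by (rule combsE)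
  define J' where "J' = inv_into I e ` J"
  have inv: "e (inv_into I e \<phi>) = \<phi>" if "\<phi> \<in> J" for \<phi>
    using that J(2) by (auto intro: f_inv_into_f)
  have "inj_on (inv_into I e) J" using inv by (metis inj_onI)
  hence "(\<Sum>n\<in>J'. c (e n) * e n x) = s x" for x
    unfolding J'_def J(3) by (subst sum.reindex) (auto simp: inv)
  moreover have "finite J'" "J' \<subseteq> I"
    using J by (auto simp: J'_def intro: inv_into_into)
  ultimately show "\<exists>J c. finite J \<and> J \<subseteq> I \<and> L2_sq M (\<lambda>x. u x - (\<Sum>n\<in>J. c n * e n x)) < \<epsilon>"
    using s(2) by (intro exI[of _ J'] exI[of _ "\<lambda>n. c (e n)"]) simp
qed

lemma L2_total_combsD:
  assumes total: "L2_total M I e" and "u \<in> L2 M" "\<epsilon> > 0"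
  shows "\<exists>s\<in>combs (e ` I). L2_sq M (\<lambda>x. u x - s x) < \<epsilon>"
proof -
  obtain J c where J: "finite J" "J \<subseteq> I" and near: "L2_sq M (\<lambda>x. u x - (\<Sum>n\<in>J. c n * e n x)) < \<epsilon>"
    using total[unfolded L2_total_def, rule_format, OF assms(2,3)] by (elim exE conjE)
  have "(\<lambda>x. \<Sum>n\<in>J. c n * e n x) \<in> combs (e ` I)"
    using J by (intro combs_sum combs_mem) auto
  with near show ?thesis by (intro bexI[of _ "\<lambda>x. \<Sum>n\<in>J. c n * e n x"])
qed

lemma combs_transfer:
  assumes "\<And>\<phi>. \<phi> \<in> E \<Longrightarrow> \<exists>t\<in>combs F. \<forall>x\<in>\<Omega>. t x = \<phi> x" and "s \<in> combs E"
  shows "\<exists>t\<in>combs F. \<forall>x\<in>\<Omega>. t x = s x"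
proof -
  obtain J c where J: "J \<subseteq> E" "s = (\<lambda>x. \<Sum>\<phi>\<in>J. c \<phi> * \<phi> x)" using assms(2) by (rule combsE)
  obtain t where t: "\<And>\<phi>. \<phi> \<in> E \<Longrightarrow> t \<phi> \<in> combs F" "\<And>\<phi> x. \<phi> \<in> E \<Longrightarrow> x \<in> \<Omega> \<Longrightarrow> t \<phi> x = \<phi> x"
    using assms(1) by metis
  show ?thesis
  proof (intro bexI ballI)
    show "(\<lambda>x. \<Sum>\<phi>\<in>J. c \<phi> * t \<phi> x) \<in> combs F" using t(1) J(1) by (intro combs_sum) auto
    show "(\<Sum>\<phi>\<in>J. c \<phi> * t \<phi> x) = s x" if "x \<in> \<Omega>" for x
      unfolding J(2) using t(2) J(1) that by (intro sum.cong) auto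
  qed
qed

text \<open>The Hilbert-Schmidt bound for the norm of the matrix \<open>B\<close>.\<close>

lemma sum_cmod_sq_matrix_le:
  fixes w :: "'i \<Rightarrow> complex" and B :: "'i \<Rightarrow> 'j \<Rightarrow> complex"
  shows "(\<Sum>j\<in>J. (cmod (\<Sum>i\<in>I. w i * B i j))\<^sup>2)
    \<le> (\<Sum>j\<in>J. \<Sum>i\<in>I. (cmod (B i j))\<^sup>2) * (\<Sum>i\<in>I. (cmod (w i))\<^sup>2)"
  unfolding sum_distrib_right
proof (rule sum_mono)
  fix j assume "j \<in> J"
  have "(cmod (\<Sum>i\<in>I. w i * B i j))\<^sup>2 \<le> (\<Sum>i\<in>I. cmod (w i) * cmod (B i j))\<^sup>2"
    by (intro power_mono sum_norm_le) (auto simp: norm_mult)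
  also have "\<dots> \<le> (\<Sum>i\<in>I. (cmod (w i))\<^sup>2) * (\<Sum>i\<in>I. (cmod (B i j))\<^sup>2)"
    by (rule Cauchy_Schwarz_ineq_sum)
  also have "\<dots> = (\<Sum>i\<in>I. (cmod (B i j))\<^sup>2 * (\<Sum>i\<in>I. (cmod (w i))\<^sup>2))"
    by (subst mult.commute, subst sum_distrib_right) simp
  finally show "(cmod (\<Sum>i\<in>I. w i * B i j))\<^sup>2 \<le> (\<Sum>i\<in>I. (cmod (B i j))\<^sup>2 * (\<Sum>i\<in>I. (cmod (w i))\<^sup>2))" .
qed

section \<open>Groups with small open subgroups and separating characters\<close>

definition coset :: "'a::ab_group_add set \<Rightarrow> 'a \<Rightarrow> 'a set" where
  "coset S a = {x. x - a \<in> S}"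

lemma coset_eq_image: "coset S a = (+) a ` S"
proof (intro Set.set_eqI iffI)
  show "x \<in> (+) a ` S" if "x \<in> coset S a" for x
    using that image_eqI[of x "(+) a" "x - a" S] by (simp add: coset_def)
qed (auto simp: coset_def)

lemma open_coset:
  fixes S :: "'a::topological_ab_group_add set"
  assumes "open S" shows "open (coset S a)"
proof -
  have "open ((\<lambda>x. x - a) -` S)"
    using assms by (intro open_vimage continuous_intros) auto
  thus ?thesis by (simp add: coset_def vimage_def)
qed

locale additive_subgroup =
  fixes S :: "'a::ab_group_add set"
  assumes zero: "0 \<in> S" and add: "x \<in> S \<Longrightarrow> y \<in> S \<Longrightarrow> x + y \<in> S" and minus: "x \<in> S \<Longrightarrow> - x \<in> S"
begin

lemma diff: "x \<in> S \<Longrightarrow> y \<in> S \<Longrightarrow> x - y \<in> S"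
  using add[OF _ minus] by simp

lemma self_mem_coset: "a \<in> coset S a"
  by (simp add: coset_def zero)

lemma coset_eq: "x \<in> coset S a \<Longrightarrow> coset S x = coset S a"
proof (intro Set.set_eqI iffI)
  fix y assume x: "x \<in> coset S a"
  show "y \<in> coset S a" if "y \<in> coset S x"
    using add[of "y - x" "x - a"] that x by (simp add: coset_def)
  show "y \<in> coset S x" if "y \<in> coset S a"
    using diff[of "y - a" "x - a"] that x by (simp add: coset_def)
qed

end

text \<open>
  Compactness gives a finite cover; choosing one representative per coset makes the cosets distinct.
\<close>

lemma finite_coset_cover:
  fixes S :: "'a::topological_ab_group_add set"
  assumes S: "additive_subgroup S" "open S" and K: "compact K"
  obtains A where "finite A" "A \<subseteq> K" "K \<subseteq> (\<Union>a\<in>A. coset S a)"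
    "\<And>a b. a \<in> A \<Longrightarrow> b \<in> A \<Longrightarrow> a \<in> coset S b \<Longrightarrow> a = b"
proof -
  interpret additive_subgroup S by fact
  obtain A where A: "A \<subseteq> K" "finite A" "K \<subseteq> (\<Union>a\<in>A. coset S a)"
  proof (rule compactE_image[OF K, of K "coset S"])
    show "open (coset S a)" for a by (rule open_coset[OF S(2)])
    show "K \<subseteq> (\<Union>a\<in>K. coset S a)" using self_mem_coset by blast
  qed
  define r where "r = (\<lambda>T. SOME a. a \<in> A \<and> coset S a = T)"
  have r: "r (coset S a) \<in> A \<and> coset S (r (coset S a)) = coset S a" if "a \<in> A" for a
    unfolding r_def using someI[of "\<lambda>b. b \<in> A \<and> coset S b = coset S a" a] that by blast
  show ?thesis
  proof (rule that[of "(\<lambda>a. r (coset S a)) ` A"])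
    show "K \<subseteq> (\<Union>a\<in>(\<lambda>a. r (coset S a)) ` A. coset S a)"
    proof
      fix x assume "x \<in> K"
      then obtain a where "a \<in> A" "x \<in> coset S a" using A(3) by blast
      thus "x \<in> (\<Union>a\<in>(\<lambda>a. r (coset S a)) ` A. coset S a)" using r[of a] by auto
    qed
    show "a = b" if im: "a \<in> (\<lambda>a. r (coset S a)) ` A" "b \<in> (\<lambda>a. r (coset S a)) ` A" and mem: "a \<in> coset S b" for a b
    proof -
      obtain a' b' where ab: "a' \<in> A" "a = r (coset S a')" "b' \<in> A" "b = r (coset S b')"
        using im by blast
      have "coset S a = coset S b" using coset_eq[OF mem] .
      hence "coset S a' = coset S b'" using r[OF ab(1)] r[OF ab(3)] ab by simp
      thus ?thesis using ab by simp
    qed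
  qed (use A r in auto)
qed

text \<open>
  The hypotheses on the group, the model being the group \<open>\<rat>\<^sub>p\<^sup>d\<close> with its balls. They say that the
  characters in \<open>X\<close> that are trivial on \<open>H n\<close> separate the cosets of \<open>H n\<close>.
\<close>

locale separated_group =
  fixes X :: "('a::topological_ab_group_add \<Rightarrow> complex) set" and H :: "nat \<Rightarrow> 'a set"
  assumes monoid: "function_monoid X" and countable_X: "countable X"
    and character: "\<phi> \<in> X \<Longrightarrow> is_character \<phi>"
    and subgroup: "additive_subgroup (H n)" and open_H: "open (H n)"
    and basis: "open U \<Longrightarrow> 0 \<in> U \<Longrightarrow> \<exists>n. H n \<subseteq> U"
    and separate: "x \<notin> H n \<Longrightarrow> \<exists>\<phi>\<in>X. (\<forall>y\<in>H n. \<phi> y = 1) \<and> \<phi> x \<noteq> 1"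
begin

lemma character_add: "\<phi> \<in> X \<Longrightarrow> \<phi> (x + y) = \<phi> x * \<phi> y"
  and character_norm: "\<phi> \<in> X \<Longrightarrow> cmod (\<phi> x) = 1"
  and character_continuous: "\<phi> \<in> X \<Longrightarrow> continuous_on UNIV \<phi>"
  using character unfolding is_character_def by blast+

lemma character_nonzero: "\<phi> \<in> X \<Longrightarrow> \<phi> x \<noteq> 0"
  using character_norm[of \<phi> x] by auto

lemma character_coset: "\<phi> \<in> X \<Longrightarrow> \<phi> x = \<phi> a * \<phi> (x - a)"
  using character_add[of \<phi> a "x - a"] by simp

definition annihilator :: "nat \<Rightarrow> ('a \<Rightarrow> complex) set" where
  "annihilator n = {\<phi>\<in>X. \<forall>y\<in>H n. \<phi> y = 1}"

lemma function_monoid_annihilator: "function_monoid (annihilator n)"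
  using monoid unfolding function_monoid_def annihilator_def by auto

lemma annihilator_separates:
  assumes "a \<notin> coset (H n) b"
  shows "\<exists>\<phi>\<in>annihilator n. \<phi> a \<noteq> \<phi> b"
proof -
  obtain \<phi> where \<phi>: "\<phi> \<in> annihilator n" "\<phi> (a - b) \<noteq> 1"
    using separate[of "a - b" n] assms by (auto simp: coset_def annihilator_def)
  hence X: "\<phi> \<in> X" by (simp add: annihilator_def)
  have "\<phi> a \<noteq> \<phi> b" using character_coset[OF X, of a b] character_nonzero[OF X, of b] \<phi>(2) by simp
  thus ?thesis using \<phi>(1) by blast
qed

lemma annihilator_coset: "\<phi> \<in> annihilator n \<Longrightarrow> x \<in> coset (H n) a \<Longrightarrow> \<phi> x = \<phi> a"
  using character_coset[of \<phi> x a] by (auto simp: annihilator_def coset_def)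

text \<open>
  A Lebesgue number argument: cover \<open>K\<close> by finitely many cosets of subgroups \<open>H (m a)\<close> contained in \<open>U\<close>
  and take \<open>H n\<close> inside the intersection of these subgroups.
\<close>

lemma uniform_neighbourhood:
  assumes K: "compact K" and U: "open U" "K \<subseteq> U"
  obtains n where "\<And>x. x \<in> K \<Longrightarrow> coset (H n) x \<subseteq> U"
proof -
  have "\<exists>m. coset (H m) x \<subseteq> U" if "x \<in> K" for x
  proof -
    have "open ((\<lambda>y. y + x) -` U)" using U(1) by (intro open_vimage continuous_intros) auto
    moreover have "0 \<in> (\<lambda>y. y + x) -` U" using that U(2) by auto
    ultimately obtain m where m: "H m \<subseteq> (\<lambda>y. y + x) -` U" using basis by blast
    have "y \<in> U" if "y \<in> coset (H m) x" for y
    proof -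
      have "y - x \<in> (\<lambda>y. y + x) -` U" using that m by (auto simp: coset_def)
      thus ?thesis by simp
    qed
    thus ?thesis by blast
  qed
  then obtain m where m: "\<And>x. x \<in> K \<Longrightarrow> coset (H (m x)) x \<subseteq> U" by metis
  obtain A where A: "A \<subseteq> K" "finite A" "K \<subseteq> (\<Union>a\<in>A. coset (H (m a)) a)"
  proof (rule compactE_image[OF K, of K "\<lambda>a. coset (H (m a)) a"])
    show "open (coset (H (m a)) a)" for a by (rule open_coset[OF open_H])
    show "K \<subseteq> (\<Union>a\<in>K. coset (H (m a)) a)" using additive_subgroup.self_mem_coset[OF subgroup] by blast
  qed
  have "open (\<Inter>a\<in>A. H (m a))" using A(2) open_H by (intro open_INT) auto
  moreover have "0 \<in> (\<Inter>a\<in>A. H (m a))" using additive_subgroup.zero[OF subgroup] by blast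
  ultimately obtain n where n: "H n \<subseteq> (\<Inter>a\<in>A. H (m a))" using basis by blast
  show ?thesis
  proof (rule that[of n], rule subsetI)
    fix x y assume "x \<in> K" "y \<in> coset (H n) x"
    then obtain a where a: "a \<in> A" "x \<in> coset (H (m a)) a" using A(3) by blast
    have "y - x \<in> H (m a)" using \<open>y \<in> coset (H n) x\<close> n a(1) by (auto simp: coset_def)
    hence "y \<in> coset (H (m a)) x" by (simp add: coset_def)
    hence "y \<in> coset (H (m a)) a" using additive_subgroup.coset_eq[OF subgroup a(2)] by blast
    thus "y \<in> U" using m a(1) A(1) by blast
  qed
qed

text \<open>
  Characters trivial on \<open>H n\<close> only see the finitely many cosets that meet \<open>K\<close>, so interpolation between
  representatives of these cosets produces the indicator.
\<close>

lemma coset_indicator_combs: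
  assumes K: "compact K" and x: "x \<in> K"
  shows "\<exists>f\<in>combs X. \<forall>y\<in>K. f y = indicator (coset (H n) x) y"
proof -
  interpret H: additive_subgroup "H n" by (rule subgroup)
  obtain A where A: "finite A" "A \<subseteq> K" "K \<subseteq> (\<Union>a\<in>A. coset (H n) a)"
    using finite_coset_cover[OF subgroup open_H K] by metis
  have "\<exists>\<phi>\<in>annihilator n. \<phi> x \<noteq> \<phi> b" if b: "b \<in> A - coset (H n) x" for b
  proof -
    obtain \<phi> where "\<phi> \<in> annihilator n" "\<phi> b \<noteq> \<phi> x" using annihilator_separates[of b n x] b by blast
    thus ?thesis by (intro bexI[of _ \<phi>]) auto
  qed
  then obtain f where f: "f \<in> combs (annihilator n)" "f x = 1" "\<And>b. b \<in> A - coset (H n) x \<Longrightarrow> f b = 0"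
    using function_monoid.interpolation[OF function_monoid_annihilator, of "A - coset (H n) x" n x] A(1)
    by blast
  obtain J c where J: "finite J" "J \<subseteq> annihilator n" "f = (\<lambda>x. \<Sum>\<phi>\<in>J. c \<phi> * \<phi> x)"
    using f(1) by (rule combsE)
  have inv: "f y = f a" if "y \<in> coset (H n) a" for y a
    unfolding J(3) using annihilator_coset[OF _ that] J(2) by (intro sum.cong) auto
  have "f y = indicator (coset (H n) x) y" if y: "y \<in> K" for y
  proof (cases "y \<in> coset (H n) x")
    case True
    thus ?thesis using inv f(2) by simp
  next
    case False
    obtain a where a: "a \<in> A" "y \<in> coset (H n) a" using A(3) y by blast
    have "a \<notin> coset (H n) x" using False a(2) H.coset_eq by blast
    thus ?thesis using False inv[OF a(2)] f(3) a(1) by simp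
  qed
  moreover have "f \<in> combs X"
    unfolding J(3) using J(2) by (intro combs_sum combs_mem) (auto simp: annihilator_def)
  ultimately show ?thesis by blast
qed

end

section \<open>Haar measure\<close>

locale haar_separated_group = separated_group X H
  for X :: "('a::topological_ab_group_add \<Rightarrow> complex) set" and H :: "nat \<Rightarrow> 'a set" +
  fixes \<mu> :: "'a measure"
  assumes haar: "is_haar_measure \<mu>"
begin

lemma sets_haar: "sets \<mu> = sets borel"
  using haar by (simp add: is_haar_measure_def)

lemma space_haar: "space \<mu> = UNIV"
  using sets_eq_imp_space_eq[OF sets_haar] by simp

lemmas haar_conjuncts = haar[unfolded is_haar_measure_def, THEN conjunct2, THEN conjunct2]

lemma emeasure_translate: "A \<in> sets borel \<Longrightarrow> emeasure \<mu> ((+) a ` A) = emeasure \<mu> A"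
  by (rule haar_conjuncts[THEN conjunct1, rule_format])

lemma emeasure_compact_finite: "compact K \<Longrightarrow> emeasure \<mu> K < \<infinity>"
  by (rule haar_conjuncts[THEN conjunct2, THEN conjunct1, rule_format])

lemma outer_regular: "A \<in> sets borel \<Longrightarrow> emeasure \<mu> A = (INF U\<in>{U. open U \<and> A \<subseteq> U}. emeasure \<mu> U)"
  by (rule haar_conjuncts[THEN conjunct2, THEN conjunct2, THEN conjunct1, rule_format])

lemma inner_regular: "open U \<Longrightarrow> emeasure \<mu> U = (SUP K\<in>{K. compact K \<and> K \<subseteq> U}. emeasure \<mu> K)"
  by (rule haar_conjuncts[THEN conjunct2, THEN conjunct2, THEN conjunct2, rule_format])

lemma emeasure_coset: "S \<in> sets borel \<Longrightarrow> emeasure \<mu> (coset S a) = emeasure \<mu> S"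
  unfolding coset_eq_image by (rule emeasure_translate)

lemma continuous_measurable: "continuous_on UNIV f \<Longrightarrow> f \<in> borel_measurable \<mu>"
  using borel_measurable_continuous_onI[of f] measurable_cong_sets[OF sets_haar refl] by blast

lemma translate_measurable: "(\<lambda>x. x + y) \<in> measurable \<mu> \<mu>"
proof -
  have "(\<lambda>x. x + y) \<in> borel_measurable \<mu>"
    by (intro continuous_measurable continuous_intros)
  thus ?thesis using measurable_cong_sets[OF refl sets_haar] by blast
qed

lemma distr_translate: "distr \<mu> \<mu> (\<lambda>x. x + y) = \<mu>"
proof (rule measure_eqI)
  fix A assume "A \<in> sets (distr \<mu> \<mu> (\<lambda>x. x + y))"
  hence A: "A \<in> sets \<mu>" by simp
  have "(\<lambda>x. x + y) -` A \<inter> space \<mu> = coset A (- y)"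
    by (auto simp: space_haar coset_def)
  thus "emeasure (distr \<mu> \<mu> (\<lambda>x. x + y)) A = emeasure \<mu> A"
    using A by (simp add: emeasure_distr[OF translate_measurable] emeasure_coset sets_haar)
qed simp

lemma integral_translate:
  fixes f :: "'a \<Rightarrow> complex"
  assumes "f \<in> borel_measurable \<mu>"
  shows "(LINT x|\<mu>. f (x + y)) = (LINT x|\<mu>. f x)"
  using integral_distr[OF translate_measurable assms, of y] by (simp add: distr_translate)

text \<open>
  The orthogonality relation for characters: translation by \<open>y\<close> preserves the coset and multiplies the
  integrand by \<open>\<psi> y \<noteq> 1\<close>.
\<close>

lemma integral_coset_eq_0:
  assumes S: "additive_subgroup S" "S \<in> sets borel" and y: "y \<in> S" "\<psi> y \<noteq> 1"
    and \<psi>: "\<psi> \<in> borel_measurable \<mu>" "\<And>x. \<psi> (x + y) = \<psi> x * \<psi> y"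
  shows "(LINT x|\<mu>. indicator (coset S a) x * \<psi> x) = (0::complex)"
proof -
  interpret additive_subgroup S by fact
  define f where "f = (\<lambda>x. indicator (coset S a) x * \<psi> x)"
  have "coset S a = (\<lambda>x. x + - a) -` S \<inter> space \<mu>" by (auto simp: coset_def space_haar)
  hence "coset S a \<in> sets \<mu>"
    using measurable_sets[OF translate_measurable[of "- a"], of S] S(2) by (simp add: sets_haar)
  hence f: "f \<in> borel_measurable \<mu>"
    unfolding f_def using \<psi>(1) by measurable
  have "x + y - a \<in> S \<longleftrightarrow> x - a \<in> S" for x
    using add[OF _ y(1), of "x - a"] diff[OF _ y(1), of "x + y - a"] by (auto simp: algebra_simps)
  hence "f (x + y) = \<psi> y * f x" for x
    by (simp add: f_def coset_def indicator_def \<psi>(2))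
  hence "(LINT x|\<mu>. f x) = \<psi> y * (LINT x|\<mu>. f x)"
    using integral_translate[OF f, of y] by simp
  hence "(\<psi> y - 1) * (LINT x|\<mu>. f x) = 0" by (simp add: algebra_simps)
  thus ?thesis using y(2) by (simp add: f_def)
qed

text \<open>
  Otherwise every compact set, being covered by finitely many cosets, would be null, and so would be the whole
  group by inner regularity.
\<close>

lemma emeasure_H_nonzero: "emeasure \<mu> (H n) \<noteq> 0"
proof
  assume 0: "emeasure \<mu> (H n) = 0"
  have "emeasure \<mu> K \<le> 0" if K: "compact K" for K
  proof -
    obtain A where A: "finite A" "K \<subseteq> (\<Union>a\<in>A. coset (H n) a)"
      using finite_coset_cover[OF subgroup open_H K, of n] by metis
    have sets: "coset (H n) a \<in> sets \<mu>" for a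
      using open_coset[OF open_H, of n a] by (simp add: sets_haar)
    have "emeasure \<mu> K \<le> emeasure \<mu> (\<Union>a\<in>A. coset (H n) a)"
      using A sets by (intro emeasure_mono sets.finite_UN) auto
    also have "\<dots> \<le> (\<Sum>a\<in>A. emeasure \<mu> (coset (H n) a))"
      using A(1) sets by (intro emeasure_subadditive_finite) auto
    also have "\<dots> = 0" using 0 open_H[of n] by (simp add: emeasure_coset)
    finally show ?thesis .
  qed
  hence "emeasure \<mu> UNIV \<le> 0"
    unfolding inner_regular[OF open_UNIV] by (intro SUP_least) auto
  thus False using haar by (simp add: is_haar_measure_def)
qed

end

text \<open>
  A point of \<open>\<Omega>\<close> is what bounds the measure of the small subgroups \<open>H n\<close>: they have translates inside
  \<open>\<Omega>\<close>, whose measure is finite.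
\<close>

locale haar_compact_open = haar_separated_group X H \<mu>
  for X :: "('a::topological_ab_group_add \<Rightarrow> complex) set" and H :: "nat \<Rightarrow> 'a set" and \<mu> :: "'a measure" +
  fixes \<Omega> :: "'a set"
  assumes compact_\<Omega>: "compact \<Omega>" and open_\<Omega>: "open \<Omega>" and nonempty: "\<Omega> \<noteq> {}"
begin

abbreviation M :: "'a measure" where
  "M \<equiv> restrict_space \<mu> \<Omega>"

lemma sets_\<Omega>: "\<Omega> \<inter> space \<mu> \<in> sets \<mu>"
  using open_\<Omega> by (simp add: sets_haar space_haar)

lemma space_M [simp]: "space M = \<Omega>"
  by (simp add: space_restrict_space space_haar)

lemma finite_M: "finite_measure M"
proof (rule finite_measureI)
  have "emeasure M \<Omega> = emeasure \<mu> \<Omega>" using sets_\<Omega> by (intro emeasure_restrict_space) auto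
  thus "emeasure M (space M) \<noteq> \<infinity>" using emeasure_compact_finite[OF compact_\<Omega>] by simp
qed

lemma sets_M_iff: "A \<in> sets M \<longleftrightarrow> A \<in> sets borel \<and> A \<subseteq> \<Omega>"
  using sets_restrict_space_iff[OF sets_\<Omega>, of A] by (auto simp: sets_haar)

lemma emeasure_M: "A \<subseteq> \<Omega> \<Longrightarrow> emeasure M A = emeasure \<mu> A"
  by (rule emeasure_restrict_space[OF sets_\<Omega>])

lemma emeasure_eq_measure_M: "A \<subseteq> \<Omega> \<Longrightarrow> emeasure \<mu> A = ennreal (measure M A)"
  using finite_measure.emeasure_eq_measure[OF finite_M, of A] emeasure_M by simp

lemma continuous_measurable_M: "continuous_on UNIV f \<Longrightarrow> f \<in> borel_measurable M"
  by (intro measurable_restrict_space1 continuous_measurable)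

text \<open>
  By regularity a Borel set \<open>B\<close> lies in an open set \<open>W\<close> of almost the same measure, and a compact subset
  \<open>K\<close> fills almost all of \<open>W\<close>. Finitely many disjoint cosets fit between \<open>K\<close> and \<open>W\<close>.
\<close>

lemma borel_approx_cosets:
  assumes B: "B \<in> sets M" and \<epsilon>: "\<epsilon> > 0"
  obtains n A where "finite A" "A \<subseteq> \<Omega>" "disjoint_family_on (coset (H n)) A"
    "L2_sq M (\<lambda>x. indicator B x - indicator (\<Union>a\<in>A. coset (H n) a) x) < \<epsilon>"
proof -
  have B': "B \<in> sets borel" "B \<subseteq> \<Omega>" using B by (auto simp: sets_M_iff)
  have "(INF U\<in>{U. open U \<and> B \<subseteq> U}. emeasure \<mu> U) < ennreal (measure M B + \<epsilon> / 2)"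
    unfolding outer_regular[OF B'(1), symmetric] emeasure_eq_measure_M[OF B'(2)]
    using \<epsilon> by (intro ennreal_lessI) (auto intro: add_nonneg_pos)
  then obtain U where U: "open U" "B \<subseteq> U" "emeasure \<mu> U < ennreal (measure M B + \<epsilon> / 2)"
    unfolding INF_less_iff by blast
  \<comment> \<open>Openness of \<open>\<Omega>\<close> keeps the open neighbourhood, and hence the cosets, inside \<open>\<Omega>\<close>.\<close>
  define W where "W = U \<inter> \<Omega>"
  have W: "open W" "B \<subseteq> W" "W \<subseteq> \<Omega>" using U open_\<Omega> B'(2) by (auto simp: W_def)
  have "emeasure \<mu> W \<le> emeasure \<mu> U"
    using U(1) by (intro emeasure_mono) (auto simp: W_def sets_haar)
  hence "ennreal (measure M W) < ennreal (measure M B + \<epsilon> / 2)"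
    using U(3) by (simp add: emeasure_eq_measure_M[OF W(3), symmetric])
  hence mW: "measure M W < measure M B + \<epsilon> / 2" by (simp add: ennreal_less_iff)
  \<comment> \<open>If \<open>W\<close> is small, the bound is vacuous and \<open>K = {}\<close> will do.\<close>
  have "\<exists>K. compact K \<and> K \<subseteq> W \<and> ennreal (measure M W - \<epsilon> / 2) \<le> emeasure \<mu> K"
  proof (cases "measure M W < \<epsilon> / 2")
    case True
    thus ?thesis by (intro exI[of _ "{}"]) (auto simp: ennreal_neg)
  next
    case False
    hence "ennreal (measure M W - \<epsilon> / 2) < emeasure \<mu> W"
      unfolding emeasure_eq_measure_M[OF W(3)] using \<epsilon> by (intro ennreal_lessI) auto
    hence "ennreal (measure M W - \<epsilon> / 2) < (SUP K\<in>{K. compact K \<and> K \<subseteq> W}. emeasure \<mu> K)"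
      using inner_regular[OF W(1)] by simp
    then obtain K where "compact K" "K \<subseteq> W" "ennreal (measure M W - \<epsilon> / 2) < emeasure \<mu> K"
      unfolding less_SUP_iff by blast
    thus ?thesis by (intro exI[of _ K]) auto
  qed
  then obtain K where K: "compact K" "K \<subseteq> W" "ennreal (measure M W - \<epsilon> / 2) \<le> emeasure \<mu> K" by blast
  obtain n where n: "\<And>x. x \<in> K \<Longrightarrow> coset (H n) x \<subseteq> W" using uniform_neighbourhood[OF K(1) W(1) K(2)] by blast
  obtain A where A: "finite A" "A \<subseteq> K" "K \<subseteq> (\<Union>a\<in>A. coset (H n) a)"
    "\<And>a b. a \<in> A \<Longrightarrow> b \<in> A \<Longrightarrow> a \<in> coset (H n) b \<Longrightarrow> a = b"
    using finite_coset_cover[OF subgroup open_H K(1), of n] by metis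
  define V where "V = (\<Union>a\<in>A. coset (H n) a)"
  have V: "V \<subseteq> W" "open V" using n A(2) open_coset[OF open_H] by (auto simp: V_def)
  have "emeasure \<mu> K \<le> emeasure \<mu> V"
    using A(3) V(2) by (intro emeasure_mono) (auto simp: V_def[symmetric] sets_haar)
  also have "emeasure \<mu> V = ennreal (measure M V)"
    using V(1) W(3) by (intro emeasure_eq_measure_M) auto
  finally have "ennreal (measure M W - \<epsilon> / 2) \<le> ennreal (measure M V)"
    using K(3) by (rule order_trans[rotated])
  hence mV: "measure M W - \<epsilon> / 2 \<le> measure M V" by (simp add: ennreal_le_iff)
  have sets: "W \<in> sets M" "V \<in> sets M" using V W by (auto simp: sets_M_iff)
  have int: "integrable M (indicator Z :: 'a \<Rightarrow> real)" if "Z \<in> sets M" for Z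
    using that finite_measure.emeasure_finite[OF finite_M, of Z]
    by (intro integrable_real_indicator) (auto simp: top.not_eq_extremum)
  have "L2_sq M (\<lambda>x. indicator B x - indicator V x)
      \<le> (LINT x|M. (indicator W x - indicator B x) + (indicator W x - indicator V x :: real))"
    unfolding L2_sq_def
  proof (rule integral_mono_AE)
    show "integrable M (\<lambda>x. (cmod (indicator B x - indicator V x))\<^sup>2)"
      using B sets by (intro L2_integrable L2_diff L2_bounded[OF finite_M, where B = 1]) (auto simp: indicator_def)
    show "integrable M (\<lambda>x. (indicator W x - indicator B x) + (indicator W x - indicator V x :: real))"
      using B sets by (intro Bochner_Integration.integrable_add Bochner_Integration.integrable_diff int)
    show "AE x in M. (cmod (indicator B x - indicator V x))\<^sup>2
        \<le> (indicator W x - indicator B x) + (indicator W x - indicator V x :: real)"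
      using V(1) W(2) by (intro AE_I2) (auto simp: indicator_def)
  qed
  also have "\<dots> = (measure M W - measure M B) + (measure M W - measure M V)"
    using B sets B'(2) W(3) V(1)
    by (simp add: Int_absorb2 order_trans[OF V(1) W(3)] Bochner_Integration.integral_add Bochner_Integration.integral_diff int
        Bochner_Integration.integrable_diff)
  also have "\<dots> < \<epsilon>" using mW mV by linarith
  finally have "L2_sq M (\<lambda>x. indicator B x - indicator V x) < \<epsilon>" .
  moreover have "disjoint_family_on (coset (H n)) A"
    unfolding disjoint_family_on_def
  proof (intro ballI impI equals0I)
    fix a b x assume ab: "a \<in> A" "b \<in> A" "a \<noteq> b" and x: "x \<in> coset (H n) a \<inter> coset (H n) b"
    have "coset (H n) a = coset (H n) b"
      using additive_subgroup.coset_eq[OF subgroup] x by blast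
    thus False using A(4)[OF ab(1,2)] ab(3) additive_subgroup.self_mem_coset[OF subgroup] by blast
  qed
  ultimately show ?thesis using that[of A n] A(1,2) K(2) W(3) by (auto simp: V_def)
qed

text \<open>
  The closure of \<open>combs F\<close> is a closed subspace which contains all indicators by \<open>borel_approx_cosets\<close>.
\<close>

lemma coset_indicators_dense:
  assumes F: "F \<subseteq> L2 M"
    and cosets: "\<And>n x. x \<in> \<Omega> \<Longrightarrow> \<exists>s\<in>combs F. \<forall>y\<in>\<Omega>. s y = indicator (coset (H n) x) y"
    and u: "u \<in> L2 M" and \<epsilon>: "\<epsilon> > 0"
  shows "\<exists>s\<in>combs F. L2_sq M (\<lambda>x. u x - s x) < \<epsilon>"
proof -
  have comb_L2: "s \<in> L2 M" if "s \<in> combs F" for s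
    using that F by (auto elim!: combsE intro!: L2_sum)
  define D where "D = {u\<in>L2 M. \<forall>\<epsilon>>0. \<exists>s\<in>combs F. L2_sq M (\<lambda>x. u x - s x) < \<epsilon>}"
  have "u \<in> D"
  proof (rule L2_closed_subspace_eq[OF finite_M _ _ _ u])
    fix B assume B: "B \<in> sets M"
    show "(\<lambda>x. indicator B x) \<in> D"
      unfolding D_def
    proof (intro CollectI conjI allI impI)
      show "(\<lambda>x. indicator B x :: complex) \<in> L2 M"
        using B by (intro L2_bounded[OF finite_M, where B = 1]) (auto simp: indicator_def)
      fix \<epsilon> :: real assume "\<epsilon> > 0"
      then obtain n A where A: "finite A" "A \<subseteq> \<Omega>" "disjoint_family_on (coset (H n)) A"
        and near: "L2_sq M (\<lambda>x. indicator B x - indicator (\<Union>a\<in>A. coset (H n) a) x) < \<epsilon>"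
        using borel_approx_cosets[OF B] by metis
      obtain s where s: "\<And>a. a \<in> \<Omega> \<Longrightarrow> s a \<in> combs F"
        "\<And>a y. a \<in> \<Omega> \<Longrightarrow> y \<in> \<Omega> \<Longrightarrow> s a y = indicator (coset (H n) a) y"
        using cosets[of _ n] by metis
      have "(\<lambda>x. \<Sum>a\<in>A. 1 * s a x) \<in> combs F" using s(1) A(2) by (intro combs_sum) auto
      moreover have "(\<Sum>a\<in>A. 1 * s a x) = indicator (\<Union>a\<in>A. coset (H n) a) x" if "x \<in> \<Omega>" for x
        unfolding indicator_UN_disjoint[OF A(1,3)] using s(2) A(2) that by (intro sum.cong) auto
      hence "L2_sq M (\<lambda>x. indicator B x - (\<Sum>a\<in>A. 1 * s a x))
          = L2_sq M (\<lambda>x. indicator B x - indicator (\<Union>a\<in>A. coset (H n) a) x)"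
        by (intro L2_sq_cong) simp
      ultimately show "\<exists>s\<in>combs F. L2_sq M (\<lambda>x. indicator B x - s x) < \<epsilon>"
        using near by (intro bexI[of _ "\<lambda>x. \<Sum>a\<in>A. 1 * s a x"]) simp_all
    qed
  next
    fix f g a b assume f: "f \<in> D" and g: "g \<in> D"
    show "(\<lambda>x. a * f x + b * g x) \<in> D"
      unfolding D_def
    proof (intro CollectI conjI allI impI)
      show "(\<lambda>x. a * f x + b * g x) \<in> L2 M" using f g by (auto simp: D_def intro: L2_lincomb)
      fix \<epsilon> :: real assume "\<epsilon> > 0"
      then obtain \<delta> :: real where \<delta>: "\<delta> > 0"
        "\<And>w w' r r'. w \<in> L2 M \<Longrightarrow> w' \<in> L2 M \<Longrightarrow> r \<in> L2 M \<Longrightarrow> r' \<in> L2 M \<Longrightarrow>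
          L2_sq M (\<lambda>x. w x - r x) < \<delta> \<Longrightarrow> L2_sq M (\<lambda>x. w' x - r' x) < \<delta> \<Longrightarrow>
          L2_sq M (\<lambda>x. (a * w x + b * w' x) - (a * r x + b * r' x)) < \<epsilon>"
        by (rule L2_lincomb_near[of \<epsilon> M a b]) blast
      obtain s where s: "s \<in> combs F" "L2_sq M (\<lambda>x. f x - s x) < \<delta>"
        using f \<delta>(1) by (auto simp: D_def)
      obtain t where t: "t \<in> combs F" "L2_sq M (\<lambda>x. g x - t x) < \<delta>"
        using g \<delta>(1) by (auto simp: D_def)
      have "L2_sq M (\<lambda>x. (a * f x + b * g x) - (a * s x + b * t x)) < \<epsilon>"
        using f g s t comb_L2 by (intro \<delta>(2)) (auto simp: D_def)
      thus "\<exists>s\<in>combs F. L2_sq M (\<lambda>x. a * f x + b * g x - s x) < \<epsilon>"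
        using combs_lincomb[OF s(1) t(1), of a b] by (intro bexI[of _ "\<lambda>x. a * s x + b * t x"])
    qed
  next
    fix u assume u: "u \<in> L2 M" and near: "\<And>\<epsilon>::real. \<epsilon> > 0 \<Longrightarrow> \<exists>v\<in>D. L2_sq M (\<lambda>x. u x - v x) < \<epsilon>"
    show "u \<in> D"
      unfolding D_def
    proof (intro CollectI conjI allI impI u)
      fix \<epsilon> :: real assume \<epsilon>: "\<epsilon> > 0"
      obtain v where v: "v \<in> D" "L2_sq M (\<lambda>x. u x - v x) < \<epsilon> / 4" using near[of "\<epsilon> / 4"] \<epsilon> by auto
      obtain s where s: "s \<in> combs F" "L2_sq M (\<lambda>x. v x - s x) < \<epsilon> / 4"
        using v(1) \<epsilon> unfolding D_def by (auto dest: spec[of _ "\<epsilon> / 4"])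
      have "L2_sq M (\<lambda>x. u x - s x) \<le> 2 * L2_sq M (\<lambda>x. u x - v x) + 2 * L2_sq M (\<lambda>x. v x - s x)"
        using u v(1) comb_L2[OF s(1)] by (intro L2_sq_diff_triangle) (auto simp: D_def)
      thus "\<exists>s\<in>combs F. L2_sq M (\<lambda>x. u x - s x) < \<epsilon>"
        using v(2) s by (intro bexI[of _ s]) auto
    qed
  qed
  thus ?thesis using \<epsilon> by (simp add: D_def)
qed

end

section \<open>The Riesz basis\<close>

text \<open>
  The choices on which the construction depends: a subgroup \<open>H m\<close> so small that \<open>\<Omega>\<close> is a union of its
  cosets, representatives \<open>A\<close> of these cosets, and characters \<open>\<theta> j\<close> trivial on \<open>H m\<close> whose matrix of values
  on \<open>A\<close> has the inverse \<open>Y\<close>.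
\<close>

locale coset_decomposition = haar_compact_open X H \<mu> \<Omega>
  for X :: "('a::topological_ab_group_add \<Rightarrow> complex) set" and H :: "nat \<Rightarrow> 'a set"
    and \<mu> :: "'a measure" and \<Omega> :: "'a set" +
  fixes m :: nat and A :: "'a set" and \<theta> Y :: "'a \<Rightarrow> 'a \<Rightarrow> complex"
  assumes coset_subset: "x \<in> \<Omega> \<Longrightarrow> coset (H m) x \<subseteq> \<Omega>"
    and A: "finite A" "A \<subseteq> \<Omega>" "\<Omega> \<subseteq> (\<Union>a\<in>A. coset (H m) a)"
    and A_distinct: "a \<in> A \<Longrightarrow> b \<in> A \<Longrightarrow> a \<in> coset (H m) b \<Longrightarrow> a = b"
    and \<theta>: "j \<in> A \<Longrightarrow> \<theta> j \<in> annihilator m"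
    and biorthogonal: "biorthogonal A \<theta> Y"
begin

lemma Y_\<theta>: "a \<in> A \<Longrightarrow> b \<in> A \<Longrightarrow> (\<Sum>j\<in>A. Y a j * \<theta> j b) = (if a = b then 1 else 0)"
  and \<theta>_Y: "i \<in> A \<Longrightarrow> j \<in> A \<Longrightarrow> (\<Sum>a\<in>A. \<theta> i a * Y a j) = (if i = j then 1 else 0)"
  using biorthogonal by (simp_all add: biorthogonal_def)

abbreviation "S \<equiv> H m"

sublocale S: additive_subgroup S
  by (rule subgroup)

lemma in_coset:
  assumes "x \<in> \<Omega>"
  obtains a where "a \<in> A" "x \<in> coset S a"
  using A(3) assms by blast

lemma coset_unique:
  assumes "a \<in> A" "b \<in> A" "x \<in> coset S a" "x \<in> coset S b"
  shows "a = b"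
  using A_distinct[OF assms(1,2)] S.coset_eq[OF assms(3)] S.coset_eq[OF assms(4)] S.self_mem_coset[of a] by simp

lemma sum_indicator_coset:
  fixes g :: "'a \<Rightarrow> complex"
  assumes "a \<in> A" "x \<in> coset S a"
  shows "(\<Sum>b\<in>A. g b * indicator (coset S b) x) = g a"
proof -
  have "(\<Sum>b\<in>A. g b * indicator (coset S b) x) = (\<Sum>b\<in>A. if b = a then g b else 0)"
    using assms coset_unique by (intro sum.cong) (auto simp: indicator_def)
  thus ?thesis using A(1) assms(1) by simp
qed

lemma \<theta>_coset: "j \<in> A \<Longrightarrow> x \<in> coset S a \<Longrightarrow> \<theta> j x = \<theta> j a"
  using annihilator_coset[OF \<theta>] .

lemma \<theta>_character: "j \<in> A \<Longrightarrow> \<theta> j \<in> X"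
  using \<theta> by (simp add: annihilator_def)

definition coset_volume :: real where "coset_volume = measure \<mu> S"

lemma emeasure_coset_eq: "a \<in> \<Omega> \<Longrightarrow> emeasure \<mu> S = ennreal (measure M (coset S a))"
  using emeasure_eq_measure_M[OF coset_subset, of a] emeasure_coset[of S a] open_H[of m] by simp

lemma measure_coset: "a \<in> \<Omega> \<Longrightarrow> measure M (coset S a) = coset_volume"
  unfolding coset_volume_def measure_def[of \<mu>] using emeasure_coset_eq[of a] by simp

lemma coset_volume_pos: "coset_volume > 0"
proof -
  obtain a where a: "a \<in> \<Omega>" using nonempty by blast
  have "ennreal coset_volume \<noteq> 0"
    using emeasure_coset_eq[OF a] measure_coset[OF a] emeasure_H_nonzero[of m] by simp
  thus ?thesis by (simp add: coset_volume_def zero_less_measure_iff)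
qed

lemma coset_in_M: "a \<in> A \<Longrightarrow> coset S a \<in> sets M"
  using coset_subset[of a] A(2) open_coset[OF open_H[of m]] by (auto simp: sets_M_iff)

text \<open>
  A choice of one character from each class of characters with the same restriction to \<open>S\<close>. The
  class representatives \<open>\<Lambda>\<close> correspond to the restrictions of elements of \<open>X\<close> to \<open>S\<close>.
\<close>

definition restriction_rep :: "('a \<Rightarrow> complex) \<Rightarrow> 'a \<Rightarrow> complex" where
  "restriction_rep \<phi> = (SOME \<psi>. \<psi> \<in> X \<and> (\<forall>y\<in>S. \<psi> y = \<phi> y))"

lemma restriction_rep:
  assumes "\<phi> \<in> X"
  shows "restriction_rep \<phi> \<in> X" "y \<in> S \<Longrightarrow> restriction_rep \<phi> y = \<phi> y"
  using someI[of "\<lambda>\<psi>. \<psi> \<in> X \<and> (\<forall>y\<in>S. \<psi> y = \<phi> y)" \<phi>] assms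
  by (auto simp: restriction_rep_def)

definition \<Lambda> :: "('a \<Rightarrow> complex) set" where "\<Lambda> = restriction_rep ` X"

lemma \<Lambda>_subset: "\<Lambda> \<subseteq> X"
  by (auto simp: \<Lambda>_def restriction_rep)

lemma \<Lambda>_eqI:
  assumes "\<phi> \<in> \<Lambda>" "\<psi> \<in> \<Lambda>" "\<And>y. y \<in> S \<Longrightarrow> \<phi> y = \<psi> y"
  shows "\<phi> = \<psi>"
proof -
  obtain \<phi>' \<psi>' where reps: "\<phi>' \<in> X" "\<phi> = restriction_rep \<phi>'" "\<psi>' \<in> X" "\<psi> = restriction_rep \<psi>'"
    using assms(1,2) by (auto simp: \<Lambda>_def)
  have "\<phi>' y = \<psi>' y" if "y \<in> S" for y
    using assms(3)[OF that] restriction_rep(2)[OF reps(1) that] restriction_rep(2)[OF reps(3) that] reps by simp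
  hence "restriction_rep \<phi>' = restriction_rep \<psi>'" unfolding restriction_rep_def by (simp cong: conj_cong)
  thus ?thesis by (simp add: reps)
qed

definition I :: "(('a \<Rightarrow> complex) \<times> 'a) set" where "I = \<Lambda> \<times> A"

text \<open>
  The orthonormal basis \<open>e\<close> and the characters \<open>f\<close> carry the same indices: in the first case the second
  component is a coset, in the second case it numbers the characters trivial on \<open>S\<close>.
\<close>

definition e :: "('a \<Rightarrow> complex) \<times> 'a \<Rightarrow> 'a \<Rightarrow> complex" where
  "e n x = fst n x * indicator (coset S (snd n)) x / sqrt coset_volume"

definition f :: "('a \<Rightarrow> complex) \<times> 'a \<Rightarrow> 'a \<Rightarrow> complex" where
  "f n x = fst n x * \<theta> (snd n) x"

lemma countable_I: "countable I"
  using countable_X A(1) by (auto simp: I_def \<Lambda>_def intro: countable_SIGMA countable_finite)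

lemma f_character: "n \<in> I \<Longrightarrow> f n \<in> X"
  using function_monoid.mult[OF monoid, of "fst n" "\<theta> (snd n)"] \<Lambda>_subset \<theta>_character
  by (auto simp: I_def f_def[abs_def])

lemma X_L2: "\<phi> \<in> X \<Longrightarrow> \<phi> \<in> L2 M"
  by (intro L2_bounded[OF finite_M, where B = 1] continuous_measurable_M character_continuous)
     (simp_all add: character_norm)

lemma f_L2: "n \<in> I \<Longrightarrow> f n \<in> L2 M"
  by (intro X_L2 f_character)

lemma e_L2:
  assumes n: "n \<in> I"
  shows "e n \<in> L2 M"
proof (rule L2_bounded[OF finite_M, where B = "1 / sqrt coset_volume"])
  have X: "fst n \<in> X" and a: "snd n \<in> A" using n \<Lambda>_subset by (auto simp: I_def)
  have [measurable]: "fst n \<in> borel_measurable M"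
    by (intro continuous_measurable_M character_continuous X)
  have [measurable]: "coset S (snd n) \<in> sets M" by (rule coset_in_M[OF a])
  show "e n \<in> borel_measurable M" unfolding e_def[abs_def] by measurable
  show "cmod (e n x) \<le> 1 / sqrt coset_volume" for x
    using coset_volume_pos by (simp add: e_def norm_mult norm_divide character_norm[OF X] indicator_def)
qed

lemma integral_M_coset:
  fixes g :: "'a \<Rightarrow> complex"
  assumes "a \<in> A"
  shows "(LINT x|M. indicator (coset S a) x * g x) = (LINT x|\<mu>. indicator (coset S a) x * g x)"
proof -
  have "indicator \<Omega> x *\<^sub>R (indicator (coset S a) x * g x) = indicator (coset S a) x * g x" for x
    using coset_subset[of a] assms A(2) by (auto simp: indicator_def)
  thus ?thesis by (simp add: integral_restrict_space[OF sets_\<Omega>])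
qed

text \<open>
  Members on different cosets have disjoint supports. On one coset, distinct members of \<open>\<Lambda>\<close> have
  distinct restrictions to \<open>S\<close>, so \<open>integral_coset_eq_0\<close> applies to their quotient \<open>\<eta>\<close>.
\<close>

lemma e_orthonormal:
  assumes n: "n \<in> I" and n': "n' \<in> I"
  shows "L2_inner M (e n) (e n') = (if n = n' then 1 else 0)"
proof -
  obtain \<phi> a \<psi> b where nn: "n = (\<phi>, a)" "n' = (\<psi>, b)" by (metis surj_pair)
  have X: "\<phi> \<in> X" "\<psi> \<in> X" and \<Lambda>: "\<phi> \<in> \<Lambda>" "\<psi> \<in> \<Lambda>" and ab: "a \<in> A" "b \<in> A"
    using n n' \<Lambda>_subset by (auto simp: I_def nn)
  have hh: "complex_of_real (sqrt coset_volume) * complex_of_real (sqrt coset_volume) = complex_of_real coset_volume"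
    using coset_volume_pos by (simp flip: of_real_mult)
  show ?thesis
  proof (cases "a = b")
    case False
    hence "e n x * cnj (e n' x) = 0" for x
      using coset_unique[OF ab, of x] by (auto simp: e_def nn indicator_def)
    hence "L2_inner M (e n) (e n') = 0" unfolding L2_inner_def by (simp only: Bochner_Integration.integral_zero)
    thus ?thesis using False by (simp add: nn)
  next
    case True
    define \<eta> where "\<eta> = (\<lambda>x. \<phi> x * cnj (\<psi> x))"
    have "e n x * cnj (e n' x) = (indicator (coset S a) x * \<eta> x) / coset_volume" for x
      using hh by (auto simp: e_def nn True \<eta>_def indicator_def)
    hence inner: "L2_inner M (e n) (e n') = (LINT x|M. indicator (coset S a) x * \<eta> x) / coset_volume"
      by (simp add: L2_inner_def)
    \<comment> \<open>Values of characters lie on the unit circle, so conjugation inverts them.\<close>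
    have cnj_cancel: "cnj (\<psi> x) * \<psi> x = 1" for x
      using complex_norm_square[of "\<psi> x"] character_norm[OF X(2), of x] by (simp add: mult.commute)
    show ?thesis
    proof (cases "\<phi> = \<psi>")
      case True
      have "(LINT x|M. indicator (coset S a) x * \<eta> x) = (LINT x|M. complex_of_real (indicator (coset S a) x))"
        using cnj_cancel by (intro Bochner_Integration.integral_cong) (auto simp: \<eta>_def True mult.commute indicator_def)
      also have "\<dots> = complex_of_real (measure M (coset S a \<inter> space M))"
        by (simp only: integral_complex_of_real Bochner_Integration.integral_indicator)
      also have "\<dots> = coset_volume" using measure_coset[of a] coset_subset[of a] ab(1) A(2) by (simp add: Int_absorb2 subset_iff)
      finally have "L2_inner M (e n) (e n') = 1" using coset_volume_pos by (simp add: inner)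
      thus ?thesis by (simp add: nn True \<open>a = b\<close>)
    next
      case False
      then obtain y where y: "y \<in> S" "\<phi> y \<noteq> \<psi> y" using \<Lambda>_eqI[OF \<Lambda>] by blast
      have "\<eta> y * \<psi> y = \<phi> y" using cnj_cancel[of y] by (simp add: \<eta>_def mult.assoc)
      hence "\<eta> y \<noteq> 1" using y(2) by auto
      moreover have "\<eta> \<in> borel_measurable \<mu>"
        unfolding \<eta>_def by (intro continuous_measurable continuous_intros character_continuous X)
      ultimately have "(LINT x|\<mu>. indicator (coset S a) x * \<eta> x) = 0"
        using open_H[of m] y(1)
        by (intro integral_coset_eq_0[where y = y] S.additive_subgroup_axioms)
           (auto simp: \<eta>_def character_add[OF X(1)] character_add[OF X(2)])
      hence "L2_inner M (e n) (e n') = 0" by (simp add: inner integral_M_coset[OF ab(1)])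
      thus ?thesis using False by (simp add: nn)
    qed
  qed
qed

text \<open>
  On a single coset, a character is proportional to the representative of its restriction to \<open>S\<close>; the
  factor is read off at the point \<open>a\<close>.
\<close>

lemma character_combs_e:
  assumes X: "\<phi> \<in> X"
  shows "\<exists>t\<in>combs (e ` I). \<forall>x\<in>\<Omega>. t x = \<phi> x"
proof (intro bexI ballI)
  let ?\<psi> = "restriction_rep \<phi>"
  have X': "?\<psi> \<in> X" and \<Lambda>: "?\<psi> \<in> \<Lambda>" using restriction_rep(1)[OF X] X by (auto simp: \<Lambda>_def)
  \<comment> \<open>The square root undoes the normalisation of \<open>e\<close>.\<close>
  define c where "c = (\<lambda>a. sqrt coset_volume * \<phi> a / ?\<psi> a)"
  show "(\<lambda>x. \<Sum>a\<in>A. c a * e (?\<psi>, a) x) \<in> combs (e ` I)"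
    using \<Lambda> by (intro combs_sum combs_mem) (auto simp: I_def)
  fix x assume "x \<in> \<Omega>"
  then obtain a where a: "a \<in> A" "x \<in> coset S a" by (rule in_coset)
  have "(\<Sum>a\<in>A. c a * e (?\<psi>, a) x) = (\<Sum>b\<in>A. (\<phi> b * ?\<psi> x / ?\<psi> b) * indicator (coset S b) x)"
    using coset_volume_pos by (intro sum.cong) (auto simp: c_def e_def)
  also have "\<dots> = \<phi> a * ?\<psi> x / ?\<psi> a" by (rule sum_indicator_coset[OF a])
  also have "\<dots> = \<phi> a * ?\<psi> (x - a)"
    using character_coset[OF X', of x a] character_nonzero[OF X', of a] by simp
  also have "\<dots> = \<phi> a * \<phi> (x - a)" using restriction_rep(2)[OF X] a(2) by (simp add: coset_def)
  also have "\<dots> = \<phi> x" using character_coset[OF X, of x a] by simp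
  finally show "(\<Sum>a\<in>A. c a * e (?\<psi>, a) x) = \<phi> x" .
qed

lemma e_total: "L2_total M I e"
proof (rule L2_total_combs[OF e_L2])
  fix u and \<epsilon> :: real assume "u \<in> L2 M" "\<epsilon> > 0"
  thus "\<exists>s\<in>combs (e ` I). L2_sq M (\<lambda>x. u x - s x) < \<epsilon>"
  proof (rule coset_indicators_dense[rotated 2])
    show "e ` I \<subseteq> L2 M" using e_L2 by blast
    fix n x assume "x \<in> \<Omega>"
    then obtain g where g: "g \<in> combs X" "\<And>y. y \<in> \<Omega> \<Longrightarrow> g y = indicator (coset (H n) x) y"
      using coset_indicator_combs[OF compact_\<Omega>] by blast
    obtain s where "s \<in> combs (e ` I)" "\<And>y. y \<in> \<Omega> \<Longrightarrow> s y = g y"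
      using combs_transfer[OF character_combs_e g(1)] by blast
    thus "\<exists>s\<in>combs (e ` I). \<forall>y\<in>\<Omega>. s y = indicator (coset (H n) x) y"
      using g(2) by (intro bexI[of _ s]) auto
  qed
qed

text \<open>The inverse matrix \<open>Y\<close> recovers the indicators of the cosets from the \<open>\<theta> j\<close>.\<close>

lemma e_combs_f:
  assumes n: "n \<in> I"
  shows "\<exists>t\<in>combs (f ` I). \<forall>x\<in>\<Omega>. t x = e n x"
proof -
  obtain \<phi> a where nn: "n = (\<phi>, a)" by (metis surj_pair)
  have I: "\<phi> \<in> \<Lambda>" "a \<in> A" using n by (auto simp: I_def nn)
  show ?thesis
  proof (intro bexI ballI)
    show "(\<lambda>x. \<Sum>j\<in>A. (Y a j / sqrt coset_volume) * f (\<phi>, j) x) \<in> combs (f ` I)"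
      using I by (intro combs_sum combs_mem) (auto simp: I_def)
    fix x assume "x \<in> \<Omega>"
    then obtain b where b: "b \<in> A" "x \<in> coset S b" by (rule in_coset)
    have "(\<Sum>j\<in>A. (Y a j / sqrt coset_volume) * f (\<phi>, j) x) = (\<Sum>j\<in>A. (\<phi> x / sqrt coset_volume) * (Y a j * \<theta> j b))"
      using \<theta>_coset[OF _ b(2)] by (intro sum.cong) (auto simp: f_def)
    also have "\<dots> = (\<phi> x / sqrt coset_volume) * (\<Sum>j\<in>A. Y a j * \<theta> j b)" by (simp only: sum_distrib_left)
    also have "\<dots> = (\<phi> x / sqrt coset_volume) * (if a = b then 1 else 0)" by (simp only: Y_\<theta>[OF I(2) b(1)])
    also have "(if a = b then 1 else 0 :: complex) = indicator (coset S a) x"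
    proof (cases "a = b")
      case False
      hence "x \<notin> coset S a" using coset_unique[OF I(2) b(1) _ b(2)] by blast
      thus ?thesis using False by simp
    qed (use b in simp)
    also have "\<phi> x / sqrt coset_volume * indicator (coset S a) x = e n x" by (simp add: e_def nn)
    finally show "(\<Sum>j\<in>A. (Y a j / sqrt coset_volume) * f (\<phi>, j) x) = e n x" .
  qed
qed

lemma f_total: "L2_total M I f"
proof (rule L2_total_combs[OF f_L2])
  fix u and \<epsilon> :: real assume "u \<in> L2 M" "\<epsilon> > 0"
  obtain s where s: "s \<in> combs (e ` I)" "L2_sq M (\<lambda>x. u x - s x) < \<epsilon>"
    using L2_total_combsD[OF e_total \<open>u \<in> L2 M\<close> \<open>\<epsilon> > 0\<close>] by blast
  obtain t where t: "t \<in> combs (f ` I)" "\<And>x. x \<in> \<Omega> \<Longrightarrow> t x = s x"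
    using combs_transfer[OF _ s(1), of "f ` I" \<Omega>] e_combs_f by blast
  have "L2_sq M (\<lambda>x. u x - t x) = L2_sq M (\<lambda>x. u x - s x)"
    using t(2) by (intro L2_sq_cong) simp
  thus "\<exists>s\<in>combs (f ` I). L2_sq M (\<lambda>x. u x - s x) < \<epsilon>" using s(2) t(1) by (intro bexI[of _ t]) simp_all
qed

text \<open>
  If \<open>c\<close> are the coefficients of a sum with respect to \<open>f\<close>, then \<open>sqrt coset_volume * \<theta>_coeff c\<close> are its
  coefficients with respect to the orthonormal basis \<open>e\<close>. The matrix involved depends on the second component only.
\<close>

definition \<theta>_coeff :: "(('a \<Rightarrow> complex) \<times> 'a \<Rightarrow> complex) \<Rightarrow> ('a \<Rightarrow> complex) \<times> 'a \<Rightarrow> complex" where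
  "\<theta>_coeff c n = (\<Sum>j\<in>A. c (fst n, j) * \<theta> j (snd n))"

lemma sum_f_eq_sum_e:
  assumes x: "x \<in> \<Omega>"
  shows "(\<Sum>n\<in>L \<times> A. c n * f n x) = (\<Sum>n\<in>L \<times> A. (sqrt coset_volume * \<theta>_coeff c n) * e n x)"
proof -
  obtain a where a: "a \<in> A" "x \<in> coset S a" using x by (rule in_coset)
  have "(\<Sum>j\<in>A. c (\<phi>, j) * f (\<phi>, j) x) = (\<Sum>b\<in>A. (sqrt coset_volume * \<theta>_coeff c (\<phi>, b)) * e (\<phi>, b) x)" for \<phi>
  proof -
    have "(\<Sum>j\<in>A. c (\<phi>, j) * f (\<phi>, j) x) = \<phi> x * \<theta>_coeff c (\<phi>, a)"
      unfolding \<theta>_coeff_def sum_distrib_left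
      using \<theta>_coset[OF _ a(2)] by (intro sum.cong) (auto simp: f_def)
    also have "\<dots> = (\<Sum>b\<in>A. (\<phi> x * \<theta>_coeff c (\<phi>, b)) * indicator (coset S b) x)"
      by (rule sum_indicator_coset[OF a, symmetric])
    also have "\<dots> = (\<Sum>b\<in>A. (sqrt coset_volume * \<theta>_coeff c (\<phi>, b)) * e (\<phi>, b) x)"
      using coset_volume_pos by (intro sum.cong) (auto simp: e_def)
    finally show ?thesis .
  qed
  moreover have "(\<Sum>n\<in>L \<times> A. F n) = (\<Sum>\<phi>\<in>L. \<Sum>b\<in>A. F (\<phi>, b))" for F :: "_ \<Rightarrow> complex"
    by (simp add: sum.cartesian_product split_def)
  ultimately show ?thesis by (simp only:)
qed

lemma L2_sq_sum_e:
  assumes "finite L" "L \<subseteq> \<Lambda>"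
  shows "L2_sq M (\<lambda>x. \<Sum>n\<in>L \<times> A. c n * e n x) = (\<Sum>\<phi>\<in>L. \<Sum>a\<in>A. (cmod (c (\<phi>, a)))\<^sup>2)"
proof -
  have LA: "L \<times> A \<subseteq> I" "finite (L \<times> A)" using assms A(1) by (auto simp: I_def)
  hence "L2_sq M (\<lambda>x. \<Sum>n\<in>L \<times> A. c n * e n x) = (\<Sum>n\<in>L \<times> A. (cmod (c n))\<^sup>2)"
    by (intro L2_pythagoras e_L2 e_orthonormal) auto
  thus ?thesis by (simp add: sum.cartesian_product split_def)
qed

lemma L2_sq_sum_f:
  assumes "finite L" "L \<subseteq> \<Lambda>"
  shows "L2_sq M (\<lambda>x. \<Sum>n\<in>L \<times> A. c n * f n x) = coset_volume * (\<Sum>\<phi>\<in>L. \<Sum>a\<in>A. (cmod (\<theta>_coeff c (\<phi>, a)))\<^sup>2)"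
proof -
  have "L2_sq M (\<lambda>x. \<Sum>n\<in>L \<times> A. c n * f n x) = L2_sq M (\<lambda>x. \<Sum>n\<in>L \<times> A. (sqrt coset_volume * \<theta>_coeff c n) * e n x)"
    by (intro L2_sq_cong sum_f_eq_sum_e) simp
  also have "\<dots> = (\<Sum>\<phi>\<in>L. \<Sum>a\<in>A. (cmod (sqrt coset_volume * \<theta>_coeff c (\<phi>, a)))\<^sup>2)"
    by (rule L2_sq_sum_e[OF assms])
  also have "\<dots> = coset_volume * (\<Sum>\<phi>\<in>L. \<Sum>a\<in>A. (cmod (\<theta>_coeff c (\<phi>, a)))\<^sup>2)"
    using coset_volume_pos by (simp add: norm_mult power_mult_distrib sum_distrib_left)
  finally show ?thesis .
qed

lemma \<theta>_coeff_inverse: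
  assumes "j \<in> A"
  shows "(\<Sum>a\<in>A. \<theta>_coeff c (\<phi>, a) * Y a j) = c (\<phi>, j)"
proof -
  have "(\<Sum>a\<in>A. \<theta>_coeff c (\<phi>, a) * Y a j) = (\<Sum>i\<in>A. c (\<phi>, i) * (\<Sum>a\<in>A. \<theta> i a * Y a j))"
    unfolding \<theta>_coeff_def fst_conv snd_conv sum_distrib_left sum_distrib_right
    by (subst sum.swap) (simp add: mult.assoc)
  also have "\<dots> = (\<Sum>i\<in>A. if i = j then c (\<phi>, i) else 0)"
    using \<theta>_Y assms by (intro sum.cong) auto
  finally show ?thesis using A(1) assms by simp
qed

text \<open>
  Extending the coefficients by zero, a finite index set may be enlarged to a product \<open>L \<times> A\<close>, on which
  the whole matrix acts.
\<close>

lemma sum_extend: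
  assumes J: "finite J" "J \<subseteq> I"
  obtains L c' where "finite L" "L \<subseteq> \<Lambda>" "\<And>g :: _ \<Rightarrow> complex. (\<Sum>n\<in>J. c n * g n) = (\<Sum>n\<in>L \<times> A. c' n * g n)"
proof (rule that[of "fst ` J" "\<lambda>n. if n \<in> J then c n else 0"])
  show "(\<Sum>n\<in>J. c n * g n) = (\<Sum>n\<in>fst ` J \<times> A. (if n \<in> J then c n else 0) * g n)" for g :: "_ \<Rightarrow> complex"
  proof (rule sum.mono_neutral_cong_left)
    show "J \<subseteq> fst ` J \<times> A" using J(2) by (force simp: I_def)
  qed (use J(1) A(1) in auto)
qed (use J in \<open>auto simp: I_def\<close>)

definition f_bound where "f_bound = coset_volume * (\<Sum>a\<in>A. \<Sum>j\<in>A. (cmod (\<theta> j a))\<^sup>2)"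

definition e_bound where "e_bound = (\<Sum>j\<in>A. \<Sum>a\<in>A. (cmod (Y a j))\<^sup>2) / coset_volume"

lemma bounds_nonneg: "f_bound \<ge> 0" "e_bound \<ge> 0"
  using coset_volume_pos by (auto simp: f_bound_def e_bound_def intro!: sum_nonneg mult_nonneg_nonneg divide_nonneg_nonneg)

lemma sum_f_le_sum_e:
  assumes J: "finite J" "J \<subseteq> I"
  shows "L2_sq M (\<lambda>x. \<Sum>n\<in>J. c n * f n x) \<le> f_bound * L2_sq M (\<lambda>x. \<Sum>n\<in>J. c n * e n x)"
proof -
  obtain L c' where L: "finite L" "L \<subseteq> \<Lambda>"
    and eq: "\<And>g :: _ \<Rightarrow> complex. (\<Sum>n\<in>J. c n * g n) = (\<Sum>n\<in>L \<times> A. c' n * g n)"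
    using sum_extend[OF J, of c] by metis
  have "(\<Sum>a\<in>A. (cmod (\<theta>_coeff c' (\<phi>, a)))\<^sup>2)
      \<le> (\<Sum>a\<in>A. \<Sum>j\<in>A. (cmod (\<theta> j a))\<^sup>2) * (\<Sum>j\<in>A. (cmod (c' (\<phi>, j)))\<^sup>2)" for \<phi>
    unfolding \<theta>_coeff_def fst_conv snd_conv by (rule sum_cmod_sq_matrix_le)
  hence "coset_volume * (\<Sum>\<phi>\<in>L. \<Sum>a\<in>A. (cmod (\<theta>_coeff c' (\<phi>, a)))\<^sup>2)
      \<le> coset_volume * (\<Sum>\<phi>\<in>L. (\<Sum>a\<in>A. \<Sum>j\<in>A. (cmod (\<theta> j a))\<^sup>2) * (\<Sum>j\<in>A. (cmod (c' (\<phi>, j)))\<^sup>2))"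
    using coset_volume_pos by (intro mult_left_mono sum_mono) auto
  also have "\<dots> = f_bound * (\<Sum>\<phi>\<in>L. \<Sum>a\<in>A. (cmod (c' (\<phi>, a)))\<^sup>2)"
    by (simp only: f_bound_def sum_distrib_left[symmetric] mult.assoc)
  finally show ?thesis unfolding eq L2_sq_sum_e[OF L] L2_sq_sum_f[OF L] .
qed

lemma sum_e_le_sum_f:
  assumes J: "finite J" "J \<subseteq> I"
  shows "L2_sq M (\<lambda>x. \<Sum>n\<in>J. c n * e n x) \<le> e_bound * L2_sq M (\<lambda>x. \<Sum>n\<in>J. c n * f n x)"
proof -
  obtain L c' where L: "finite L" "L \<subseteq> \<Lambda>"
    and eq: "\<And>g :: _ \<Rightarrow> complex. (\<Sum>n\<in>J. c n * g n) = (\<Sum>n\<in>L \<times> A. c' n * g n)"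
    using sum_extend[OF J, of c] by metis
  define K where "K = (\<Sum>j\<in>A. \<Sum>a\<in>A. (cmod (Y a j))\<^sup>2)"
  have "(\<Sum>j\<in>A. (cmod (c' (\<phi>, j)))\<^sup>2) \<le> K * (\<Sum>a\<in>A. (cmod (\<theta>_coeff c' (\<phi>, a)))\<^sup>2)" for \<phi>
  proof -
    have "(\<Sum>j\<in>A. (cmod (c' (\<phi>, j)))\<^sup>2) = (\<Sum>j\<in>A. (cmod (\<Sum>a\<in>A. \<theta>_coeff c' (\<phi>, a) * Y a j))\<^sup>2)"
      by (intro sum.cong) (simp_all add: \<theta>_coeff_inverse)
    thus ?thesis unfolding K_def using sum_cmod_sq_matrix_le[of "\<lambda>a. \<theta>_coeff c' (\<phi>, a)" Y A A] by simp
  qed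
  hence "(\<Sum>\<phi>\<in>L. \<Sum>a\<in>A. (cmod (c' (\<phi>, a)))\<^sup>2) \<le> (\<Sum>\<phi>\<in>L. K * (\<Sum>a\<in>A. (cmod (\<theta>_coeff c' (\<phi>, a)))\<^sup>2))"
    by (rule sum_mono)
  also have "\<dots> = e_bound * (coset_volume * (\<Sum>\<phi>\<in>L. \<Sum>a\<in>A. (cmod (\<theta>_coeff c' (\<phi>, a)))\<^sup>2))"
    using coset_volume_pos by (simp add: e_bound_def K_def sum_distrib_left[symmetric])
  finally show ?thesis unfolding eq L2_sq_sum_e[OF L] L2_sq_sum_f[OF L] .
qed

lemma f_riesz_basis: "L2_riesz_basis M I f"
  by (rule L2_riesz_basisI[OF countable_I e_L2 f_L2 e_orthonormal e_total f_total
        bounds_nonneg(1) sum_f_le_sum_e bounds_nonneg(2) sum_e_le_sum_f])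

end

context haar_compact_open
begin

lemma riesz_basis_of_characters:
  "\<exists>(I :: nat set) \<psi>. (\<forall>n\<in>I. is_character (\<psi> n)) \<and> L2_riesz_basis M I \<psi>"
proof -
  obtain m where m: "\<And>x. x \<in> \<Omega> \<Longrightarrow> coset (H m) x \<subseteq> \<Omega>"
    using uniform_neighbourhood[OF compact_\<Omega> open_\<Omega> subset_refl] by blast
  obtain A where A: "finite A" "A \<subseteq> \<Omega>" "\<Omega> \<subseteq> (\<Union>a\<in>A. coset (H m) a)"
    "\<And>a b. a \<in> A \<Longrightarrow> b \<in> A \<Longrightarrow> a \<in> coset (H m) b \<Longrightarrow> a = b"
    using finite_coset_cover[OF subgroup open_H compact_\<Omega>, of m] by metis
  have sep: "\<exists>\<phi>\<in>annihilator m. \<phi> a \<noteq> \<phi> b" if "a \<in> A" "b \<in> A" "a \<noteq> b" for a b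
    using annihilator_separates[of a m b] A(4)[OF that(1,2)] that(3) by blast
  obtain \<theta> Y where "\<forall>j\<in>A. \<theta> j \<in> annihilator m" "biorthogonal A \<theta> Y"
    using function_monoid.biorthogonal_family[OF function_monoid_annihilator A(1) sep] by blast
  with m A interpret coset_decomposition X H \<mu> \<Omega> m A \<theta> Y
    by unfold_locales auto
  have bij: "bij_betw (from_nat_into I) (to_nat_on I ` I) I"
    using countable_I by (intro bij_betw_byWitness[where f' = "to_nat_on I"]) auto
  show ?thesis
  proof (intro exI conjI ballI)
    show "L2_riesz_basis M (to_nat_on I ` I) (f \<circ> from_nat_into I)"
      by (rule L2_riesz_basis_reindex[OF bij f_riesz_basis])
    show "is_character ((f \<circ> from_nat_into I) n)" if "n \<in> to_nat_on I ` I" for n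
      using bij_betwE[OF bij] that by (auto intro!: character f_character simp del: from_nat_into_to_nat_on)
  qed
qed

end

section \<open>A character of \<open>\<rat>\<^sub>p\<close> with kernel \<open>\<int>\<^sub>p\<close>\<close>

text \<open>
  The group \<open>\<int>[1/p]\<close>. Modulo \<open>\<int>\<close> it represents all of \<open>\<rat>\<close>, and eventually all of \<open>\<rat>\<^sub>p\<close>, modulo \<open>p\<close>-adic
  integers; composed with \<open>\<lambda>t. cis (2 * pi * t)\<close>, this gives the character.
\<close>

definition p_fractions :: "nat \<Rightarrow> rat set" where
  "p_fractions p = {of_int a / of_nat p ^ k | a k. True}"

lemma p_fractions_diff:
  assumes p: "prime p" and "r \<in> p_fractions p" "s \<in> p_fractions p"
  shows "r - s \<in> p_fractions p"
proof -
  obtain a k b l where rs: "r = of_int a / of_nat p ^ k" "s = of_int b / of_nat p ^ l"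
    using assms(2,3) by (auto simp: p_fractions_def)
  have "r - s = of_int (a * int p ^ l - b * int p ^ k) / of_nat p ^ (k + l)"
    using p by (auto simp: rs field_simps power_add dest: prime_gt_0_nat)
  thus ?thesis unfolding p_fractions_def by blast
qed

lemma padic_abs_Fract_le_1_iff:
  assumes p: "prime p" and ab: "a \<noteq> 0" "b \<noteq> 0"
  shows "padic_abs p (Rat.Fract a b) \<le> 1 \<longleftrightarrow> multiplicity (int p) b \<le> multiplicity (int p) a"
proof -
  have nz: "Rat.Fract a b \<noteq> 0" using ab by (simp add: Zero_rat_def eq_rat)
  have p1: "real p > 1" using p by (auto dest: prime_gt_1_nat)
  have "real p powi k \<le> 1 \<longleftrightarrow> k \<le> 0" for k
    using power_int_le_imp_le_exp[of "real p" k 0] power_int_increasing[of k 0 "real p"] p1 by auto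
  thus ?thesis using nz by (simp add: padic_abs_def padic_val_Fract[OF p ab])
qed

lemma padic_abs_of_int_le_1: "prime p \<Longrightarrow> padic_abs p (of_int a) \<le> 1"
  using padic_abs_Fract_le_1_iff[of p a 1] by (cases "a = 0") (auto simp: Fract_of_int_eq)

lemma p_fractions_padic_abs_le_1:
  assumes p: "prime p" and r: "r \<in> p_fractions p" and le: "padic_abs p r \<le> 1"
  shows "r \<in> \<int>"
proof -
  obtain a k where r: "r = of_int a / of_nat p ^ k" using r by (auto simp: p_fractions_def)
  hence rF: "r = Rat.Fract a (int p ^ k)" by (simp add: Fract_of_int_quotient)
  have p0: "int p ^ k \<noteq> 0" using p by (auto dest: prime_gt_0_nat)
  show ?thesis
  proof (cases "a = 0")
    case False
    have "multiplicity (int p) (int p ^ k) \<le> multiplicity (int p) a"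
      using padic_abs_Fract_le_1_iff[OF p False p0] le rF by simp
    moreover have "multiplicity (int p) (int p ^ k) = k"
      using p by (intro multiplicity_same_power) (auto dest: prime_gt_0_nat)
    ultimately have "int p ^ k dvd a" by (simp add: multiplicity_dvd')
    then obtain b where "a = int p ^ k * b" by (rule dvdE)
    hence "r = of_int b" using p by (auto simp: r dest: prime_gt_0_nat)
    thus ?thesis by simp
  qed (simp add: r)
qed

text \<open>
  Partial fractions: writing the denominator as \<open>p ^ k * d\<close> with \<open>d\<close> prime to \<open>p\<close>, Bezout's identity
  splits off a summand with denominator \<open>d\<close>, which is a \<open>p\<close>-adic integer.
\<close>

lemma p_fraction_approx:
  assumes p: "prime p"
  shows "\<exists>r\<in>p_fractions p. padic_abs p (q - r) \<le> 1"
proof -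
  obtain c e where q: "q = Rat.Fract c e" "e > 0" by (cases q) auto
  have "\<not> is_unit (int p)" "e \<noteq> 0" using p q by (auto simp: prime_nat_iff)
  then obtain d where e: "e = int p ^ multiplicity (int p) e * d" "\<not> int p dvd d"
    using multiplicity_decompose'[of e "int p"] by metis
  define k where "k = multiplicity (int p) e"
  have d0: "d \<noteq> 0" using e(2) by auto
  have "coprime (int p) d" using e(2) p by (intro prime_imp_coprime) auto
  hence "coprime (int p ^ k) d" by simp
  hence "gcd (int p ^ k) d = 1" by simp
  then obtain u v where uv: "u * int p ^ k + v * d = 1"
    using bezout_int[of "int p ^ k" d] by metis
  define r :: rat where "r = of_int (c * v) / of_nat p ^ k"
  have pk: "(of_nat p :: rat) ^ k \<noteq> 0" using p by (auto dest: prime_gt_0_nat)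
  have uv': "(of_int u * of_nat p ^ k + of_int v * of_int d :: rat) = 1"
    using arg_cong[OF uv, of "of_int :: int \<Rightarrow> rat"] by simp
  have eR: "(of_int e :: rat) = of_nat p ^ k * of_int d"
    using arg_cong[OF e(1), of "of_int :: int \<Rightarrow> rat"] by (simp add: k_def)
  have "q = of_int c * (of_int u * of_nat p ^ k + of_int v * of_int d) / (of_nat p ^ k * of_int d)"
    unfolding uv' by (simp add: q Fract_of_int_quotient eR)
  hence qr: "q - r = Rat.Fract (c * u) d"
    using pk d0 prime_gt_0_nat[OF p] by (simp add: r_def Fract_of_int_quotient field_simps)
  have "padic_abs p (q - r) \<le> 1"
  proof (cases "c * u = 0")
    case True
    show ?thesis unfolding qr True by (simp add: rat_number_collapse)
  next
    case False
    thus ?thesis unfolding qr using e(2)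
      by (simp add: padic_abs_Fract_le_1_iff[OF p _ d0] not_dvd_imp_multiplicity_0)
  qed
  moreover have "r \<in> p_fractions p" unfolding p_fractions_def r_def by blast
  ultimately show ?thesis by blast
qed

definition p_part :: "nat \<Rightarrow> rat \<Rightarrow> rat" where
  "p_part p q = (SOME r. r \<in> p_fractions p \<and> padic_abs p (q - r) \<le> 1)"

lemma p_part:
  assumes "prime p"
  shows "p_part p q \<in> p_fractions p" "padic_abs p (q - p_part p q) \<le> 1"
  using someI_ex[of "\<lambda>r. r \<in> p_fractions p \<and> padic_abs p (q - r) \<le> 1"] p_fraction_approx[OF assms, of q]
  unfolding p_part_def by blast+

definition rat_char :: "nat \<Rightarrow> rat \<Rightarrow> complex" where
  "rat_char p q = cis (2 * pi * of_rat (p_part p q))"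

lemma norm_rat_char [simp]: "cmod (rat_char p q) = 1"
  by (simp add: rat_char_def)

lemma cis_2pi_eq_1_iff: "cis (2 * pi * of_rat r) = 1 \<longleftrightarrow> r \<in> \<int>"
proof
  assume "cis (2 * pi * of_rat r) = 1"
  hence "cos (2 * pi * of_rat r) = 1" by (metis cis.simps(1) one_complex.sel(1))
  then obtain n where "2 * pi * of_rat r = of_int n * 2 * pi" using cos_one_2pi_int by blast
  hence "of_rat r = (of_int n :: real)" by simp
  hence "r = of_int n" by (metis of_rat_of_int_eq of_rat_eq_iff)
  thus "r \<in> \<int>" by simp
next
  assume "r \<in> \<int>"
  then obtain n where "r = of_int n" by (rule Ints_cases)
  thus "cis (2 * pi * of_rat r) = 1" by (simp add: cis_multiple_2pi)
qed

lemma rat_char_eq_1_iff: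
  assumes p: "prime p"
  shows "rat_char p q = 1 \<longleftrightarrow> padic_abs p q \<le> 1"
  unfolding rat_char_def cis_2pi_eq_1_iff
proof
  assume "p_part p q \<in> \<int>"
  then obtain n where "p_part p q = of_int n" by (rule Ints_cases)
  thus "padic_abs p q \<le> 1"
    using padic_abs_add_le_max[OF p, of "q - p_part p q" "p_part p q"] p_part(2)[OF p, of q]
      padic_abs_of_int_le_1[OF p, of n] by simp
next
  assume "padic_abs p q \<le> 1"
  hence "padic_abs p (p_part p q) \<le> 1"
    using padic_abs_add_le_max[OF p, of "p_part p q - q" q] p_part(2)[OF p, of q]
    by (simp add: padic_abs_minus_commute[OF p, of "p_part p q"])
  thus "p_part p q \<in> \<int>" by (intro p_fractions_padic_abs_le_1[OF p] p_part p)
qed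

text \<open>
  The defect of additivity of \<open>p_part\<close> is at once a \<open>p\<close>-adic integer and an element of \<open>\<int>[1/p]\<close>, hence an
  integer.
\<close>

lemma rat_char_add:
  assumes p: "prime p"
  shows "rat_char p (q + r) = rat_char p q * rat_char p r"
proof -
  let ?P = "p_part p"
  define s where "s = ?P (q + r) - ?P q - ?P r"
  have "s = ((q - ?P q) + (r - ?P r)) + (?P (q + r) - (q + r))" by (simp add: s_def)
  also have "padic_abs p \<dots> \<le> 1"
    using padic_abs_add_le_max[OF p, of "(q - ?P q) + (r - ?P r)" "?P (q + r) - (q + r)"]
      padic_abs_add_le_max[OF p, of "q - ?P q" "r - ?P r"] p_part(2)[OF p, of q] p_part(2)[OF p, of r]
      p_part(2)[OF p, of "q + r"] padic_abs_minus_commute[OF p, of "?P (q + r)" "q + r"]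
    by linarith
  finally have "s \<in> \<int>"
    unfolding s_def by (intro p_fractions_padic_abs_le_1[OF p] p_fractions_diff p_part p)
  hence 1: "cis (2 * pi * of_rat s) = 1" by (simp only: cis_2pi_eq_1_iff)
  have "?P (q + r) = ?P q + ?P r + s" by (simp add: s_def)
  hence "rat_char p (q + r) = cis (2 * pi * of_rat (?P q)) * cis (2 * pi * of_rat (?P r)) * cis (2 * pi * of_rat s)"
    by (simp add: rat_char_def of_rat_add distrib_left cis_mult)
  thus ?thesis by (simp add: 1 rat_char_def)
qed

lemma rat_char_cong:
  assumes p: "prime p" and "padic_abs p (q - r) \<le> 1"
  shows "rat_char p q = rat_char p r"
  using rat_char_add[OF p, of "q - r" r] rat_char_eq_1_iff[OF p, of "q - r"] assms by simp

text \<open>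
  The terms of a Cauchy sequence eventually differ by \<open>p\<close>-adic integers, so \<open>rat_char\<close> is eventually
  constant along it and the limit is attained.
\<close>

lift_definition padic_seq_char :: "'p::prime_card padic_seq \<Rightarrow> complex"
  is "\<lambda>X. lim (\<lambda>n. rat_char CARD('p) (X n))" .

lemma eventually_padic_seq_char:
  fixes X :: "'p::prime_card padic_seq"
  shows "eventually (\<lambda>n. rat_char CARD('p) (Rep_padic_seq X n) = padic_seq_char X) sequentially"
proof -
  let ?r = "rat_char CARD('p)"
  have "padic_Cauchy CARD('p) (Rep_padic_seq X)" using Rep_padic_seq[of X] by simp
  then obtain N where "\<And>m n. m \<ge> N \<Longrightarrow> n \<ge> N \<Longrightarrow> padic_abs CARD('p) (Rep_padic_seq X m - Rep_padic_seq X n) < 1"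
    unfolding padic_Cauchy_def by (meson zero_less_one)
  hence "?r (Rep_padic_seq X n) = ?r (Rep_padic_seq X N)" if "n \<ge> N" for n
    using that by (intro rat_char_cong prime_card) (meson le_refl less_imp_le)
  hence ev: "eventually (\<lambda>n. ?r (Rep_padic_seq X n) = ?r (Rep_padic_seq X N)) sequentially"
    by (rule eventually_sequentiallyI)
  hence "padic_seq_char X = ?r (Rep_padic_seq X N)"
    unfolding padic_seq_char.rep_eq by (intro limI tendsto_eventually)
  with ev show ?thesis by simp
qed

lemma norm_padic_seq_char [simp]: "cmod (padic_seq_char X) = 1"
proof -
  obtain n where "rat_char CARD('a) (Rep_padic_seq X n) = padic_seq_char X"
    using eventually_happens'[OF sequentially_bot eventually_padic_seq_char[of X]] by blast
  thus ?thesis by (metis norm_rat_char)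
qed

lemma padic_seq_char_add:
  fixes X Y :: "'p::prime_card padic_seq"
  shows "padic_seq_char (X + Y) = padic_seq_char X * padic_seq_char Y"
proof -
  have "eventually (\<lambda>n. padic_seq_char (X + Y) = padic_seq_char X * padic_seq_char Y) sequentially"
    using eventually_padic_seq_char[of X] eventually_padic_seq_char[of Y] eventually_padic_seq_char[of "X + Y"]
    by eventually_elim (metis plus_padic_seq.rep_eq rat_char_add[OF prime_card])
  thus ?thesis by simp
qed

text \<open>
  The absolute value only takes powers of \<open>p\<close> as nonzero values. This discreteness lets a limit of absolute values
  that is at most 1 force the terms to be at most 1 eventually.
\<close>

lemma padic_abs_less_imp_le_1:
  assumes p: "prime p" and "padic_abs p q < real p"
  shows "padic_abs p q \<le> 1"
proof (cases "q = 0")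
  case False
  have p1: "real p > 1" using p by (auto dest: prime_gt_1_nat)
  have "real p powi (- padic_val p q) < real p powi 1" using assms(2) False by (simp add: padic_abs_def)
  hence "- padic_val p q < 1" using p1 power_int_increasing[of 1 "- padic_val p q" "real p"] by linarith
  hence "real p powi (- padic_val p q) \<le> real p powi 0" using p1 by (intro power_int_increasing) auto
  thus ?thesis using False by (simp add: padic_abs_def)
qed simp

lemma padic_seq_char_eq_1_iff: "padic_seq_char X = 1 \<longleftrightarrow> padic_seq_abs X \<le> 1"
  for X :: "'p::prime_card padic_seq"
proof
  let ?N = "padic_abs CARD('p)"
  assume "padic_seq_char X = 1"
  hence "eventually (\<lambda>n. ?N (Rep_padic_seq X n) \<le> 1) sequentially"
    using eventually_padic_seq_char[of X] by (simp add: rat_char_eq_1_iff[OF prime_card])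
  thus "padic_seq_abs X \<le> 1" by (intro tendsto_upperbound[OF padic_seq_abs_tendsto]) auto
next
  let ?N = "padic_abs CARD('p)"
  assume "padic_seq_abs X \<le> 1"
  \<comment> \<open>There is a gap between \<open>1\<close> and \<open>p\<close> in the values of the absolute value.\<close>
  also have "1 < real CARD('p)" using prime_gt_1_nat[OF prime_card[where 'a='p]] by simp
  finally have "eventually (\<lambda>n. ?N (Rep_padic_seq X n) < real CARD('p)) sequentially"
    by (rule order_tendstoD(2)[OF padic_seq_abs_tendsto])
  hence "eventually (\<lambda>n. padic_seq_char X = 1) sequentially"
    using eventually_padic_seq_char[of X]
  proof eventually_elim
    case (elim n)
    have "?N (Rep_padic_seq X n) \<le> 1" by (rule padic_abs_less_imp_le_1[OF prime_card elim(1)])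
    thus ?case using elim(2) by (simp add: rat_char_eq_1_iff[OF prime_card, symmetric])
  qed
  thus "padic_seq_char X = 1" by simp
qed

lift_definition padic_char :: "'p::prime_card padic \<Rightarrow> complex" is padic_seq_char
proof -
  fix X Y :: "'p padic_seq" assume "padic_rel X Y"
  hence "padic_seq_abs (X - Y) = 0" by (simp add: padic_rel_def padic_seq_abs_eq_0_iff)
  hence "padic_seq_char (X - Y) = 1" by (simp add: padic_seq_char_eq_1_iff)
  thus "padic_seq_char X = padic_seq_char Y" using padic_seq_char_add[of "X - Y" Y] by simp
qed

lemma norm_padic_char [simp]: "cmod (padic_char x) = 1"
  by transfer simp

lemma padic_char_add: "padic_char (x + y) = padic_char x * padic_char y"
  by transfer (rule padic_seq_char_add)

lemma padic_char_eq_1_iff: "padic_char x = 1 \<longleftrightarrow> padic_norm x \<le> 1"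
  by transfer (rule padic_seq_char_eq_1_iff)

lemma padic_norm_zero [simp]: "padic_norm 0 = 0"
  by (simp only: padic_norm_eq_0_iff)

lemma padic_norm_one: "padic_norm (1 :: 'p::prime_card padic) = 1"
  using padic_norm_mult[of "1 :: 'p padic" 1] by simp

lemma padic_norm_p: "padic_norm (of_nat CARD('p) :: 'p::prime_card padic) = 1 / CARD('p)"
proof -
  let ?p = "CARD('p)"
  have p: "prime ?p" by (rule prime_card)
  have "padic_val ?p (of_nat ?p) = padic_val ?p (Rat.Fract (int ?p) 1)"
    by (simp add: Fract_of_int_quotient)
  also have "\<dots> = 1"
    using p by (subst padic_val_Fract) (auto simp: prime_gt_0_nat multiplicity_self prime_nat_iff)
  finally have "padic_val ?p (of_nat ?p) = 1" .
  thus ?thesis using p by (simp add: padic_norm_of_nat padic_abs_def field_simps power_int_minus prime_gt_0_nat)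
qed

section \<open>Balls and characters of \<open>\<rat>\<^sub>p\<^sup>d\<close>\<close>

definition padic_scale :: "nat \<Rightarrow> 'p::prime_card padic" where
  "padic_scale n = inverse (of_nat CARD('p)) ^ n"

lemma padic_norm_scale: "padic_norm (padic_scale n :: 'p::prime_card padic) = real CARD('p) ^ n"
proof -
  let ?p = "of_nat CARD('p) :: 'p padic"
  have P: "real CARD('p) > 0" using prime_gt_0_nat[OF prime_card[where 'a='p]] by simp
  hence "?p \<noteq> 0" using padic_norm_p[where 'p='p] by auto
  hence "padic_norm ?p * padic_norm (inverse ?p) = 1"
    using padic_norm_mult[of ?p "inverse ?p"] by (simp add: padic_norm_one)
  hence "padic_norm (inverse ?p) = real CARD('p)" using P by (simp add: padic_norm_p field_simps)
  thus ?thesis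
    unfolding padic_scale_def by (induction n) (simp_all add: padic_norm_one padic_norm_mult)
qed

text \<open>
  The ball of radius \<open>p ^ -n\<close> in the maximum norm, written through \<open>padic_scale\<close> so that
  \<open>padic_char_eq_1_iff\<close> applies literally.
\<close>

definition padic_ball :: "nat \<Rightarrow> ('p::prime_card padic ^ 'd) set" where
  "padic_ball n = {x. \<forall>i. padic_norm (padic_scale n * x $ i) \<le> 1}"

lemma padic_ball_iff:
  "x \<in> (padic_ball n :: ('p::prime_card padic ^ 'd) set) \<longleftrightarrow> (\<forall>i. padic_norm (x $ i) \<le> (1 / CARD('p)) ^ n)"
  using prime_gt_0_nat[OF prime_card[where 'a='p]]
  by (simp add: padic_ball_def padic_norm_mult padic_norm_scale field_simps power_divide)

lemma padic_ball_zero: "0 \<in> padic_ball n"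
  by (simp add: padic_ball_def)

lemma padic_ball_minus: "x \<in> padic_ball n \<Longrightarrow> - x \<in> padic_ball n"
  by (simp add: padic_ball_def)

lemma padic_ball_add: "x \<in> padic_ball n \<Longrightarrow> y \<in> padic_ball n \<Longrightarrow> x + y \<in> padic_ball n"
  unfolding padic_ball_iff
proof (intro allI)
  fix i assume "\<forall>i. padic_norm (x $ i) \<le> (1 / real CARD('a)) ^ n" "\<forall>i. padic_norm (y $ i) \<le> (1 / real CARD('a)) ^ n"
  hence "max (padic_norm (x $ i)) (padic_norm (y $ i)) \<le> (1 / real CARD('a)) ^ n" by simp
  thus "padic_norm ((x + y) $ i) \<le> (1 / real CARD('a)) ^ n"
    using order_trans[OF padic_norm_add_le_max[of "x $ i" "y $ i"]] by simp
qed

lemma open_padic_ball: "open (padic_ball n :: ('p::prime_card padic ^ 'd) set)"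
  unfolding open_vec_def
proof (intro ballI exI conjI allI impI)
  let ?\<epsilon> = "(1 / CARD('p)) ^ n :: real"
  have \<epsilon>: "?\<epsilon> > 0" using prime_gt_0_nat[OF prime_card[where 'a='p]] by simp
  fix x :: "'p padic ^ 'd" assume x: "x \<in> padic_ball n"
  show "open (ball (x $ i) ?\<epsilon>)" "x $ i \<in> ball (x $ i) ?\<epsilon>" for i using \<epsilon> by auto
  fix y assume y: "\<forall>i. y $ i \<in> ball (x $ i) ?\<epsilon>"
  have "padic_norm (y $ i) \<le> ?\<epsilon>" for i
  proof -
    have "padic_norm (y $ i - x $ i) \<le> ?\<epsilon>"
      using y[rule_format, of i] padic_norm_minus[of "x $ i - y $ i"] by (simp add: dist_padic_def)
    thus ?thesis
      using padic_norm_add_le_max[of "y $ i - x $ i" "x $ i"] x by (simp add: padic_ball_iff) (smt (verit))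
  qed
  thus "y \<in> padic_ball n" by (simp add: padic_ball_iff)
qed

lemma padic_ball_basis:
  assumes "open U" "0 \<in> U"
  shows "\<exists>n. (padic_ball n :: ('p::prime_card padic ^ 'd) set) \<subseteq> U"
proof -
  obtain A where A: "\<And>i. open (A i)" "\<And>i. 0 \<in> A i" "\<And>y. (\<forall>i. y $ i \<in> A i) \<Longrightarrow> y \<in> U"
    using assms unfolding open_vec_def by (metis zero_index)
  have "\<exists>e>0. \<forall>y. dist y 0 < e \<longrightarrow> y \<in> A i" for i
    using A(1,2)[of i] unfolding open_dist by blast
  then obtain e where e: "\<And>i. e i > 0" "\<And>i y. dist y 0 < e i \<Longrightarrow> y \<in> A i" by metis
  define \<epsilon> where "\<epsilon> = Min (range e)"
  have \<epsilon>: "\<epsilon> > 0" "\<And>i. \<epsilon> \<le> e i" using e(1) by (auto simp: \<epsilon>_def)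
  have "1 / real CARD('p) < 1" using prime_gt_1_nat[OF prime_card[where 'a='p]] by simp
  then obtain n where n: "(1 / real CARD('p)) ^ n < \<epsilon>" using \<epsilon>(1) real_arch_pow_inv by blast
  have "x \<in> U" if "x \<in> padic_ball n" for x :: "'p padic ^ 'd"
  proof (intro A(3) allI e(2))
    fix i
    have "padic_norm (x $ i) \<le> (1 / real CARD('p)) ^ n" using that by (simp add: padic_ball_iff)
    also have "\<dots> < e i" using n \<epsilon>(2)[of i] by simp
    finally show "dist (x $ i) 0 < e i" by (simp add: dist_padic_def)
  qed
  thus ?thesis by blast
qed

text \<open>
  All finite products of the characters \<open>\<lambda>x. padic_char (padic_scale n * x $ i)\<close>. Indexing the products by lists makes
  countability and closure under multiplication evident.
\<close>

definition padic_chars :: "('p::prime_card padic ^ 'd \<Rightarrow> complex) set" where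
  "padic_chars = range (\<lambda>l x. \<Prod>(n, i)\<leftarrow>l. padic_char (padic_scale n * x $ i))"

lemma is_character_one: "is_character (\<lambda>x. 1)"
  by (simp add: is_character_def)

lemma is_character_mult: "is_character \<phi> \<Longrightarrow> is_character \<psi> \<Longrightarrow> is_character (\<lambda>x. \<phi> x * \<psi> x)"
  by (auto simp: is_character_def norm_mult intro!: continuous_intros)

text \<open>Such a homomorphism is locally constant: it takes the value \<open>\<phi> x\<close> on \<open>x + H\<close>.\<close>

lemma is_character_open_kernel:
  fixes \<phi> :: "'a::topological_ab_group_add \<Rightarrow> complex"
  assumes norm: "\<And>x. cmod (\<phi> x) = 1" and add: "\<And>x y. \<phi> (x + y) = \<phi> x * \<phi> y"
    and H: "open H" "0 \<in> H" "\<And>x. x \<in> H \<Longrightarrow> \<phi> x = 1"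
  shows "is_character \<phi>"
proof -
  have "(\<phi> \<longlongrightarrow> \<phi> x) (at x)" for x
  proof -
    have "((\<lambda>y. y - x) \<longlongrightarrow> x - x) (nhds x)" by (intro tendsto_intros filterlim_ident)
    hence "eventually (\<lambda>y. y - x \<in> H) (nhds x)" using H(1,2) by (auto dest!: topological_tendstoD)
    hence "eventually (\<lambda>y. \<phi> y = \<phi> x) (nhds x)"
    proof eventually_elim
      case (elim y)
      thus ?case using add[of "y - x" x] H(3) by simp
    qed
    thus ?thesis
      by (intro tendsto_eventually) (auto simp: eventually_at_filter elim: eventually_mono)
  qed
  thus ?thesis using norm add by (simp add: is_character_def continuous_on_def)
qed

lemma padic_char_coordinate:
  fixes i :: "'d::finite"
  shows "is_character (\<lambda>x :: 'p::prime_card padic ^ 'd. padic_char (padic_scale n * x $ i))"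
proof (rule is_character_open_kernel[OF _ _ open_padic_ball padic_ball_zero])
  show "padic_char (padic_scale n * x $ i) = 1" if "x \<in> padic_ball n" for x :: "'p padic ^ 'd"
    using that by (simp add: padic_char_eq_1_iff padic_ball_def)
qed (simp_all add: distrib_left padic_char_add)

lemma is_character_padic_chars:
  fixes \<phi> :: "'p::prime_card padic ^ 'd \<Rightarrow> complex"
  assumes "\<phi> \<in> padic_chars"
  shows "is_character \<phi>"
proof -
  have "is_character (\<lambda>x :: 'p padic ^ 'd. \<Prod>(n, i)\<leftarrow>l. padic_char (padic_scale n * x $ i))" for l
    by (induction l) (auto simp: is_character_one intro!: is_character_mult padic_char_coordinate)
  thus ?thesis using assms by (auto simp: padic_chars_def)
qed

lemma countable_padic_chars: "countable padic_chars"
  unfolding padic_chars_def by (rule countable_image) simp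

lemma function_monoid_padic_chars: "function_monoid padic_chars"
proof
  show "(\<lambda>x. 1) \<in> padic_chars" unfolding padic_chars_def by (rule range_eqI[of _ _ "[]"]) simp
  fix \<phi> \<phi>' :: "'p::prime_card padic ^ 'd \<Rightarrow> complex"
  assume "\<phi> \<in> padic_chars" "\<phi>' \<in> padic_chars"
  then obtain l l' where "\<phi> = (\<lambda>x. \<Prod>(n, i)\<leftarrow>l. padic_char (padic_scale n * x $ i))"
    "\<phi>' = (\<lambda>x. \<Prod>(n, i)\<leftarrow>l'. padic_char (padic_scale n * x $ i))" by (auto simp: padic_chars_def)
  thus "(\<lambda>x. \<phi> x * \<phi>' x) \<in> padic_chars"
    unfolding padic_chars_def by (intro range_eqI[of _ _ "l @ l'"]) simp
qed

lemma padic_chars_separate: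
  assumes "x \<notin> padic_ball n"
  shows "\<exists>\<phi>\<in>padic_chars. (\<forall>y\<in>padic_ball n. \<phi> y = 1) \<and> \<phi> x \<noteq> 1"
proof -
  obtain i where i: "\<not> padic_norm (padic_scale n * x $ i) \<le> 1" using assms by (auto simp: padic_ball_def)
  show ?thesis
  proof (intro bexI conjI)
    show "(\<lambda>x. padic_char (padic_scale n * x $ i)) \<in> padic_chars"
      unfolding padic_chars_def by (rule range_eqI[of _ _ "[(n, i)]"]) simp
  qed (use i in \<open>auto simp: padic_char_eq_1_iff padic_ball_def\<close>)
qed

interpretation padic: separated_group
  "padic_chars :: ('p::prime_card padic ^ 'd \<Rightarrow> complex) set" padic_ball
proof (rule separated_group.intro)
  show "additive_subgroup (padic_ball n :: ('p padic ^ 'd) set)" for n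
    by (rule additive_subgroup.intro) (auto intro: padic_ball_zero padic_ball_add padic_ball_minus)
  show "function_monoid (padic_chars :: ('p padic ^ 'd \<Rightarrow> complex) set)"
    by (rule function_monoid_padic_chars)
qed (auto intro: countable_padic_chars is_character_padic_chars open_padic_ball padic_ball_basis
    padic_chars_separate)

lemma L2_riesz_basis_empty:
  assumes "space M = {}"
  shows "L2_riesz_basis M {} f"
proof -
  have "L2_sq M u = L2_sq M (\<lambda>x. 0)" for u using assms by (intro L2_sq_cong) auto
  hence 0: "L2_sq M u = 0" for u by (simp add: L2_sq_def)
  have "L2_total M {} f" unfolding L2_total_def by (simp add: 0)
  thus ?thesis by (intro L2_riesz_basisI[where e = f and C = 0 and C' = 0]) (auto simp: 0)
qed

theorem corollary1p2:
  fixes \<mu> :: "('p::prime_card padic ^ 'd) measure"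
    and \<Omega> :: "('p padic ^ 'd) set"
  assumes "is_haar_measure \<mu>"
    and "compact \<Omega>" and "open \<Omega>"
  shows "\<exists>(I :: nat set) \<psi>. (\<forall>n\<in>I. is_character (\<psi> n)) \<and>
           L2_riesz_basis (restrict_space \<mu> \<Omega>) I \<psi>"
proof (cases "\<Omega> = {}")
  case True
  have "L2_riesz_basis (restrict_space \<mu> \<Omega>) {} (\<lambda>n :: nat. \<lambda>x. 1)"
    by (rule L2_riesz_basis_empty) (simp add: space_restrict_space True)
  thus ?thesis by blast
next
  case False
  interpret haar_compact_open "padic_chars :: ('p padic ^ 'd \<Rightarrow> complex) set" padic_ball \<mu> \<Omega>
    by unfold_locales (use assms False in auto)
  show ?thesis by (rule riesz_basis_of_characters)
qed

end
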